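(* Let $\mathcal{B}$ be a $C^*$-algebra and let $E$ be a faithful $C^*$-correspondence over $\mathcal{B}$. Then $E$ admits a faithful nondegenerate representation $(\pi,\eta)$ on some Hilbert space.
   Context: A ($C^*$-)correspondence $E$ over $\mathcal{B}$ is a Hilbert $\mathcal{B}$-module with a nondegenerate left action of $\mathcal{B}$ by adjointable operators ($\overline{\mathrm{span}}\,\mathcal{B}E=E$). It is faithful if the left action $\mathcal{B}\to B^a(E)$ is injective. $E$ is not assumed full and $\mathcal{B}$ is not assumed unital. A representation of $E$ on a Hilbert space $G$ is a pair $(\pi,\eta)$, where $\pi:\mathcal{B}\to B(G)$ is a nondegenerate representation and $\eta:E\to B(G)$ is a linear map with $\eta(bxb')=\pi(b)\eta(x)\pi(b')$ and $\eta(x)^*\eta(y)=\pi(\langle x,y\rangle)$. It is nondegenerate if $\overline{\mathrm{span}}\,\eta(E)G=G$, and faithful if $\pi$ is injective (then $\eta$ is injective, too). *)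

theory Defs
  imports "HOL-Analysis.Analysis" "HOL-Library.Function_Algebras"
begin

class complex_vector = ab_group_add +
  fixes scaleC :: "complex \<Rightarrow> 'a \<Rightarrow> 'a"  (infixr "*\<^sub>C" 75)
  assumes scaleC_add_right: "z *\<^sub>C (x + y) = z *\<^sub>C x + z *\<^sub>C y"
    and scaleC_add_left: "(z + w) *\<^sub>C x = z *\<^sub>C x + w *\<^sub>C x"
    and scaleC_scaleC: "z *\<^sub>C (w *\<^sub>C x) = (z * w) *\<^sub>C x"
    and scaleC_one: "1 *\<^sub>C x = x"

global_interpretation complex_vector:
  vector_space "scaleC :: complex \<Rightarrow> 'a \<Rightarrow> 'a::complex_vector"
  by unfold_locales (fact scaleC_add_right scaleC_add_left scaleC_scaleC scaleC_one)+

instantiation complex :: complex_vector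
begin
definition scaleC_complex :: "complex \<Rightarrow> complex \<Rightarrow> complex"
  where "scaleC_complex z x = z * x"
instance
  by standard (simp_all add: scaleC_complex_def algebra_simps)
end

instantiation "fun" :: (type, complex_vector) complex_vector
begin
definition scaleC_fun :: "complex \<Rightarrow> ('a \<Rightarrow> 'b) \<Rightarrow> 'a \<Rightarrow> 'b"
  where "scaleC_fun z f = (\<lambda>i. z *\<^sub>C f i)"
instance
  by standard
    (simp_all add: scaleC_fun_def fun_eq_iff scaleC_add_right scaleC_add_left scaleC_scaleC scaleC_one)
end

text \<open>No unit is assumed, and the zero algebra is allowed.\<close>

class cstar_algebra = real_normed_algebra + banach + complex_vector +
  fixes star :: "'a \<Rightarrow> 'a"
  assumes scaleR_scaleC: "r *\<^sub>R a = complex_of_real r *\<^sub>C a"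
    and norm_scaleC: "norm (z *\<^sub>C a) = cmod z * norm a"
    and mult_scaleC_left: "(z *\<^sub>C a) * b = z *\<^sub>C (a * b)"
    and mult_scaleC_right: "a * (z *\<^sub>C b) = z *\<^sub>C (a * b)"
    and star_star: "star (star a) = a"
    and star_add: "star (a + b) = star a + star b"
    and star_scaleC: "star (z *\<^sub>C a) = cnj z *\<^sub>C star a"
    and star_mult: "star (a * b) = star b * star a"
    and cstar_identity: "norm (star a * a) = (norm a)\<^sup>2"

definition cstar_positive :: "'b::cstar_algebra \<Rightarrow> bool"
  where "cstar_positive a \<longleftrightarrow> (\<exists>c. a = star c * c)"

text \<open>Completeness and closed linear spans inside a carrier set \<open>V\<close>, relative to a norm
  \<open>nrm\<close> on \<open>V\<close> that need not be the one of a type class.\<close>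

definition complete_in :: "'v::ab_group_add set \<Rightarrow> ('v \<Rightarrow> real) \<Rightarrow> bool"
  where "complete_in V nrm \<longleftrightarrow>
    (\<forall>X. (\<forall>n. X n \<in> V) \<and> (\<forall>e>0. \<exists>N. \<forall>m\<ge>N. \<forall>n\<ge>N. nrm (X m - X n) < e) \<longrightarrow>
      (\<exists>l\<in>V. (\<lambda>n::nat. nrm (X n - l)) \<longlonglongrightarrow> 0))"

definition closed_span :: "'v::complex_vector set \<Rightarrow> ('v \<Rightarrow> real) \<Rightarrow> 'v set \<Rightarrow> 'v set"
  where "closed_span V nrm S =
    {v \<in> V. \<forall>e>0. \<exists>u\<in>complex_vector.span S. nrm (v - u) < e}"

text \<open>All inner products are linear in the second argument.\<close>

locale hilbert_module =
  fixes ract :: "'e::complex_vector \<Rightarrow> 'b::cstar_algebra \<Rightarrow> 'e"  (infixl "\<cdot>" 70)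
    and ip :: "'e \<Rightarrow> 'e \<Rightarrow> 'b"
  assumes ract_add_left: "(x + y) \<cdot> b = x \<cdot> b + y \<cdot> b"
    and ract_add_right: "x \<cdot> (b + c) = x \<cdot> b + x \<cdot> c"
    and ract_scaleC_left: "(z *\<^sub>C x) \<cdot> b = z *\<^sub>C (x \<cdot> b)"
    and ract_scaleC_right: "x \<cdot> (z *\<^sub>C b) = z *\<^sub>C (x \<cdot> b)"
    and ract_mult: "x \<cdot> (b * c) = (x \<cdot> b) \<cdot> c"
    and ip_add_right: "ip x (y + y') = ip x y + ip x y'"
    and ip_scaleC_right: "ip x (z *\<^sub>C y) = z *\<^sub>C ip x y"
    and ip_ract: "ip x (y \<cdot> b) = ip x y * b"
    and ip_star: "star (ip x y) = ip y x"
    and ip_positive: "cstar_positive (ip x x)"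
    and ip_definite: "ip x x = 0 \<Longrightarrow> x = 0"
    and complete_module: "complete_in UNIV (\<lambda>x. sqrt (norm (ip x x)))"

text \<open>The left action is a *-homomorphism into the adjointable operators. As usual, an operator
  with an adjoint is automatically linear, bounded and right linear over the algebra, so these
  properties of \<open>lact b\<close> are not listed.\<close>

locale correspondence = hilbert_module ract ip
  for ract :: "'e::complex_vector \<Rightarrow> 'b::cstar_algebra \<Rightarrow> 'e"  (infixl "\<cdot>" 70)
    and ip :: "'e \<Rightarrow> 'e \<Rightarrow> 'b" +
  fixes lact :: "'b \<Rightarrow> 'e \<Rightarrow> 'e"
  assumes lact_add: "lact (b + c) x = lact b x + lact c x"
    and lact_scaleC: "lact (z *\<^sub>C b) x = z *\<^sub>C lact b x"
    and lact_mult: "lact (b * c) x = lact b (lact c x)"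
    and lact_star: "ip (lact b x) y = ip x (lact (star b) y)"
    and lact_nondegenerate:
      "closed_span UNIV (\<lambda>x. sqrt (norm (ip x x))) {lact b x |b x. True} = UNIV"

locale faithful_correspondence = correspondence +
  assumes lact_faithful: "inj lact"

definition hnorm :: "('g \<Rightarrow> 'g \<Rightarrow> complex) \<Rightarrow> 'g \<Rightarrow> real"
  where "hnorm ipG v = sqrt (Re (ipG v v))"

text \<open>A Hilbert space is given by a linear subspace \<open>G\<close> of an ambient complex vector space and
  an inner product on \<open>G\<close>; the ambient space itself carries no topology.\<close>

locale hilbert_space =
  fixes G :: "'g::complex_vector set"
    and ipG :: "'g \<Rightarrow> 'g \<Rightarrow> complex"
  assumes subspace: "complex_vector.subspace G"
    and ipG_add_right: "\<lbrakk>u \<in> G; v \<in> G; w \<in> G\<rbrakk> \<Longrightarrow> ipG u (v + w) = ipG u v + ipG u w"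
    and ipG_scaleC_right: "\<lbrakk>u \<in> G; v \<in> G\<rbrakk> \<Longrightarrow> ipG u (z *\<^sub>C v) = z * ipG u v"
    and ipG_cnj: "\<lbrakk>u \<in> G; v \<in> G\<rbrakk> \<Longrightarrow> cnj (ipG u v) = ipG v u"
    and ipG_nonneg: "u \<in> G \<Longrightarrow> 0 \<le> Re (ipG u u)"
    and ipG_definite: "\<lbrakk>u \<in> G; ipG u u = 0\<rbrakk> \<Longrightarrow> u = 0"
    and complete_hilbert: "complete_in G (hnorm ipG)"

text \<open>Operators are extensional functions on \<open>G\<close>, so that equality of functions is equality of
  operators on \<open>G\<close>.\<close>

definition bounded_ops ::
    "'g::complex_vector set \<Rightarrow> ('g \<Rightarrow> 'g \<Rightarrow> complex) \<Rightarrow> ('g \<Rightarrow> 'g) set"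
  where "bounded_ops G ipG = {T \<in> G \<rightarrow>\<^sub>E G.
    (\<forall>u\<in>G. \<forall>v\<in>G. T (u + v) = T u + T v) \<and>
    (\<forall>z. \<forall>v\<in>G. T (z *\<^sub>C v) = z *\<^sub>C T v) \<and>
    (\<exists>C. \<forall>v\<in>G. hnorm ipG (T v) \<le> C * hnorm ipG v)}"

definition adj ::
    "'g::complex_vector set \<Rightarrow> ('g \<Rightarrow> 'g \<Rightarrow> complex) \<Rightarrow> ('g \<Rightarrow> 'g) \<Rightarrow> 'g \<Rightarrow> 'g"
  where "adj G ipG T =
    (THE S. S \<in> bounded_ops G ipG \<and> (\<forall>u\<in>G. \<forall>v\<in>G. ipG (T u) v = ipG u (S v)))"

locale representation =
  correspondence ract ip lact + hilbert_space G ipG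
  for ract :: "'e::complex_vector \<Rightarrow> 'b::cstar_algebra \<Rightarrow> 'e"  (infixl "\<cdot>" 70)
    and ip :: "'e \<Rightarrow> 'e \<Rightarrow> 'b"
    and lact :: "'b \<Rightarrow> 'e \<Rightarrow> 'e"
    and G :: "'g::complex_vector set"
    and ipG :: "'g \<Rightarrow> 'g \<Rightarrow> complex" +
  fixes \<pi> :: "'b \<Rightarrow> 'g \<Rightarrow> 'g"
    and \<eta> :: "'e \<Rightarrow> 'g \<Rightarrow> 'g"
  assumes pi_bounded: "\<pi> b \<in> bounded_ops G ipG"
    and pi_add: "v \<in> G \<Longrightarrow> \<pi> (b + c) v = \<pi> b v + \<pi> c v"
    and pi_scaleC: "v \<in> G \<Longrightarrow> \<pi> (z *\<^sub>C b) v = z *\<^sub>C \<pi> b v"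
    and pi_mult: "\<pi> (b * c) = compose G (\<pi> b) (\<pi> c)"
    and pi_star: "\<pi> (star b) = adj G ipG (\<pi> b)"
    and pi_nondegenerate:
      "closed_span G (hnorm ipG) {\<pi> b v |b v. v \<in> G} = G"
    and eta_bounded: "\<eta> x \<in> bounded_ops G ipG"
    and eta_add: "v \<in> G \<Longrightarrow> \<eta> (x + y) v = \<eta> x v + \<eta> y v"
    and eta_scaleC: "v \<in> G \<Longrightarrow> \<eta> (z *\<^sub>C x) v = z *\<^sub>C \<eta> x v"
    and eta_bimodule: "\<eta> (lact b (x \<cdot> c)) = compose G (\<pi> b) (compose G (\<eta> x) (\<pi> c))"
    and eta_ip: "compose G (adj G ipG (\<eta> x)) (\<eta> y) = \<pi> (ip x y)"

locale nondegenerate_representation = representation +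
  assumes eta_nondegenerate: "closed_span G (hnorm ipG) {\<eta> x v |x v. v \<in> G} = G"

locale faithful_representation = representation +
  assumes pi_faithful: "inj \<pi>"

text \<open>Types cannot be existentially quantified, so the Hilbert space to be found is sought among
  the subspaces of one fixed function space. Any Hilbert space with a total subset indexed by
  \<open>'i\<close> is isomorphic to one carried by a subspace of \<open>'i \<Rightarrow> complex\<close> (send \<open>v\<close> to its inner
  products with the total subset). The index type below has at least \<open>2 ^ (|B| + |E| + |N|)\<close>
  elements; a faithful representation that is as small as possible needs no more than
  \<open>|B| + |E| + |N|\<close>.\<close>

type_synonym ('b, 'e) ambient = "((nat + 'b + 'e) list \<Rightarrow> complex) \<Rightarrow> complex"

end

theory Submission
  imports Defs
begin

text \<open>A nondegenerate representation amounts to a representation of the algebra on some \<open>G\<close> with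
  \<open>E \<otimes> G \<cong> G\<close>; such a \<open>G\<close> is found among infinite tensor powers \<open>E \<otimes> E \<otimes> \<dots>\<close>. The inner
  product of two infinite elementary tensors with eventually contractive letters is a positive
  functional applied to the bounded sequence of the inner products of their finite truncations. The
  functional is obtained by the Hahn-Banach theorem and ignores finitely many entries. Prefixing a
  letter then shifts the sequence, which is why the space is a direct sum of components indexed by
  the integers, and prefixing letters is onto.

  For faithfulness the functional must not vanish on the sequence \<open>\<langle>b w, b w\<rangle>\<close> for a suitable word
  \<open>w\<close>. A faithful left action is isometric, so each letter of \<open>w\<close> can be chosen such that the norm
  of the truncated inner product stays above half of its initial value; one such functional is used
  for each \<open>b\<close>.\<close>

section \<open>Positive elements of unital C*-algebras\<close>

text \<open>The truncated inner products of two infinite tensors need not converge, and the states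
  that nearly attain their norms change with the truncation; hence a functional on the whole
  sequence instead of a limit of states. Its invariance under shifts is not asked for, as averaging
  over shifts could destroy the lower bound. The main obstacle is positivity of the resulting
  kernel: Gram matrices over the algebra must stay positive when letters are appended. Positivity in
  matrix algebras is avoided by writing a Gram matrix approximately as a finite sum of terms
  \<open>star (c k i) * c k j\<close>, which the left action carries along. The order theory needed
  for this takes place in the unitization and rests on norm estimates and one square root iteration,
  with no spectral theory. The Hilbert space must live in a prescribed function type. It is
  therefore a space of functions on encoded words, as for a reproducing kernel, which also makes
  quotients unnecessary.\<close>

lemma star_zero [simp]: "star (0::'a::cstar_algebra) = 0"
  using star_add[of "0::'a" 0] by simp

lemma star_minus: "star (- a) = - star (a::'a::cstar_algebra)"
  by (metis add.right_inverse add_eq_0_iff star_add star_zero)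

lemma star_diff: "star (a - b) = star a - star (b::'a::cstar_algebra)"
  by (metis diff_conv_add_uminus star_add star_minus)

lemma star_scaleR: "star (r *\<^sub>R a) = r *\<^sub>R star (a::'a::cstar_algebra)"
  by (simp add: scaleR_scaleC star_scaleC)

lemma norm_star [simp]: "norm (star a) = norm (a::'a::cstar_algebra)"
proof -
  have le: "norm b \<le> norm (star b)" for b :: 'a
  proof (cases "b = 0")
    case False
    have "(norm b)\<^sup>2 \<le> norm (star b) * norm b"
      by (metis cstar_identity norm_mult_ineq)
    then show ?thesis using False by (simp add: power2_eq_square)
  qed simp
  from le[of a] le[of "star a"] show ?thesis by (simp add: star_star)
qed

lemma bounded_linear_star: "bounded_linear (star :: 'a::cstar_algebra \<Rightarrow> 'a)"
  by (rule bounded_linear_intro[where K = 1]) (auto simp: star_add star_scaleR)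

lemmas tendsto_star [tendsto_intros] = bounded_linear.tendsto[OF bounded_linear_star]

lemma norm_selfadjoint_square: "star a = a \<Longrightarrow> norm (a * a) = (norm (a::'a::cstar_algebra))\<^sup>2"
  by (metis cstar_identity)

lemma star_mult_self_zero: "star a * a = 0 \<Longrightarrow> (a::'a::cstar_algebra) = 0"
  using cstar_identity[of a] by simp

text \<open>The iteration is dominated by the real iteration for \<open>h = 1\<close>, which increases to
  its fixed point \<open>1\<close>; the limit is \<open>1 - sqrt (1 - h)\<close>.\<close>

lemma half_root_exists:
  fixes h :: "'a::cstar_algebra"
  assumes sa: "star h = h" and h1: "norm h \<le> 1"
  obtains s where "star s = s" "norm s \<le> 1" "s + s = h + s * s"
    "\<And>a. a * h = h * a \<Longrightarrow> a * s = s * a"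
proof -
  define s where "s = rec_nat (0::'a) (\<lambda>_ x. (1/2) *\<^sub>R (h + x * x))"
  define t where "t = rec_nat (0::real) (\<lambda>_ x. (1/2) * (1 + x * x))"
  have s0: "s 0 = 0" and sS: "s (Suc n) = (1/2) *\<^sub>R (h + s n * s n)"
    and t0: "t 0 = 0" and tS: "t (Suc n) = (1/2) * (1 + t n * t n)" for n
    by (simp_all add: s_def t_def)
  have t01: "0 \<le> t n \<and> t n \<le> 1" for n
  proof (induction n)
    case (Suc n)
    then have "t n * t n \<le> 1 * 1" by (intro mult_mono) auto
    with Suc show ?case by (simp add: tS)
  qed (simp add: t0)
  have tinc: "t n \<le> t (Suc n)" for n
    using sum_squares_ge_zero[of "1 - t n" 0] by (simp add: tS algebra_simps)
  have comm: "a * s n = s n * a" if "a * h = h * a" for a n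
  proof (induction n)
    case (Suc n)
    have "a * (s n * s n) = s n * s n * a" by (metis Suc mult.assoc)
    then show ?case using that by (simp add: sS distrib_left distrib_right)
  qed (simp add: s0)
  have commss: "s m * s n = s n * s m" for m n
    using comm[of "s m" n] comm[of h m] by simp
  have ns: "norm (s n) \<le> t n" for n
  proof (induction n)
    case (Suc n)
    have "norm (h + s n * s n) \<le> 1 + t n * t n"
      by (intro norm_triangle_le add_mono h1 norm_mult_ineq[THEN order_trans] mult_mono Suc)
        (auto simp: t01)
    then show ?case by (simp add: sS tS)
  qed (simp add: s0 t0)
  have step: "norm (s (Suc n) - s n) \<le> t (Suc n) - t n" for n
  proof (induction n)
    case 0
    then show ?case using h1 by (simp add: sS tS s0 t0)
  next
    case (Suc n)
    \<comment> \<open>The iterates commute, so the difference of squares factors; for the majorant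
      \<open>t\<close> the same factorization is an equality of real numbers.\<close>
    have "s (Suc (Suc n)) - s (Suc n)
        = (1/2) *\<^sub>R ((s (Suc n) + s n) * (s (Suc n) - s n))"
      using commss[of n "Suc n"]
      by (subst (1 2) sS) (simp add: algebra_simps flip: scaleR_diff_right)
    then have "norm (s (Suc (Suc n)) - s (Suc n))
        = (1/2) * norm ((s (Suc n) + s n) * (s (Suc n) - s n))" by simp
    also have "\<dots> \<le> (1/2) * ((t (Suc n) + t n) * (t (Suc n) - t n))"
      by (intro mult_left_mono norm_mult_ineq[THEN order_trans] mult_mono Suc
          norm_triangle_le add_mono ns) (use t01 in auto)
    also have "\<dots> = t (Suc (Suc n)) - t (Suc n)"
      by (subst (3 4) tS) (simp add: algebra_simps)
    finally show ?case .
  qed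
  have diff: "norm (s (n + k) - s n) \<le> t (n + k) - t n" for n k
  proof (induction k)
    case (Suc k)
    have "norm (s (n + Suc k) - s n) \<le> norm (s (Suc (n+k)) - s (n+k)) + norm (s (n+k) - s n)"
      using norm_triangle_ineq[of "s (Suc (n+k)) - s (n+k)" "s (n+k) - s n"] by simp
    with Suc step[of "n+k"] show ?case by simp
  qed simp
  have "incseq t" using tinc by (rule incseq_SucI)
  moreover have "Bseq t" by (rule BseqI'[of _ 1]) (simp add: t01)
  ultimately have "convergent t" by (auto intro: Bseq_mono_convergent simp: incseq_def)
  then have Ct: "Cauchy t" by (simp add: Cauchy_convergent_iff)
  have "Cauchy s"
  proof (rule CauchyI')
    fix e :: real assume "0 < e"
    then obtain M where M: "\<And>m n. m \<ge> M \<Longrightarrow> n \<ge> M \<Longrightarrow> norm (t m - t n) < e"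
      using Ct CauchyD by metis
    show "\<exists>M. \<forall>m\<ge>M. \<forall>n>m. dist (s m) (s n) < e"
    proof (intro exI allI impI)
      fix m n assume mn: "M \<le> m" "m < n"
      then have "norm (s n - s m) \<le> t n - t m" using diff[of m "n - m"] by simp
      also have "\<dots> < e" using M[of n m] mn by simp
      finally show "dist (s m) (s n) < e" by (simp add: dist_norm norm_minus_commute)
    qed
  qed
  then obtain l where l: "s \<longlonglongrightarrow> l" using Cauchy_convergent convergent_def by blast
  show thesis
  proof
    have sasn: "star (s n) = s n" for n
      by (induction n) (auto simp: s0 sS star_scaleR star_add star_mult sa)
    show "star l = l"
      using tendsto_star[OF l] l by (simp add: sasn LIMSEQ_unique)
    show "norm l \<le> 1"
      by (rule tendsto_upperbound[OF tendsto_norm[OF l]])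
        (use ns t01 order_trans in \<open>auto intro!: always_eventually, blast\<close>)
    have "(\<lambda>n. s (Suc n)) \<longlonglongrightarrow> (1/2) *\<^sub>R (h + l * l)"
      unfolding sS by (intro tendsto_intros l)
    then have "l = (1/2) *\<^sub>R (h + l * l)" using l LIMSEQ_Suc LIMSEQ_unique by blast
    then have "2 *\<^sub>R l = 2 *\<^sub>R ((1/2) *\<^sub>R (h + l * l))" by simp
    then show "l + l = h + l * l" by (simp add: scaleR_2)
    show "a * l = l * a" if "a * h = h * a" for a
    proof -
      have "(\<lambda>n. a * s n) \<longlonglongrightarrow> a * l" "(\<lambda>n. s n * a) \<longlonglongrightarrow> l * a"
        by (intro tendsto_intros l)+
      then show ?thesis using comm[OF that] by (simp add: LIMSEQ_unique)
    qed
  qed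
qed

section \<open>Positivity as a norm condition, square roots, order and norm\<close>

class unital_cstar_algebra = cstar_algebra + real_normed_algebra_1

lemma star_one [simp]: "star (1::'a::unital_cstar_algebra) = 1"
  by (metis mult_1 mult_1_right star_mult star_star)

lemma star_of_real [simp]: "star (of_real r :: 'a::unital_cstar_algebra) = of_real r"
  by (simp add: of_real_def star_scaleR)

text \<open>For self-adjoint \<open>h\<close> the inequality says that the spectrum lies between
  \<open>0\<close> and \<open>2 * t\<close>. In this form sums of positive elements are positive by
  the triangle inequality, and no spectrum has to be defined.\<close>

definition psd :: "'a::unital_cstar_algebra \<Rightarrow> bool"
  where "psd h \<longleftrightarrow> star h = h \<and> (\<exists>t\<ge>0. norm (of_real t - h) \<le> t)"

lemma psd_star: "psd h \<Longrightarrow> star h = h"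
  by (simp add: psd_def)

lemma psd_0 [simp]: "psd 0"
  unfolding psd_def by (auto intro!: exI[of _ 0])

lemma psd_1 [simp]: "psd 1"
  unfolding psd_def by (auto intro!: exI[of _ 1])

lemma psd_add:
  assumes "psd x" "psd y" shows "psd (x + y)"
proof -
  from assms obtain t u where "t \<ge> 0" "norm (of_real t - x) \<le> t" "u \<ge> 0" "norm (of_real u - y) \<le> u"
    by (auto simp: psd_def)
  then have "norm (of_real (t + u) - (x + y)) \<le> t + u"
    using norm_triangle_ineq[of "of_real t - x" "of_real u - y"] by (simp add: algebra_simps)
  with \<open>t \<ge> 0\<close> \<open>u \<ge> 0\<close> show ?thesis
    using assms unfolding psd_def by (auto simp: star_add intro!: exI[of _ "t + u"])
qed

lemma psd_scaleR:
  assumes "psd x" "0 \<le> r" shows "psd (r *\<^sub>R x)"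
proof -
  from assms obtain t where t: "t \<ge> 0" "norm (of_real t - x) \<le> t" by (auto simp: psd_def)
  have "norm (of_real (r * t) - r *\<^sub>R x) = r * norm (of_real t - x)"
    using \<open>0 \<le> r\<close> by (simp add: of_real_def flip: scaleR_scaleR scaleR_diff_right)
  also have "\<dots> \<le> r * t" using t \<open>0 \<le> r\<close> by (intro mult_left_mono)
  finally show ?thesis using assms t
    unfolding psd_def by (auto simp: star_scaleR intro!: exI[of _ "r * t"])
qed

lemma psd_sum: "(\<And>i. i \<in> A \<Longrightarrow> psd (f i)) \<Longrightarrow> psd (\<Sum>i\<in>A. f i)"
  by (induction A rule: infinite_finite_induct) (auto intro: psd_add)

text \<open>\<open>s + \<i> w\<close> is unitary.\<close>

lemma norm_le_1_of_squares_sum: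
  fixes s w :: "'a::unital_cstar_algebra"
  assumes "star s = s" "star w = w" "s * w = w * s" "s * s + w * w = 1"
  shows "norm s \<le> 1"
proof -
  define u where "u = s + \<i> *\<^sub>C w"
  define v where "v = s - \<i> *\<^sub>C w"
  have su: "star u = v"
    by (simp add: u_def v_def star_add star_scaleC assms)
  have "v * u = s * s + w * w"
    unfolding u_def v_def using assms(3)
    by (simp add: algebra_simps mult_scaleC_left mult_scaleC_right scaleC_scaleC)
  then have "star u * u = s * s + w * w" by (simp add: su)
  then have "norm u = 1" using cstar_identity[of u] assms(4) 
    by (metis norm_one norm_ge_zero one_power2 power2_eq_imp_eq zero_le_one)
  then have "norm v = 1" using norm_star[of u] su by simp
  have "s = (1/2) *\<^sub>R (u + v)" by (simp add: u_def v_def flip: scaleR_2)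
  then have "norm s = (1/2) * norm (u + v)" by simp
  also have "\<dots> \<le> 1" using norm_triangle_ineq[of u v] \<open>norm u = 1\<close> \<open>norm v = 1\<close> by simp
  finally show ?thesis .
qed

lemma root_of_one_minus:
  fixes h :: "'a::unital_cstar_algebra"
  assumes "star h = h" "norm h \<le> 1"
  obtains v where "psd v" "v * v = 1 - h" "\<And>a. a * h = h * a \<Longrightarrow> a * v = v * a"
proof -
  obtain s where s: "star s = s" "norm s \<le> 1" "s + s = h + s * s"
    "\<And>a. a * h = h * a \<Longrightarrow> a * s = s * a"
    using half_root_exists[OF assms] by metis
  show thesis
  proof
    show "psd (1 - s)" unfolding psd_def
      using s(1,2) by (auto simp: star_diff intro!: exI[of _ 1])
    have "(1 - s) * (1 - s) = 1 - (s + s) + s * s" by (simp add: algebra_simps)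
    then show "(1 - s) * (1 - s) = 1 - h" using s(3) by simp
    show "a * (1 - s) = (1 - s) * a" if "a * h = h * a" for a
      using s(4)[OF that] by (simp add: algebra_simps)
  qed
qed

text \<open>\<open>s\<close> and the root \<open>v\<close> play cosine and sine: they commute, so
  the norm bound for \<open>v\<close> comes from the unitary formed of both.\<close>

lemma one_minus_square:
  fixes s :: "'a::unital_cstar_algebra"
  assumes "star s = s" "norm s \<le> 1"
  obtains v where "star v = v" "norm v \<le> 1" "v * v = 1 - s * s"
proof -
  have "norm (s * s) \<le> 1"
    using assms by (simp add: norm_selfadjoint_square power_le_one)
  then obtain v where v: "psd v" "v * v = 1 - s * s"
    "\<And>a. a * (s * s) = s * s * a \<Longrightarrow> a * v = v * a"
    using root_of_one_minus[of "s * s"] assms by (metis star_mult)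
  have "norm v \<le> 1"
    by (rule norm_le_1_of_squares_sum[of v s])
      (use v(1,2) v(3)[of s] assms in \<open>auto simp: psd_star mult.assoc\<close>)
  with v(1,2) show thesis by (intro that[of v]) (auto simp: psd_star)
qed

text \<open>This gives \<open>psd_square\<close> and, through roots, shows that every
  \<open>t\<close> above the norm of a positive element can serve as the witness in
  \<open>psd\<close>.\<close>

lemma scaled_selfadjoint:
  fixes s :: "'a::unital_cstar_algebra"
  assumes "star s = s" "(norm s)\<^sup>2 \<le> t"
  obtains v where "star v = v" "v * v = of_real t - s * s" "norm (v * v) \<le> t"
proof (cases "t = 0")
  case True
  then have "s = 0" using assms by simp
  with True that[of 0] show thesis by simp
next
  case False
  with assms have t: "t > 0" by (metis less_eq_real_def order_trans zero_le_power2)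
  define s' where "s' = (1 / sqrt t) *\<^sub>R s"
  have "norm s \<le> sqrt t" using assms(2) by (simp add: real_le_rsqrt)
  then have "star s' = s'" "norm s' \<le> 1"
    using t assms by (auto simp: s'_def star_scaleR)
  then obtain v where v: "star v = v" "norm v \<le> 1" "v * v = 1 - s' * s'"
    using one_minus_square by metis
  have s's': "t *\<^sub>R (s' * s') = s * s" using t by (simp add: s'_def)
  have eq: "(sqrt t *\<^sub>R v) * (sqrt t *\<^sub>R v) = t *\<^sub>R (v * v)" using t by simp
  show thesis
  proof (rule that[of "sqrt t *\<^sub>R v"])
    show "star (sqrt t *\<^sub>R v) = sqrt t *\<^sub>R v" by (simp add: star_scaleR v)
    show "sqrt t *\<^sub>R v * sqrt t *\<^sub>R v = of_real t - s * s"
      unfolding eq v(3) by (simp add: scaleR_diff_right s's' of_real_def)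
    show "norm (sqrt t *\<^sub>R v * sqrt t *\<^sub>R v) \<le> t"
      unfolding eq using t v(2) norm_selfadjoint_square[OF v(1)] by (simp add: power_le_one)
  qed
qed

lemma psd_square:
  assumes "star s = s" shows "psd (s * s)"
proof -
  obtain v where "v * v = of_real ((norm s)\<^sup>2) - s * s" "norm (v * v) \<le> (norm s)\<^sup>2"
    using scaled_selfadjoint[OF assms order_refl] by metis
  then have "norm (of_real ((norm s)\<^sup>2) - s * s) \<le> (norm s)\<^sup>2" by simp
  then show ?thesis unfolding psd_def using assms
    by (intro conjI exI[of _ "(norm s)\<^sup>2"]) (auto simp: star_mult simp del: of_real_power)
qed

text \<open>With the witness \<open>t\<close>, the element \<open>h / t\<close> is
  \<open>1 - k\<close> for a contraction \<open>k\<close>, to which the iteration applies. The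
  commutation clause stands in for the fact that the root lies in the closed algebra generated by
  \<open>h\<close> and \<open>1\<close>.\<close>

lemma psd_root:
  assumes "psd h"
  obtains s where "psd s" "s * s = h" "\<And>a. a * h = h * a \<Longrightarrow> a * s = s * a"
proof -
  from assms obtain t where t: "t \<ge> 0" "norm (of_real t - h) \<le> t" and sa: "star h = h"
    by (auto simp: psd_def)
  show thesis
  proof (cases "t = 0")
    case True
    then have "h = 0" using t by simp
    then show thesis using that[of 0] by simp
  next
    case False
    with t have tp: "t > 0" by simp
    define k where "k = (1/t) *\<^sub>R (of_real t - h)"
    have k: "star k = k" "norm k \<le> 1"
      using tp t sa by (auto simp: k_def star_scaleR star_diff)
    have k': "1 - k = (1/t) *\<^sub>R h" using tp
      by (simp add: k_def scaleR_diff_right of_real_def)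
    obtain v where v: "psd v" "v * v = 1 - k" "\<And>a. a * k = k * a \<Longrightarrow> a * v = v * a"
      using root_of_one_minus[OF k] by metis
    show thesis
    proof (rule that[of "sqrt t *\<^sub>R v"])
      show "psd (sqrt t *\<^sub>R v)" using v(1) tp by (intro psd_scaleR) auto
      show "(sqrt t *\<^sub>R v) * (sqrt t *\<^sub>R v) = h" using tp v(2) k' by simp
      fix a assume "a * h = h * a"
      then have "a * k = k * a"
        by (simp add: k_def algebra_simps of_real_def)
      then show "a * (sqrt t *\<^sub>R v) = (sqrt t *\<^sub>R v) * a" using v(3) by simp
    qed
  qed
qed

lemma psd_of_real_minus:
  assumes "psd x" "norm x \<le> t" shows "psd (of_real t - x)"
proof -
  obtain s where s: "psd s" "s * s = x" using psd_root[OF assms(1)] by metis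
  then have "(norm s)\<^sup>2 \<le> t" using assms(2) by (metis norm_selfadjoint_square psd_star)
  then show ?thesis using scaled_selfadjoint[of s t] s psd_square psd_star by metis
qed

lemma norm_of_real_minus_psd:
  assumes "psd x" "norm x \<le> t" shows "norm (of_real t - x) \<le> t"
proof -
  obtain s where s: "psd s" "s * s = x" using psd_root[OF assms(1)] by metis
  then have "(norm s)\<^sup>2 \<le> t" using assms(2) by (metis norm_selfadjoint_square psd_star)
  then show ?thesis using scaled_selfadjoint[of s t] s psd_star by metis
qed

text \<open>The radius \<open>norm h + 1\<close> works at once for all approximants at distance at
  most \<open>1\<close>, so the defining inequality passes to the limit.\<close>

lemma psd_approx:
  assumes "\<And>e. e > 0 \<Longrightarrow> \<exists>g. psd g \<and> norm (h - g) \<le> e"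
  shows "psd h"
proof -
  have "star h - h = 0"
  proof (rule ccontr)
    assume ne: "star h - h \<noteq> 0"
    define e where "e = norm (star h - h) / 3"
    have "e > 0" using ne by (simp add: e_def)
    then obtain g where g: "psd g" "norm (h - g) \<le> e" using assms by blast
    have "star h - h = star (h - g) - (h - g)" using g by (simp add: star_diff psd_star)
    then have "norm (star h - h) \<le> norm (star (h - g)) + norm (h - g)"
      by (metis norm_triangle_ineq4)
    then have "norm (star h - h) \<le> 2 * e" using g(2) by simp
    then show False using \<open>e > 0\<close> by (simp add: e_def)
  qed
  moreover have "norm (of_real (norm h + 1) - h) \<le> norm h + 1"
  proof (rule field_le_epsilon)
    fix e :: real assume "e > 0"
    define e' where "e' = min e 1"
    have "e' > 0" using \<open>e > 0\<close> by (simp add: e'_def)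
    then obtain g where g: "psd g" "norm (h - g) \<le> e'" using assms by blast
    have "norm g \<le> norm h + norm (h - g)" by (metis norm_triangle_sub norm_minus_commute)
    also have "\<dots> \<le> norm h + 1" using g by (simp add: e'_def)
    finally have "norm (of_real (norm h + 1) - g) \<le> norm h + 1"
      by (rule norm_of_real_minus_psd[OF g(1)])
    moreover have "norm (of_real (norm h + 1) - h) \<le> norm (of_real (norm h + 1) - g) + norm (h - g)"
      by (metis diff_diff_eq2 diff_add_eq add_diff_cancel_right' norm_triangle_ineq4 diff_add_cancel)
    ultimately show "norm (of_real (norm h + 1) - h) \<le> norm h + 1 + e"
      using g(2) by (simp add: e'_def)
  qed
  ultimately show ?thesis unfolding psd_def
    by (auto intro!: exI[of _ "norm h + 1"] add_nonneg_nonneg)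
qed

lemma psd_mult_commute:
  assumes "psd x" "psd y" "x * y = y * x" shows "psd (x * y)"
proof -
  obtain s where s: "psd s" "s * s = x" "\<And>a. a * x = x * a \<Longrightarrow> a * s = s * a"
    using psd_root[OF assms(1)] by metis
  obtain t where t: "psd t" "t * t = y" "\<And>a. a * y = y * a \<Longrightarrow> a * t = t * a"
    using psd_root[OF assms(2)] by metis
  have "s * y = y * s" using s(3)[of y] assms by simp
  then have st: "s * t = t * s" by (rule t(3))
  have "x * y = (s * t) * (s * t)" unfolding s(2)[symmetric] t(2)[symmetric]
    using st by (metis mult.assoc)
  moreover have "star (s * t) = s * t" using s(1) t(1) st by (simp add: star_mult psd_star)
  ultimately show ?thesis using psd_square by metis
qed

lemma psd_power: "psd x \<Longrightarrow> psd (x ^ n)"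
  by (induction n) (auto intro!: psd_mult_commute simp: power_commutes)

text \<open>The roots of \<open>x\<close> and \<open>1 - x\<close> commute and their squares add up
  to \<open>1\<close>; the unitary argument bounds the root of \<open>x\<close>.\<close>

lemma norm_le_1_of_psd:
  assumes "psd x" "psd (1 - x)" shows "norm x \<le> 1"
proof -
  obtain s where s: "psd s" "s * s = x" "\<And>a. a * x = x * a \<Longrightarrow> a * s = s * a"
    using psd_root[OF assms(1)] by metis
  obtain t where t: "psd t" "t * t = 1 - x"
    "\<And>a. a * (1 - x) = (1 - x) * a \<Longrightarrow> a * t = t * a"
    using psd_root[OF assms(2)] by metis
  have "s * x = x * s" using s(2) by (metis mult.assoc)
  then have "s * t = t * s" by (intro t(3)) (simp add: algebra_simps)
  then have "norm s \<le> 1"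
    by (intro norm_le_1_of_squares_sum[of s t]) (use s(1,2) t(1,2) in \<open>auto simp: psd_star\<close>)
  then show ?thesis using s(1,2) by (metis norm_selfadjoint_square psd_star norm_ge_zero power_le_one)
qed

lemma norm_le_of_psd:
  assumes "psd x" "psd (of_real r - x)" "0 \<le> r" shows "norm x \<le> r"
proof (rule field_le_epsilon)
  fix e :: real assume e: "e > 0"
  \<comment> \<open>The slack keeps the divisor positive when \<open>r = 0\<close>.\<close>
  define c where "c = r + e"
  have c: "c > 0" using e assms by (simp add: c_def)
  have "psd ((1/c) *\<^sub>R (of_real r - x) + (e/c) *\<^sub>R 1)"
    using c e assms by (intro psd_add psd_scaleR) auto
  also have "(1/c) *\<^sub>R (of_real r - x) + (e/c) *\<^sub>R 1 = 1 - (1/c) *\<^sub>R x"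
  proof -
    have "(1/c) *\<^sub>R (of_real r - x) + (e/c) *\<^sub>R (1::'a)
        = (r/c + e/c) *\<^sub>R 1 - (1/c) *\<^sub>R x"
      by (simp add: scaleR_diff_right of_real_def scaleR_add_left)
    also have "r/c + e/c = 1" using c by (simp add: c_def add_divide_distrib[symmetric])
    finally show ?thesis by simp
  qed
  finally have "norm ((1/c) *\<^sub>R x) \<le> 1"
    using c assms by (intro norm_le_1_of_psd psd_scaleR) auto
  then show "norm x \<le> r + e" using c by (simp add: c_def field_simps)
qed

lemma norm_mono_psd:
  assumes "psd x" "psd y" shows "norm x \<le> norm (x + y)"
proof (rule norm_le_of_psd)
  have "psd (of_real (norm (x + y)) - (x + y))"
    by (intro psd_of_real_minus psd_add assms order_refl)
  from psd_add[OF this assms(2)] show "psd (of_real (norm (x + y)) - x)"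
    by (simp add: algebra_simps)
qed (use assms in auto)

lemma psd_sum_zero:
  assumes "psd x" "psd y" "x + y = 0" shows "x = 0"
  using norm_mono_psd[OF assms(1,2)] assms(3) by simp

text \<open>With \<open>p = |h|\<close>, \<open>n\<close> is the negative part of \<open>h\<close>.\<close>

lemma negative_part:
  assumes "star h = (h::'a::unital_cstar_algebra)"
  obtains n p where "star n = n" "psd p" "h = p - 2 *\<^sub>R n" "h * n = - (n * n)" "n * h = - (n * n)"
    "psd (n * n * n)"
proof -
  obtain p where p: "psd p" "p * p = h * h" "\<And>a. a * (h * h) = h * h * a \<Longrightarrow> a * p = p * a"
    using psd_root[OF psd_square[OF assms]] by metis
  have hp: "h * p = p * h" by (rule p(3)) (simp add: mult.assoc)
  define n where "n = (1/2) *\<^sub>R (p - h)"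
  have sn: "star n = n" using p(1) assms by (simp add: n_def star_scaleR star_diff psd_star)
  have np: "n * p = p * n" using hp by (simp add: n_def algebra_simps)
  have nn: "n * n = p * n"
  proof -
    have "n * n = (1/4) *\<^sub>R ((p - h) * (p - h))" by (simp add: n_def)
    also have "(p - h) * (p - h) = 2 *\<^sub>R (p * (p - h))"
      using hp p(2) by (simp add: algebra_simps scaleR_2)
    also have "(1/4) *\<^sub>R \<dots> = p * n" by (simp add: n_def)
    finally show ?thesis .
  qed
  have hn: "h = p - 2 *\<^sub>R n" by (simp add: n_def)
  have 1: "h * n = - (n * n)"
  proof -
    have "h * n = p * n - 2 *\<^sub>R (n * n)" by (subst hn) (simp add: left_diff_distrib)
    then show ?thesis using nn by (simp add: scaleR_2)
  qed
  have 2: "n * h = - (n * n)"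
    using arg_cong[OF 1, of star] by (simp add: star_mult star_minus sn assms)
  \<comment> \<open>The cube equals \<open>p * n * n\<close>, the square of \<open>r * n\<close>.
    Its positivity is enough for the later uses and avoids proving that \<open>n\<close> is
    positive.\<close>
  obtain r where r: "psd r" "r * r = p" "\<And>a. a * p = p * a \<Longrightarrow> a * r = r * a"
    using psd_root[OF p(1)] by metis
  have rn: "n * r = r * n" using r(3) np by simp
  have "n * n * n = (r * n) * (r * n)"
    using nn rn r(2) by (metis mult.assoc)
  moreover have "star (r * n) = r * n" using r(1) sn rn by (simp add: star_mult psd_star)
  ultimately have "psd (n * n * n)" using psd_square by metis
  with that[OF sn p(1) hn 1 2] show thesis by blast
qed

section \<open>Positivity of the elements \<open>star c * c\<close>\<close>

lemma selfadjoint_cube_zero: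
  fixes n :: "'a::cstar_algebra"
  assumes "star n = n" "n * n * n = 0" shows "n = 0"
proof -
  have "(n * n) * (n * n) = 0" using assms(2) by (metis mult.assoc mult_zero_right mult_zero_left)
  then have "n * n = 0" using star_mult_self_zero[of "n * n"] assms(1) by (simp add: star_mult)
  then show ?thesis using star_mult_self_zero[of n] assms(1) by simp
qed

text \<open>Up to a factor this is the sum of the squares of the real and imaginary parts of
  \<open>d\<close>.\<close>

lemma psd_star_commute_sum:
  fixes d :: "'a::unital_cstar_algebra"
  shows "psd (star d * d + d * star d)"
proof -
  define a where "a = d + star d"
  define b where "b = \<i> *\<^sub>C (d - star d)"
  have sa: "star a = a" by (simp add: a_def star_add star_star add.commute)
  have sb: "star b = b"
    by (simp add: b_def star_scaleC star_diff star_star flip: complex_vector.scale_minus_right)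
  have bb: "b * b = - ((d - star d) * (d - star d))"
    by (simp add: b_def mult_scaleC_left mult_scaleC_right scaleC_scaleC)
  have "star d * d + d * star d = (1/2) *\<^sub>R (a * a + b * b)"
    unfolding bb by (simp add: a_def algebra_simps flip: scaleR_2)
  then show ?thesis using sa sb by (simp add: psd_scaleR psd_add psd_square)
qed

text \<open>A substitute for comparing the spectra of \<open>star d * d\<close> and
  \<open>d * star d\<close>. By \<open>psd_star_commute_sum\<close> the latter, \<open>p\<close>, is
  positive, and \<open>p * d = - (d * g)\<close>. Hence multiplying \<open>d\<close> by
  \<open>of_real t - p\<close> from the left, which costs a factor of at most \<open>t\<close>, is
  the same as multiplying by \<open>of_real t + g\<close> from the right, which gains more than
  \<open>t\<close> unless \<open>g = 0\<close>.\<close>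

lemma negative_mult_star_zero:
  fixes d :: "'a::unital_cstar_algebra"
  assumes g: "psd g" and dd: "star d * d = - g"
  shows "g = 0"
proof -
  define p where "p = d * star d"
  have "psd ((star d * d + d * star d) + g)" by (intro psd_add psd_star_commute_sum g)
  then have p: "psd p" by (simp add: dd p_def)
  define t where "t = norm p + 1"
  have t: "t > 0" by (simp add: t_def add_nonneg_pos)
  have np: "norm (of_real t - p) \<le> t" by (rule norm_of_real_minus_psd[OF p]) (simp add: t_def)
  define \<gamma> where "\<gamma> = norm g"
  have gd: "(norm d)\<^sup>2 = \<gamma>" using cstar_identity[of d] by (simp add: dd \<gamma>_def)
  have pd: "(of_real t - p) * d = d * (of_real t + g)"
    by (simp add: p_def algebra_simps mult.assoc dd of_real_def)
  define q where "q = t\<^sup>2 *\<^sub>R g + (2*t) *\<^sub>R (g * g) + g * g * g"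
  have "star (d * (of_real t + g)) * (d * (of_real t + g)) = - q"
  proof -
    have "star (d * (of_real t + g)) * (d * (of_real t + g))
        = (of_real t + g) * (star d * d) * (of_real t + g)"
      using g by (simp add: star_mult star_add psd_star mult.assoc)
    also have "\<dots> = - q"
      by (simp add: dd q_def of_real_def algebra_simps power2_eq_square flip: scaleR_2)
    finally show ?thesis .
  qed
  then have "norm q = (norm (d * (of_real t + g)))\<^sup>2" using cstar_identity by (metis norm_minus_cancel)
  also have "\<dots> = (norm ((of_real t - p) * d))\<^sup>2" by (simp add: pd)
  also have "\<dots> \<le> (t * norm d)\<^sup>2"
    by (intro power_mono order_trans[OF norm_mult_ineq] mult_right_mono np) auto
  also have "\<dots> = t\<^sup>2 * \<gamma>" by (simp add: power_mult_distrib gd)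
  finally have up: "norm q \<le> t\<^sup>2 * \<gamma>" .
  show ?thesis
  proof (rule ccontr)
    assume "g \<noteq> 0"
    then have \<gamma>: "\<gamma> > 0" by (simp add: \<gamma>_def)
    \<comment> \<open>Since \<open>g * g\<close> is at most \<open>\<gamma>\<close> times
      \<open>g\<close>, \<open>q\<close> dominates a multiple of \<open>g * g\<close> whose norm is
      \<open>t\<^sup>2 * \<gamma> + 2 * t * \<gamma>\<^sup>2\<close>, above the bound just
      found.\<close>
    have "psd (g * (of_real \<gamma> - g))"
      by (intro psd_mult_commute g psd_of_real_minus)
        (auto simp: \<gamma>_def algebra_simps of_real_def)
    then have 1: "psd (\<gamma> *\<^sub>R g - g * g)" by (simp add: algebra_simps of_real_def)
    have gg: "psd (g * g)" by (rule psd_square) (use g in \<open>simp add: psd_star\<close>)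
    have ggg: "psd (g * g * g)"
      by (intro psd_mult_commute gg g) (simp add: mult.assoc)
    have "norm ((t\<^sup>2/\<gamma> + 2*t) *\<^sub>R (g * g))
        \<le> norm ((t\<^sup>2/\<gamma> + 2*t) *\<^sub>R (g * g) + ((t\<^sup>2/\<gamma>) *\<^sub>R (\<gamma> *\<^sub>R g - g * g) + g * g * g))"
      using t \<gamma> by (intro norm_mono_psd psd_scaleR psd_add 1 gg ggg) auto
    also have "(t\<^sup>2/\<gamma> + 2*t) *\<^sub>R (g * g) + ((t\<^sup>2/\<gamma>) *\<^sub>R (\<gamma> *\<^sub>R g - g * g) + g * g * g) = q"
      using \<gamma> by (simp add: q_def algebra_simps)
    finally have "(t\<^sup>2/\<gamma> + 2*t) * \<gamma>\<^sup>2 \<le> t\<^sup>2 * \<gamma>"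
      using up t \<gamma> g by (simp add: norm_selfadjoint_square psd_star \<gamma>_def)
    then have "2 * t * \<gamma>\<^sup>2 \<le> 0" using \<gamma> by (simp add: algebra_simps power2_eq_square)
    then show False using t \<gamma> by (simp add: mult_le_0_iff)
  qed
qed

text \<open>The negative part \<open>n\<close> compresses \<open>star c * c\<close> to
  \<open>- (n * n * n)\<close>, the negative of a positive element which is again of the form
  \<open>star d * d\<close> with \<open>d = c * n\<close>, and so vanishes.\<close>

lemma psd_star_mult:
  fixes c :: "'a::unital_cstar_algebra"
  shows "psd (star c * c)"
proof -
  define h where "h = star c * c"
  have "star h = h" by (simp add: h_def star_mult star_star)
  then obtain n p where n: "star n = n" "psd p" "h = p - 2 *\<^sub>R n" "h * n = - (n * n)"
    "psd (n * n * n)" using negative_part by metis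
  have "star (c * n) * (c * n) = n * (h * n)" by (simp add: star_mult n(1) h_def mult.assoc)
  also have "\<dots> = - (n * n * n)" by (simp add: n(4) mult.assoc)
  finally have "n * n * n = 0" by (rule negative_mult_star_zero[OF n(5)])
  then have "n = 0" using selfadjoint_cube_zero n(1) by blast
  then show ?thesis using n by (simp add: h_def)
qed

section \<open>The unitization\<close>

datatype 'a unitization = Unitization (ualg: 'a) (uscal: complex)

text \<open>The algebra is an ideal of its unitization. Reading the product with an algebra element
  as an algebra element lets roots and negative parts taken in the unitization be used where only
  algebra elements can act.\<close>

definition uact :: "'a::cstar_algebra unitization \<Rightarrow> 'a \<Rightarrow> 'a"
  where "uact x c = ualg x * c + uscal x *\<^sub>C c"

lemma bounded_linear_uact: "bounded_linear (uact x)"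
proof (rule bounded_linear_intro)
  show "norm (uact x c) \<le> norm c * (norm (ualg x) + cmod (uscal x))" for c
    unfolding uact_def
    by (rule order_trans[OF norm_triangle_ineq])
      (use norm_mult_ineq[of "ualg x" c] in \<open>simp add: norm_scaleC algebra_simps\<close>)
qed (auto simp: uact_def distrib_left scaleC_add_right scaleR_add_right scaleR_scaleC
    scaleC_scaleC mult_scaleC_right mult.commute)

instantiation unitization :: (cstar_algebra) complex_vector
begin

definition zero_unitization :: "'a unitization" where "0 = Unitization 0 0"
definition plus_unitization :: "'a unitization \<Rightarrow> 'a unitization \<Rightarrow> 'a unitization"
  where "x + y = Unitization (ualg x + ualg y) (uscal x + uscal y)"
definition minus_unitization :: "'a unitization \<Rightarrow> 'a unitization \<Rightarrow> 'a unitization"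
  where "x - y = Unitization (ualg x - ualg y) (uscal x - uscal y)"
definition uminus_unitization :: "'a unitization \<Rightarrow> 'a unitization"
  where "- x = Unitization (- ualg x) (- uscal x)"
definition scaleC_unitization :: "complex \<Rightarrow> 'a unitization \<Rightarrow> 'a unitization"
  where "z *\<^sub>C x = Unitization (z *\<^sub>C ualg x) (z * uscal x)"

instance
proof
  fix x y z :: "'a unitization" and w v :: complex
  show "x + y + z = x + (y + z)" "x + y = y + x" "0 + x = x" "- x + x = 0" "x - y = x + - y"
    by (simp_all add: zero_unitization_def plus_unitization_def
        minus_unitization_def uminus_unitization_def)
  show "w *\<^sub>C (x + y) = w *\<^sub>C x + w *\<^sub>C y" "(w + v) *\<^sub>C x = w *\<^sub>C x + v *\<^sub>C x"
    "w *\<^sub>C v *\<^sub>C x = (w * v) *\<^sub>C x" "1 *\<^sub>C x = x"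
    by (simp_all add: plus_unitization_def scaleC_unitization_def scaleC_add_left scaleC_add_right scaleC_scaleC scaleC_one
        algebra_simps)
qed

end

text \<open>The maximum with the character makes this a norm even when the algebra is already unital,
  where the left regular representation of the unitization is not faithful.\<close>

instantiation unitization :: (cstar_algebra) real_normed_algebra_1
begin

definition one_unitization :: "'a unitization" where "1 = Unitization 0 1"
definition times_unitization :: "'a unitization \<Rightarrow> 'a unitization \<Rightarrow> 'a unitization"
  where "x * y = Unitization (uact x (ualg y) + uscal y *\<^sub>C ualg x) (uscal x * uscal y)"
definition scaleR_unitization :: "real \<Rightarrow> 'a unitization \<Rightarrow> 'a unitization"
  where "r *\<^sub>R x = complex_of_real r *\<^sub>C (x :: 'a unitization)"
definition norm_unitization :: "'a unitization \<Rightarrow> real"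
  where "norm x = max (cmod (uscal x)) (onorm (uact x))"
definition dist_unitization :: "'a unitization \<Rightarrow> 'a unitization \<Rightarrow> real"
  where "dist_unitization x y = norm (x - y)"
definition sgn_unitization :: "'a unitization \<Rightarrow> 'a unitization"
  where "sgn_unitization x = scaleR (inverse (norm x)) x"
definition uniformity_unitization :: "('a unitization \<times> 'a unitization) filter"
  where "uniformity_unitization = (INF e\<in>{0<..}. principal {(x, y). dist x (y::'a unitization) < e})"
definition open_unitization :: "'a unitization set \<Rightarrow> bool"
  where "open_unitization U \<longleftrightarrow> (\<forall>x\<in>U. \<forall>\<^sub>F (x', y) in uniformity. x' = x \<longrightarrow> y \<in> U)"

lemmas unitization_ops = zero_unitization_def one_unitization_def plus_unitization_def
  minus_unitization_def uminus_unitization_def times_unitization_def scaleC_unitization_def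

lemma uact_add: "uact (x + y) c = uact x c + uact y c"
  by (simp add: uact_def unitization_ops distrib_right scaleC_add_left)

lemma uact_mult: "uact (x * y) c = uact x (uact y c)"
  by (simp add: uact_def unitization_ops distrib_right distrib_left scaleC_add_left scaleC_add_right
      mult_scaleC_left mult_scaleC_right scaleC_scaleC mult.assoc)

lemma uact_one: "uact 1 c = c"
  by (simp add: uact_def unitization_ops scaleC_one)

lemma norm_uact: "norm (uact x c) \<le> norm x * norm c"
proof -
  have "norm (uact x c) \<le> onorm (uact x) * norm c" by (rule onorm[OF bounded_linear_uact])
  also have "\<dots> \<le> norm x * norm c" by (intro mult_right_mono) (auto simp: norm_unitization_def)
  finally show ?thesis .
qed

lemma norm_unitization_bound:
  assumes "cmod (uscal x) \<le> b" "0 \<le> b" "\<And>c. norm (uact x c) \<le> b * norm c"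
  shows "norm x \<le> b"
  using assms onorm_bound[of b "uact x"] by (simp add: norm_unitization_def)

lemma norm_uscal: "cmod (uscal x) \<le> norm x"
  by (simp add: norm_unitization_def)

text \<open>The left regular representation is isometric even without a unit, as the test vector
  \<open>c = star a\<close> shows.\<close>

lemma norm_alg_le:
  fixes a :: 'a assumes "\<And>c. norm (a * c) \<le> b * norm c" "0 \<le> b" shows "norm a \<le> b"
proof (cases "norm a = 0")
  case False
  have "(norm a)\<^sup>2 = norm (a * star a)" using cstar_identity[of "star a"] by (simp add: star_star)
  also have "\<dots> \<le> b * norm a" using assms(1)[of "star a"] by simp
  finally show ?thesis using False by (simp add: power2_eq_square)
qed (use assms in simp)

text \<open>With \<open>norm_uscal\<close> and \<open>norm_unitization_le\<close> this makes
  convergence in the unitization componentwise, which settles definiteness and completeness.\<close>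

lemma norm_ualg: "norm (ualg x) \<le> 2 * norm x"
proof (rule norm_alg_le)
  fix c
  have "norm (ualg x * c) = norm (uact x c - uscal x *\<^sub>C c)" by (simp add: uact_def)
  also have "\<dots> \<le> norm x * norm c + norm x * norm c"
    by (intro order_trans[OF norm_triangle_ineq4] add_mono norm_uact)
      (simp add: norm_scaleC mult_right_mono norm_uscal)
  finally show "norm (ualg x * c) \<le> 2 * norm x * norm c" by (simp add: ac_simps)
qed (use norm_uscal[of x] norm_ge_zero[of "uscal x"] in linarith)

lemma norm_unitization_nonneg: "0 \<le> norm (x :: 'a unitization)"
  using norm_uscal[of x] norm_ge_zero[of "uscal x"] by linarith

lemma norm_unitization_le: "norm x \<le> norm (ualg x) + cmod (uscal x)"
proof (rule norm_unitization_bound)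
  show "norm (uact x c) \<le> (norm (ualg x) + cmod (uscal x)) * norm c" for c
    unfolding uact_def
    by (rule order_trans[OF norm_triangle_ineq])
      (use norm_mult_ineq[of "ualg x" c] in \<open>simp add: norm_scaleC algebra_simps\<close>)
qed auto

lemma norm_unitization_mult: "norm (x * y) \<le> norm x * norm (y :: 'a unitization)"
proof (rule norm_unitization_bound)
  show "cmod (uscal (x * y)) \<le> norm x * norm y"
    using norm_uscal[of x] norm_uscal[of y]
    by (simp add: unitization_ops norm_mult mult_mono norm_unitization_nonneg)
  fix c
  have "norm (uact (x * y) c) \<le> norm x * (norm y * norm c)" unfolding uact_mult
    by (intro order_trans[OF norm_uact] mult_left_mono norm_uact norm_unitization_nonneg)
  then show "norm (uact (x * y) c) \<le> norm x * norm y * norm c" by (simp add: mult.assoc)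
qed (simp add: norm_unitization_nonneg)

lemma norm_unitization_scaleC: "norm (w *\<^sub>C x) = cmod w * norm (x :: 'a unitization)"
proof -
  have le: "norm (w *\<^sub>C x) \<le> cmod w * norm x" for w and x :: "'a unitization"
  proof (rule norm_unitization_bound)
    show "cmod (uscal (w *\<^sub>C x)) \<le> cmod w * norm x"
      using norm_uscal[of x] by (simp add: unitization_ops norm_mult mult_left_mono)
    have "uact (w *\<^sub>C x) c = w *\<^sub>C uact x c" for c
      by (simp add: unitization_ops uact_def mult_scaleC_left scaleC_add_right scaleC_scaleC)
    then show "norm (uact (w *\<^sub>C x) c) \<le> cmod w * norm x * norm c" for c
      using norm_uact[of x c] by (simp add: norm_scaleC mult_left_mono mult.assoc)
  qed (simp add: norm_unitization_nonneg)
  show ?thesis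
  proof (cases "w = 0")
    case True
    then show ?thesis using le[of w x] norm_unitization_nonneg[of "w *\<^sub>C x"] by simp
  next
    case False
    have "norm x = norm ((1/w) *\<^sub>C w *\<^sub>C x)" using False by (simp add: scaleC_scaleC scaleC_one)
    also have "\<dots> \<le> (1 / cmod w) * norm (w *\<^sub>C x)" using le[of "1/w" "w *\<^sub>C x"]
      by (simp add: norm_divide)
    finally show ?thesis using le[of w x] False by (simp add: field_simps)
  qed
qed

instance
proof
  fix x y z :: "'a unitization" and r s :: real
  show "x * y * z = x * (y * z)"
    by (simp add: unitization_ops uact_def algebra_simps mult_scaleC_left mult_scaleC_right
        scaleC_add_left scaleC_add_right scaleC_scaleC)
  show "1 * x = x" "x * 1 = x"
    by (simp_all add: unitization_ops uact_def scaleC_one)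
  show "(x + y) * z = x * z + y * z" "x * (y + z) = x * y + x * z"
    by (simp_all add: unitization_ops uact_def algebra_simps scaleC_add_left scaleC_add_right)
  show "(0 :: 'a unitization) \<noteq> 1" by (simp add: unitization_ops)
  show "r *\<^sub>R (x + y) = r *\<^sub>R x + r *\<^sub>R y" "(r + s) *\<^sub>R x = r *\<^sub>R x + s *\<^sub>R x"
    "r *\<^sub>R s *\<^sub>R x = (r * s) *\<^sub>R x" "1 *\<^sub>R x = x"
    by (simp_all add: scaleR_unitization_def scaleC_add_right scaleC_add_left scaleC_scaleC scaleC_one)
  have mC: "w *\<^sub>C x * y = w *\<^sub>C (x * y)" "x * w *\<^sub>C y = w *\<^sub>C (x * y)" for w
    by (simp_all add: unitization_ops uact_def mult_scaleC_left mult_scaleC_right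
        scaleC_add_left scaleC_add_right scaleC_scaleC algebra_simps)
  show "r *\<^sub>R x * y = r *\<^sub>R (x * y)" "x * r *\<^sub>R y = r *\<^sub>R (x * y)"
    by (simp_all add: scaleR_unitization_def mC)
  show "dist x y = norm (x - y)" by (rule dist_unitization_def)
  show "sgn x = scaleR (inverse (norm x)) x" by (rule sgn_unitization_def)
  show "uniformity = (INF e\<in>{0<..}. principal {(x, y). dist x (y::'a unitization) < e})"
    by (rule uniformity_unitization_def)
  show "open U \<longleftrightarrow> (\<forall>x\<in>U. \<forall>\<^sub>F (x', y) in uniformity. x' = x \<longrightarrow> y \<in> U)" for U :: "'a unitization set"
    by (rule open_unitization_def)
  show "norm x = 0 \<longleftrightarrow> x = 0"
  proof
    assume "norm x = 0"
    then have "norm (ualg x) = 0" "cmod (uscal x) = 0"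
      using norm_ualg[of x] norm_uscal[of x] by auto
    then show "x = 0" by (cases x) (simp add: unitization_ops)
  next
    assume "x = 0"
    then show "norm x = 0" using norm_unitization_le[of x] norm_unitization_nonneg[of x]
      by (simp add: unitization_ops)
  qed
  show "norm (x + y) \<le> norm x + norm y"
  proof (rule norm_unitization_bound)
    show "cmod (uscal (x + y)) \<le> norm x + norm y"
      using norm_uscal[of x] norm_uscal[of y]
      by (simp add: unitization_ops norm_triangle_le)
    show "norm (uact (x + y) c) \<le> (norm x + norm y) * norm c" for c
      using norm_uact[of x c] norm_uact[of y c] by (simp add: uact_add distrib_right norm_triangle_le)
  qed (simp add: norm_unitization_nonneg)
  show "norm (r *\<^sub>R x) = \<bar>r\<bar> * norm x" by (simp add: scaleR_unitization_def norm_unitization_scaleC)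
  show "norm (x * y) \<le> norm x * norm y" by (rule norm_unitization_mult)
  show "norm (1 :: 'a unitization) = 1"
  proof (rule antisym)
    show "norm (1 :: 'a unitization) \<le> 1"
      by (rule norm_unitization_bound) (auto simp: uact_one, simp add: unitization_ops)
    show "1 \<le> norm (1 :: 'a unitization)"
      using norm_uscal[of "1 :: 'a unitization"] by (simp add: unitization_ops)
  qed
qed

end

instance unitization :: (cstar_algebra) banach
proof
  fix X :: "nat \<Rightarrow> 'a unitization" assume X: "Cauchy X"
  note d = dist_norm[where 'a = "'a unitization"]
  have "Cauchy (\<lambda>n. ualg (X n))"
  proof (rule metric_CauchyI)
    fix e :: real assume "0 < e"
    then obtain M where M: "\<And>m n. m \<ge> M \<Longrightarrow> n \<ge> M \<Longrightarrow> dist (X m) (X n) < e / 2"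
      using X unfolding Cauchy_def by (meson half_gt_zero)
    have "dist (ualg (X m)) (ualg (X n)) < e" if "m \<ge> M" "n \<ge> M" for m n
      using M[OF that] norm_ualg[of "X m - X n"] by (simp add: d dist_norm unitization_ops)
    then show "\<exists>M. \<forall>m\<ge>M. \<forall>n\<ge>M. dist (ualg (X m)) (ualg (X n)) < e" by blast
  qed
  then obtain a where a: "(\<lambda>n. ualg (X n)) \<longlonglongrightarrow> a" by (meson Cauchy_convergent convergent_def)
  have "Cauchy (\<lambda>n. uscal (X n))"
  proof (rule metric_CauchyI)
    fix e :: real assume "0 < e"
    then obtain M where M: "\<And>m n. m \<ge> M \<Longrightarrow> n \<ge> M \<Longrightarrow> dist (X m) (X n) < e"
      using X unfolding Cauchy_def by meson
    have "dist (uscal (X m)) (uscal (X n)) < e" if "m \<ge> M" "n \<ge> M" for m n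
      using M[OF that] norm_uscal[of "X m - X n"] by (simp add: d dist_norm unitization_ops)
    then show "\<exists>M. \<forall>m\<ge>M. \<forall>n\<ge>M. dist (uscal (X m)) (uscal (X n)) < e" by blast
  qed
  then obtain l where l: "(\<lambda>n. uscal (X n)) \<longlonglongrightarrow> l" by (meson Cauchy_convergent convergent_def)
  have "(\<lambda>n. norm (ualg (X n) - a) + cmod (uscal (X n) - l)) \<longlonglongrightarrow> 0"
    using tendsto_add[OF tendsto_norm[OF LIM_zero[OF a]] tendsto_norm[OF LIM_zero[OF l]]] by simp
  then have lim: "(\<lambda>n. norm (X n - Unitization a l)) \<longlonglongrightarrow> 0"
  proof (rule Lim_null_comparison[rotated])
    show "\<forall>\<^sub>F n in sequentially. norm (norm (X n - Unitization a l))
        \<le> norm (ualg (X n) - a) + cmod (uscal (X n) - l)"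
      using norm_unitization_le[of "X n - Unitization a l" for n] norm_unitization_nonneg
      by (auto simp: unitization_ops)
  qed
  show "convergent X"
  proof (unfold convergent_def, intro exI[of _ "Unitization a l"])
    show "X \<longlonglongrightarrow> Unitization a l"
      unfolding tendsto_iff d using lim by (auto simp: tendsto_iff norm_unitization_nonneg)
  qed
qed

instantiation unitization :: (cstar_algebra) unital_cstar_algebra
begin

definition star_unitization :: "'a unitization \<Rightarrow> 'a unitization"
  where "star x = Unitization (star (ualg x)) (cnj (uscal x))"

text \<open>The algebra is a Hilbert module over itself with inner product
  \<open>star c * d\<close>; on it \<open>uact x\<close> has the adjoint
  \<open>uact (star x)\<close>.\<close>

lemma star_uact: "star (uact x c) * uact y d = star c * uact (star x * y) d"
  by (simp add: uact_mult) (simp add: uact_def unitization_ops star_unitization_def star_add star_mult star_scaleC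
      distrib_left distrib_right mult_scaleC_left mult_scaleC_right mult.assoc scaleC_add_right)

text \<open>Both entries of the maximum obey the inequality: the character with equality, the
  operator norm by \<open>star_uact\<close>. The reverse inequality follows later from
  submultiplicativity and \<open>norm_unitization_star\<close>.\<close>

lemma norm_unitization_square: "(norm x)\<^sup>2 \<le> norm (star x * (x :: 'a unitization))"
proof -
  have "norm x \<le> sqrt (norm (star x * x))"
  proof (rule norm_unitization_bound)
    have "(cmod (uscal x))\<^sup>2 = cmod (uscal (star x * x))"
      by (simp add: unitization_ops star_unitization_def norm_mult power2_eq_square)
    also have "\<dots> \<le> norm (star x * x)" by (rule norm_uscal)
    finally show "cmod (uscal x) \<le> sqrt (norm (star x * x))" by (rule real_le_rsqrt)
    fix c
    have "(norm (uact x c))\<^sup>2 = norm (star c * uact (star x * x) c)"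
      by (simp flip: cstar_identity star_uact)
    also have "\<dots> \<le> norm c * (norm (star x * x) * norm c)"
      by (intro order_trans[OF norm_mult_ineq] mult_mono norm_uact) (auto simp: norm_unitization_nonneg)
    also have "\<dots> = (sqrt (norm (star x * x)) * norm c)\<^sup>2"
      by (simp add: power_mult_distrib norm_unitization_nonneg) (simp add: power2_eq_square)
    finally show "norm (uact x c) \<le> sqrt (norm (star x * x)) * norm c"
      by (rule power2_le_imp_le) (simp add: norm_unitization_nonneg)
  qed (simp add: norm_unitization_nonneg)
  then show ?thesis by (metis norm_unitization_nonneg power_mono real_sqrt_pow2)
qed

lemma norm_unitization_star: "norm (star (x :: 'a unitization)) = norm x"
proof -
  have le: "norm x \<le> norm (star x)" for x :: "'a unitization"
  proof (cases "norm x = 0")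
    case False
    have "norm x * norm x \<le> norm (star x) * norm x"
      using norm_unitization_square[of x] norm_unitization_mult[of "star x" x]
      by (simp add: power2_eq_square)
    then show ?thesis using False norm_unitization_nonneg[of x] by simp
  qed (simp add: norm_unitization_nonneg)
  have "star (star x) = x" by (simp add: unitization_ops star_unitization_def star_star)
  then show ?thesis using le[of x] le[of "star x"] by simp
qed

instance
proof
  fix x y :: "'a unitization" and r :: real and w :: complex
  show "norm (w *\<^sub>C x) = cmod w * norm x" by (rule norm_unitization_scaleC)
  show "w *\<^sub>C x * y = w *\<^sub>C (x * y)" "x * w *\<^sub>C y = w *\<^sub>C (x * y)"
    by (simp_all add: unitization_ops uact_def mult_scaleC_left mult_scaleC_right
        scaleC_add_left scaleC_add_right scaleC_scaleC algebra_simps)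
  show "r *\<^sub>R x = complex_of_real r *\<^sub>C x" by (rule scaleR_unitization_def)
  show "star (star x) = x" "star (x + y) = star x + star y" "star (w *\<^sub>C x) = cnj w *\<^sub>C star x"
    "star (x * y) = star y * star x"
    by (simp_all add: unitization_ops star_unitization_def uact_def star_star star_add star_scaleC star_mult)
  show "norm (star x * x) = (norm x)\<^sup>2"
    using norm_unitization_square[of x] norm_unitization_mult[of "star x" x]
    by (simp add: norm_unitization_star power2_eq_square)
qed

end

definition uemb :: "'a::cstar_algebra \<Rightarrow> 'a unitization"
  where "uemb a = Unitization a 0"

lemma norm_uemb [simp]: "norm (uemb a) = norm a"
proof (rule antisym)
  show "norm (uemb a) \<le> norm a" using norm_unitization_le[of "uemb a"] by (simp add: uemb_def)
  show "norm a \<le> norm (uemb a)"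
  proof (rule norm_alg_le)
    show "norm (a * c) \<le> norm (uemb a) * norm c" for c
      using norm_uact[of "uemb a" c] by (simp add: uact_def uemb_def)
  qed simp
qed

lemma inj_uemb [simp]: "uemb a = uemb b \<longleftrightarrow> a = b"
  by (simp add: uemb_def)

lemma uemb_add: "uemb (a + b) = uemb a + uemb b"
  and uemb_diff: "uemb (a - b) = uemb a - uemb b"
  and uemb_0 [simp]: "uemb 0 = 0"
  and uemb_mult: "uemb (a * b) = uemb a * uemb b"
  and uemb_star: "uemb (star a) = star (uemb a)"
  and uemb_scaleC: "uemb (z *\<^sub>C a) = z *\<^sub>C uemb a"
  by (simp_all add: uemb_def unitization_ops star_unitization_def uact_def)

lemma uemb_scaleR: "uemb (r *\<^sub>R a) = r *\<^sub>R uemb a"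
  by (simp add: scaleR_scaleC uemb_scaleC)

lemma uemb_sum: "uemb (\<Sum>i\<in>A. f i) = (\<Sum>i\<in>A. uemb (f i))"
  by (induction A rule: infinite_finite_induct) (auto simp: uemb_add)

lemma mult_uemb: "x * uemb a = uemb (uact x a)"
  by (simp add: uemb_def unitization_ops)

lemma psd_uemb_star_mult: "psd (uemb (star c * c))"
  by (simp add: uemb_mult uemb_star psd_star_mult)

section \<open>Hilbert modules and the left action\<close>

lemma psd_conj:
  assumes "psd k" shows "psd (star c * k * c)"
proof -
  obtain s where s: "psd s" "s * s = k" using psd_root[OF assms] by metis
  then have "star (s * c) * (s * c) = star c * k * c"
    by (simp add: star_mult psd_star flip: s(2) mult.assoc)
  then show ?thesis using psd_star_mult by metis
qed

lemma scaleC_of_real: "complex_of_real r *\<^sub>C a = r *\<^sub>R (a::'a::cstar_algebra)"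
  by (simp add: scaleR_scaleC)

context hilbert_module
begin

lemma ip_add_left: "ip (x + y) z = ip x z + ip y z"
  by (metis ip_add_right ip_star star_add)

lemma ip_scaleC_left: "ip (c *\<^sub>C x) y = cnj c *\<^sub>C ip x y"
  by (metis ip_scaleC_right ip_star star_scaleC)

lemma ip_ract_left: "ip (x \<cdot> b) y = star b * ip x y"
  by (metis ip_ract ip_star star_mult)

lemma ip_zero_right [simp]: "ip x 0 = 0"
  by (metis add_cancel_right_left ip_add_right)

lemma ip_zero_left [simp]: "ip 0 x = 0"
  by (metis ip_star ip_zero_right star_zero)

lemma ip_minus_right: "ip x (- y) = - ip x y"
  by (metis add.right_inverse add_eq_0_iff ip_add_right ip_zero_right)

lemma ip_minus_left: "ip (- x) y = - ip x y"
  by (metis ip_minus_right ip_star star_minus)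

lemma ip_diff_right: "ip x (y - z) = ip x y - ip x z"
  by (simp only: diff_conv_add_uminus ip_add_right ip_minus_right)

lemma ip_diff_left: "ip (x - y) z = ip x z - ip y z"
  by (simp only: diff_conv_add_uminus ip_add_left ip_minus_left)

lemma ip_sum_right: "ip x (\<Sum>i\<in>A. f i) = (\<Sum>i\<in>A. ip x (f i))"
  by (induction A rule: infinite_finite_induct) (auto simp: ip_add_right)

lemma ip_sum_left: "ip (\<Sum>i\<in>A. f i) x = (\<Sum>i\<in>A. ip (f i) x)"
  by (induction A rule: infinite_finite_induct) (auto simp: ip_add_left)

lemma eq_by_ip: "(\<And>z. ip x z = ip y z) \<Longrightarrow> x = y"
  using ip_definite[of "x - y"] by (simp add: ip_diff_left)

definition mnorm :: "'e \<Rightarrow> real"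
  where "mnorm x = sqrt (norm (ip x x))"

lemma mnorm_nonneg [simp]: "0 \<le> mnorm x"
  by (simp add: mnorm_def)

lemma mnorm_square: "(mnorm x)\<^sup>2 = norm (ip x x)"
  by (simp add: mnorm_def)

lemma mnorm_zero_iff [simp]: "mnorm x = 0 \<longleftrightarrow> x = 0"
  using ip_definite by (auto simp: mnorm_def)

lemma mnorm_scaleC: "mnorm (c *\<^sub>C x) = cmod c * mnorm x"
  by (simp add: mnorm_def ip_scaleC_left ip_scaleC_right scaleC_scaleC norm_scaleC norm_mult
      real_sqrt_mult mult.assoc)

lemma psd_ip: "psd (uemb (ip x x))"
  using ip_positive[of x] psd_uemb_star_mult by (auto simp: cstar_positive_def)

lemma norm_ip_mono: "norm (ip x x) \<le> norm (ip x x + ip y y)"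
  using norm_mono_psd[OF psd_ip[of x] psd_ip[of y]] by (simp flip: uemb_add)

text \<open>Cauchy-Schwarz. Up to sign, \<open>z\<close> is \<open>y\<close> minus its projection
  onto \<open>x\<close>, except that the scalar \<open>M\<close> replaces the possibly not
  invertible \<open>ip x x\<close>. The excess of \<open>M\<close> over \<open>ip x x\<close> is
  positive, so \<open>ip y y\<close> exceeds \<open>star c * c / M\<close> by positive
  terms.\<close>

lemma norm_ip_le: "norm (ip x y) \<le> mnorm x * mnorm y"
proof (cases "x = 0")
  case False
  define M where "M = norm (ip x x)"
  have M: "M > 0" using False ip_definite by (auto simp: M_def)
  define c where "c = ip x y"
  define z where "z = x \<cdot> ((1/M) *\<^sub>R c) - y"
  have "psd (star (uemb c) * (of_real M - uemb (ip x x)) * uemb c)"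
    by (intro psd_conj psd_of_real_minus psd_ip) (simp add: M_def)
  also have "star (uemb c) * (of_real M - uemb (ip x x)) * uemb c
      = uemb (M *\<^sub>R (star c * c) - star c * ip x x * c)"
    by (simp add: uemb_diff uemb_mult uemb_star uemb_scaleR algebra_simps of_real_def)
  finally have 1: "psd (uemb (M *\<^sub>R (star c * c) - star c * ip x x * c))" .
  have zz: "ip z z = (1/M)\<^sup>2 *\<^sub>R (star c * ip x x * c) - (2/M) *\<^sub>R (star c * c) + ip y y"
  proof -
    have yx: "ip y x = star c" by (simp add: c_def ip_star)
    show ?thesis unfolding z_def
      by (simp add: ip_diff_left ip_diff_right ip_ract ip_ract_left yx flip: c_def)
        (simp add: star_scaleR algebra_simps power2_eq_square flip: scaleR_2)
  qed
  have eq: "ip y y = (1/M) *\<^sub>R (star c * c)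
      + ((1/M)\<^sup>2 *\<^sub>R (M *\<^sub>R (star c * c) - star c * ip x x * c) + ip z z)"
    unfolding zz using M by (simp add: algebra_simps power2_eq_square flip: scaleR_add_left)
  have "norm (uemb ((1/M) *\<^sub>R (star c * c))) \<le> norm (uemb (ip y y))"
    unfolding eq uemb_add[of "(1/M) *\<^sub>R (star c * c)"]
    by (intro norm_mono_psd)
      (use M 1 psd_ip in \<open>auto simp: uemb_scaleR uemb_add intro!: psd_scaleR psd_add psd_uemb_star_mult\<close>)
  then have "(norm c)\<^sup>2 \<le> M * norm (ip y y)"
    using M by (simp add: cstar_identity field_simps)
  then have "(norm c)\<^sup>2 \<le> (mnorm x * mnorm y)\<^sup>2"
    by (simp add: power_mult_distrib mnorm_square M_def)
  then show ?thesis unfolding c_def by (rule power2_le_imp_le) simp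
qed simp

end

context correspondence
begin

lemma lact_scaleC_right: "lact b (c *\<^sub>C x) = c *\<^sub>C lact b x"
  by (rule eq_by_ip) (simp add: lact_star ip_scaleC_left)

lemma lact_zero_left [simp]: "lact 0 x = 0"
  by (metis add_cancel_right_left lact_add)

lemma lact_diff_left: "lact (b - c) x = lact b x - lact c x"
  by (metis add_diff_cancel diff_add_cancel lact_add)

lemma lact_sum_left: "lact (\<Sum>i\<in>A. f i) x = (\<Sum>i\<in>A. lact (f i) x)"
  by (induction A rule: infinite_finite_induct) (auto simp: lact_add)

lemma ip_lact_right: "ip x (lact b y) = ip (lact (star b) x) y"
  by (simp add: lact_star star_star)

text \<open>\<open>r\<close> is the square root of \<open>(norm b)\<^sup>2 - star b * b\<close> in the unitization.\<close>

lemma lact_defect: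
  obtains r where
    "\<And>x y. ip (r x) (r y) = (norm b)\<^sup>2 *\<^sub>R ip x y - ip (lact b x) (lact b y)"
proof (cases "b = 0")
  case True
  show thesis by (rule that[of "\<lambda>x. 0"]) (simp add: True)
next
  case False
  define M where "M = (norm b)\<^sup>2"
  have M: "M > 0" using False by (simp add: M_def)
  define h where "h = (1/M) *\<^sub>R (star b * b)"
  have "star h = h" "norm h \<le> 1"
    using M by (auto simp: h_def star_scaleR star_mult star_star cstar_identity M_def)
  then obtain s where s: "star s = s" "s + s = h + s * s" using half_root_exists by metis
  \<comment> \<open>The root is \<open>norm b\<close> times \<open>1 - s\<close>; the unit of the
    unitization acts on the module as the identity.\<close>
  define r where "r x = complex_of_real (norm b) *\<^sub>C (x - lact s x)" for x
  show thesis
  proof (rule that[of r])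
    fix x y
    have lh: "lact h y = complex_of_real (1/M) *\<^sub>C lact (star b) (lact b y)"
      by (simp only: h_def scaleR_scaleC lact_scaleC lact_mult)
    have "ip (x - lact s x) (y - lact s y) = ip x y - ip x (lact (s + s - s * s) y)"
      by (simp add: ip_diff_left ip_diff_right lact_star s(1) lact_diff_left lact_add lact_mult
          ip_add_right)
    also have "\<dots> = ip x y - (1/M) *\<^sub>R ip (lact b x) (lact b y)"
      unfolding s(2) by (simp only: add_diff_cancel_right' lh ip_scaleC_right scaleC_of_real lact_star)
    finally show "ip (r x) (r y) = (norm b)\<^sup>2 *\<^sub>R ip x y - ip (lact b x) (lact b y)"
      using M unfolding r_def ip_scaleC_left ip_scaleC_right complex_cnj_complex_of_real scaleC_of_real
      by (simp add: scaleR_diff_right M_def power2_eq_square)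
  qed
qed

lemma mnorm_lact: "mnorm (lact b x) \<le> norm b * mnorm x"
proof -
  obtain r where "\<And>x y. ip (r x) (r y) = (norm b)\<^sup>2 *\<^sub>R ip x y - ip (lact b x) (lact b y)"
    using lact_defect by metis
  then have "norm (ip (lact b x) (lact b x)) \<le> norm ((norm b)\<^sup>2 *\<^sub>R ip x x)"
    using norm_ip_mono[of "lact b x" "r x"] by simp
  then have "(mnorm (lact b x))\<^sup>2 \<le> (norm b * mnorm x)\<^sup>2"
    by (simp add: mnorm_square power_mult_distrib)
  then show ?thesis by (rule power2_le_imp_le) simp
qed

lemma norm_ip_lact_le: "norm (ip x (lact b y)) \<le> mnorm x * norm b * mnorm y"
proof -
  have "norm (ip x (lact b y)) \<le> mnorm x * mnorm (lact b y)" by (rule norm_ip_le)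
  also have "\<dots> \<le> mnorm x * (norm b * mnorm y)" by (intro mult_left_mono mnorm_lact mnorm_nonneg)
  finally show ?thesis by (simp add: mult.assoc)
qed

text \<open>The root of \<open>uemb h\<close> has scalar part \<open>0\<close> because its square
  has. Hence \<open>h = star q * q\<close> within the algebra, where \<open>lact\<close> is
  defined.\<close>

lemma psd_ip_lact:
  assumes "psd (uemb h)" shows "psd (uemb (ip x (lact h x)))"
proof -
  obtain s where s: "psd s" "s * s = uemb h" using psd_root[OF assms] by metis
  have "uscal s * uscal s = 0" using arg_cong[OF s(2), of uscal] by (simp add: unitization_ops uemb_def)
  then obtain q where q: "s = uemb q" by (cases s) (auto simp: uemb_def)
  have "uemb (star q * q) = uemb h" using s psd_star[OF s(1)] by (simp add: q uemb_mult uemb_star)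
  then have "h = star q * q" by simp
  then have "ip x (lact h x) = ip (lact q x) (lact q x)" by (simp add: lact_star lact_mult)
  then show ?thesis by (simp add: psd_ip)
qed

end

context faithful_correspondence
begin

text \<open>The left action is isometric on positive elements: otherwise a spectral cut-off \<open>n\<close> of
  \<open>h\<close> at a level \<open>\<rho>\<close> between the two norms would act as zero.\<close>

lemma ip_lact_almost_attains_norm:
  assumes h: "psd (uemb h)" and \<delta>: "0 \<le> \<delta>" "\<delta> < norm h"
  obtains x where "mnorm x \<le> 1" "\<delta> < norm (ip x (lact h x))"
proof (rule ccontr)
  assume "\<not> thesis"
  with that have small: "norm (ip x (lact h x)) \<le> \<delta>" if "mnorm x \<le> 1" for x
    using that by (meson not_le)
  have bound: "norm (ip x (lact h x)) \<le> \<delta> * (mnorm x)\<^sup>2" for x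
  proof (cases "x = 0")
    case False
    define m where "m = mnorm x"
    have m: "m > 0" using False mnorm_nonneg[of x] mnorm_zero_iff[of x] unfolding m_def by linarith
    have "norm (ip (complex_of_real (1/m) *\<^sub>C x) (lact h (complex_of_real (1/m) *\<^sub>C x))) \<le> \<delta>"
      by (rule small) (use m in \<open>simp add: mnorm_scaleC norm_divide flip: m_def\<close>)
    also have "ip (complex_of_real (1/m) *\<^sub>C x) (lact h (complex_of_real (1/m) *\<^sub>C x))
        = (1/m)\<^sup>2 *\<^sub>R ip x (lact h x)"
      unfolding lact_scaleC_right ip_scaleC_left ip_scaleC_right complex_cnj_complex_of_real scaleC_of_real
      by (simp add: power2_eq_square)
    finally show ?thesis using m by (simp add: field_simps flip: m_def)
  qed (use \<delta> in simp)
  define \<rho> where "\<rho> = (\<delta> + norm h) / 2"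
  have \<rho>: "\<delta> < \<rho>" "\<rho> < norm h" using \<delta> by (auto simp: \<rho>_def)
  define k where "k = of_real \<rho> - uemb h"
  have sh: "star (uemb h) = uemb h" using h by (rule psd_star)
  then have "star k = k" by (simp add: k_def star_diff)
  then obtain n p where n: "star n = n" "psd p" "k = p - 2 *\<^sub>R n" "k * n = - (n * n)"
    "n * k = - (n * n)" "psd (n * n * n)" using negative_part by metis
  \<comment> \<open>\<open>w\<close> serves as the power 3/2 of \<open>n\<close>. Multiplying both
    by \<open>h\<close> moves them into the algebra, so that they act on the module.\<close>
  obtain w where w: "psd w" "w * w = n * n * n" using psd_root[OF n(6)] by metis
  define m where "m = uact n h"
  define q where "q = uact w h"
  have m: "uemb m = n * uemb h" and q: "uemb q = w * uemb h" by (simp_all add: m_def q_def mult_uemb)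
  have "lact m x = 0" for x
  proof -
    let ?y = "lact m x"
    \<comment> \<open>On the range of \<open>m\<close> the element \<open>h\<close> is at least
      \<open>\<rho>\<close>, which \<open>bound\<close> permits only if that range is zero.\<close>
    have "uemb (star m * h * m) = uemb (\<rho> *\<^sub>R (star m * m) + star q * q)"
    proof -
      have "uemb (star m * h * m) = uemb h * n * (of_real \<rho> - k) * n * uemb h"
        by (simp add: uemb_mult uemb_star m star_mult n(1) sh k_def mult.assoc)
      also have "\<dots> = \<rho> *\<^sub>R (uemb h * n * (n * uemb h)) - uemb h * n * (k * n) * uemb h"
        by (simp add: algebra_simps of_real_def)
      also have "uemb h * n * (k * n) * uemb h = - (uemb h * (w * w) * uemb h)"
        by (simp add: n(4) w(2) mult.assoc)
      also have "\<rho> *\<^sub>R (uemb h * n * (n * uemb h)) - - (uemb h * (w * w) * uemb h)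
          = uemb (\<rho> *\<^sub>R (star m * m) + star q * q)"
        by (simp add: uemb_add uemb_scaleR uemb_mult uemb_star m q star_mult n(1) sh psd_star[OF w(1)]
            mult.assoc)
      finally show ?thesis .
    qed
    then have "star m * h * m = \<rho> *\<^sub>R (star m * m) + star q * q" by simp
    then have "ip x (lact (star m * h * m) x)
        = \<rho> *\<^sub>R ip x (lact (star m * m) x) + ip x (lact (star q * q) x)"
      by (simp add: lact_add ip_add_right) (simp add: scaleR_scaleC lact_scaleC ip_scaleC_right)
    then have eq: "ip ?y (lact h ?y) = \<rho> *\<^sub>R ip ?y ?y + ip (lact q x) (lact q x)"
      by (simp add: lact_mult lact_star)
    have "norm (uemb (\<rho> *\<^sub>R ip ?y ?y)) \<le> norm (uemb (\<rho> *\<^sub>R ip ?y ?y) + uemb (ip (lact q x) (lact q x)))"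
      using \<rho> \<delta> by (intro norm_mono_psd psd_ip) (simp add: uemb_scaleR psd_scaleR psd_ip)
    then have "\<rho> * (mnorm ?y)\<^sup>2 \<le> \<delta> * (mnorm ?y)\<^sup>2"
      using bound[of ?y] \<rho> \<delta> unfolding eq by (simp add: mnorm_square flip: uemb_add)
    then have "(mnorm ?y)\<^sup>2 \<le> 0" using \<rho> by (simp add: mult_le_cancel_right)
    then show ?thesis by simp
  qed
  then have "lact m = lact 0" by auto
  then have "m = 0" using lact_faithful by (simp add: inj_eq)
  \<comment> \<open>As \<open>n\<close> annihilates \<open>h\<close>, the product
    \<open>n * k\<close> is both \<open>\<rho>\<close> times \<open>n\<close> and
    \<open>- (n * n)\<close>; a further factor \<open>n\<close> gives two positive elements with sum
    \<open>0\<close>. Once \<open>n\<close> is gone, \<open>k\<close> is positive and the norm of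
    \<open>h\<close> cannot exceed \<open>\<rho>\<close>.\<close>
  then have nh: "n * uemb h = 0" using m by simp
  have "\<rho> *\<^sub>R n = n * k" by (simp add: k_def algebra_simps nh of_real_def)
  then have "\<rho> *\<^sub>R (n * n) + n * n * n = 0"
    by (metis n(5) add.left_inverse add.commute mult_minus_left mult_scaleR_left mult.assoc neg_eq_iff_add_eq_0)
  moreover have "psd (\<rho> *\<^sub>R (n * n))" using \<rho> \<delta> by (intro psd_scaleR psd_square n) auto
  ultimately have "\<rho> *\<^sub>R (n * n) = 0" using psd_sum_zero n(6) by blast
  then have "n * n = 0" using \<rho> \<delta> by simp
  then have "n = 0" using selfadjoint_cube_zero n(1) by (metis mult_zero_left)
  then have "psd k" using n by simp
  then have "norm (uemb h) \<le> \<rho>" unfolding k_def using h \<rho> \<delta> by (intro norm_le_of_psd) auto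
  then show False using \<rho> by simp
qed

end

section \<open>Gram matrices and words\<close>

text \<open>With \<open>b = 1 - a\<close>, the telescoping sum \<open>1 - b ^ m\<close> consists of
  \<open>m\<close> terms \<open>a * b ^ k\<close>, each at least \<open>a * b ^ m\<close>. The
  induction in \<open>step\<close> proves the comparison without forming the sum.\<close>

lemma norm_mult_power_one_minus:
  fixes a :: "'a::unital_cstar_algebra"
  assumes "psd a" "norm a \<le> 1"
  shows "real m * norm (a * (1 - a) ^ m) \<le> 1"
proof -
  define b where "b = 1 - a"
  have b: "psd b" using psd_of_real_minus[OF assms] by (simp add: b_def)
  have ab: "a * b = b * a" by (simp add: b_def algebra_simps)
  have comm: "a * b ^ k = b ^ k * a" for k
    by (induction k) (simp_all add: ab mult.assoc[symmetric], simp add: mult.assoc)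
  have abk: "psd (a * b ^ k)" for k by (intro psd_mult_commute assms psd_power b comm)
  have step: "psd (1 - b ^ m - real m *\<^sub>R (a * b ^ m))"
  proof (induction m)
    case (Suc m)
    have "psd (a * (a * b ^ m))" by (rule psd_mult_commute[OF assms(1) abk]) (simp only: mult.assoc comm[symmetric])
    then have "psd ((1 - b ^ m - real m *\<^sub>R (a * b ^ m)) + real (Suc m) *\<^sub>R (a * (a * b ^ m)))"
      by (intro psd_add Suc psd_scaleR) auto
    moreover have "1 - b ^ Suc m - real (Suc m) *\<^sub>R (a * b ^ Suc m)
        = (1 - b ^ m - real m *\<^sub>R (a * b ^ m)) + real (Suc m) *\<^sub>R (a * (a * b ^ m))"
    proof -
      have "b ^ Suc m = b ^ m - a * b ^ m" by (simp add: b_def algebra_simps)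
      then show ?thesis by (simp only:) (simp add: algebra_simps)
    qed
    ultimately show ?case by (simp only:)
  qed simp
  have "psd (of_real 1 - real m *\<^sub>R (a * b ^ m))"
    using psd_add[OF step psd_power[OF b, of m]] by simp
  then have "norm (real m *\<^sub>R (a * b ^ m)) \<le> 1"
    by (intro norm_le_of_psd psd_scaleR abk) auto
  then show ?thesis by (simp add: b_def)
qed

text \<open>\<open>g\<close> is a truncation of the Neumann series for the inverse of \<open>a\<close>, so that
  \<open>1 - e\<^sup>2 a = (1 - g a)\<^sup>2\<close> is small where \<open>a\<close> is not.\<close>

lemma approximate_inverse:
  fixes a :: "'a::unital_cstar_algebra"
  assumes a: "psd a" and "0 < \<epsilon>"
  obtains g e where "star g = g" "star e = e" "a * e = e * a" "e * e = g + g - g * a * g"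
    "norm ((1 - e * e * a) * a * (1 - e * e * a)) \<le> \<epsilon>"
proof -
  define M where "M = norm a + 1"
  have M: "M > 0" by (simp add: M_def add_nonneg_pos)
  define a' where "a' = (1/M) *\<^sub>R a"
  have a': "psd a'" "norm a' \<le> 1" "a = M *\<^sub>R a'"
    using M a by (auto simp: a'_def psd_scaleR) (simp add: M_def)
  define b where "b = 1 - a'"
  have b: "psd b" using psd_of_real_minus[OF a'(1,2)] by (simp add: b_def)
  \<comment> \<open>The residual to be estimated will be \<open>M\<close> times
    \<open>a' * b ^ (4 * n)\<close>, of norm at most \<open>M / n\<close>.\<close>
  obtain n where n: "M / \<epsilon> < real n" using reals_Archimedean2 by blast
  then have n0: "real n > 0" using M \<open>0 < \<epsilon>\<close> by (smt (verit) divide_pos_pos)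
  define g where "g = (\<Sum>k<n. b ^ k)"
  have comm: "a' * b ^ k = b ^ k * a'" for k
    using power_commutes[of b k] by (simp add: b_def algebra_simps)
  have ag: "a' * g = 1 - b ^ n"
    unfolding g_def by (induction n) (simp_all add: b_def algebra_simps)
  then have ga: "g * a' = 1 - b ^ n"
    by (simp add: g_def sum_distrib_left sum_distrib_right comm)
  have gb: "g * b ^ k = b ^ k * g" for k
    by (simp add: g_def sum_distrib_left sum_distrib_right flip: power_add) (simp add: add.commute)
  have psdg: "psd g" unfolding g_def by (intro psd_sum psd_power b)
  \<comment> \<open>This element is \<open>g + g - g * a' * g\<close>, as
    \<open>g * a' = 1 - b ^ n\<close>; its positivity provides the root \<open>e\<close>.\<close>
  have "psd (g * (1 + b ^ n))"
    by (intro psd_mult_commute psdg psd_add psd_power b) (auto simp: algebra_simps gb)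
  then obtain e where e: "psd e" "e * e = g * (1 + b ^ n)"
    "\<And>c. c * (g * (1 + b ^ n)) = g * (1 + b ^ n) * c \<Longrightarrow> c * e = e * c"
    using psd_root by metis
  have "a' * (g * (1 + b ^ n)) = (1 - b ^ n) * (1 + b ^ n)" by (simp add: ag flip: mult.assoc)
  also have "\<dots> = g * (1 + b ^ n) * a'"
  proof -
    have "g * (1 + b ^ n) * a' = (g * a') * (1 + b ^ n)" using comm[of n] by (simp add: algebra_simps)
    then show ?thesis by (simp add: ga)
  qed
  finally have a'e: "a' * e = e * a'" by (rule e(3))
  have eea: "e * e * a' = 1 - b ^ (2 * n)"
  proof -
    have "e * e * a' = (g * a') * (1 + b ^ n)" using comm[of n] by (simp add: e(2) algebra_simps)
    also have "\<dots> = 1 - b ^ (2 * n)" unfolding ga by (simp add: algebra_simps flip: power_add mult_2)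
    finally show ?thesis .
  qed
  define r where "r = 1 / sqrt M"
  have r: "r * r = 1/M" using M by (simp add: r_def)
  have eea_eq: "(r *\<^sub>R e) * (r *\<^sub>R e) * a = e * e * a'"
    using M by (simp add: a'(3) r)
  show thesis
  proof (rule that[of "(1/M) *\<^sub>R g" "r *\<^sub>R e"])
    show "star ((1/M) *\<^sub>R g) = (1/M) *\<^sub>R g" "star (r *\<^sub>R e) = r *\<^sub>R e"
      using psdg e(1) by (simp_all add: star_scaleR psd_star)
    show "a * (r *\<^sub>R e) = (r *\<^sub>R e) * a" using a'e by (simp add: a'(3))
    have "g + g - g * a' * g = g * (1 + b ^ n)"
      by (simp add: mult.assoc ag) (simp add: algebra_simps)
    moreover have "(1/M) *\<^sub>R g * a * (1/M) *\<^sub>R g = (1/M) *\<^sub>R (g * a' * g)"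
      using M by (simp add: a'(3))
    ultimately show "(r *\<^sub>R e) * (r *\<^sub>R e) = (1/M) *\<^sub>R g + (1/M) *\<^sub>R g - (1/M) *\<^sub>R g * a * (1/M) *\<^sub>R g"
      by (simp add: r e(2) flip: scaleR_add_right scaleR_diff_right)
    have "(1 - (r *\<^sub>R e) * (r *\<^sub>R e) * a) * a * (1 - (r *\<^sub>R e) * (r *\<^sub>R e) * a)
        = b ^ (2*n) * (M *\<^sub>R a') * b ^ (2*n)"
      unfolding eea_eq eea by (simp add: a'(3))
    also have "\<dots> = M *\<^sub>R ((b ^ (2*n) * a') * b ^ (2*n))" by simp
    also have "(b ^ (2*n) * a') * b ^ (2*n) = a' * b ^ (2*n + 2*n)"
      by (simp only: comm[symmetric] mult.assoc power_add)
    also have "2*n + 2*n = 4*n" by simp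
    finally have "norm ((1 - (r *\<^sub>R e) * (r *\<^sub>R e) * a) * a * (1 - (r *\<^sub>R e) * (r *\<^sub>R e) * a))
        = M * norm (a' * b ^ (4 * n))" using M by simp
    also have "\<dots> \<le> M * (1 / real n)"
    proof (rule mult_left_mono)
      have "4 * (real n * norm (a' * b ^ (4 * n))) \<le> 1"
        using norm_mult_power_one_minus[OF a'(1,2), of "4 * n"] by (simp add: b_def)
      then have "real n * norm (a' * b ^ (4 * n)) \<le> 1"
        using mult_nonneg_nonneg[of "real n" "norm (a' * b ^ (4 * n))"] by simp
      then show "norm (a' * b ^ (4 * n)) \<le> 1 / real n" using n0 by (simp add: field_simps)
    qed (use M in simp)
    also have "M * (1 / real n) \<le> \<epsilon>" using n n0 \<open>0 < \<epsilon>\<close> by (simp add: field_simps)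
    finally show "norm ((1 - (r *\<^sub>R e) * (r *\<^sub>R e) * a) * a * (1 - (r *\<^sub>R e) * (r *\<^sub>R e) * a)) \<le> \<epsilon>" .
  qed
qed

context hilbert_module
begin

lemma ip_diff_ract:
  "ip (x - z \<cdot> p) (y - z \<cdot> q) = ip x y - ip x z * q - star p * ip z y + star p * ip z z * q"
  by (simp add: ip_diff_left ip_diff_right ip_ract ip_ract_left algebra_simps)

text \<open>Approximate block Cholesky decomposition: the last vector is split off from the others.\<close>

lemma gram_matrix_approx:
  fixes x :: "nat \<Rightarrow> 'e"
  assumes "0 < \<epsilon>"
  shows "\<exists>(m::nat) c. \<forall>i<n. \<forall>j<n. norm (ip (x i) (x j) - (\<Sum>k<m. star (c k i) * c k j)) \<le> \<epsilon>"
proof (induction n arbitrary: x)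
  case (Suc n)
  define a where "a = ip (x n) (x n)"
  \<comment> \<open>The residual \<open>z\<close> of the last vector will have norm at most
    \<open>\<epsilon> / C\<close>, so its inner products with the \<open>x j\<close> are at most
    \<open>\<epsilon>\<close>.\<close>
  define C where "C = (\<Sum>j\<le>n. mnorm (x j)) + 1"
  have "C > 0" by (auto simp: C_def intro!: add_nonneg_pos sum_nonneg)
  have C: "mnorm (x j) \<le> C" if "j \<le> n" for j
    using member_le_sum[of j "{..n}" "\<lambda>j. mnorm (x j)"] that by (simp add: C_def)
  have "0 < (\<epsilon> / C)\<^sup>2" using \<open>C > 0\<close> assms by simp
  then obtain g e where ge: "star g = g" "star e = e" "uemb a * e = e * uemb a"
    "e * e = g + g - g * uemb a * g"
    "norm ((1 - e * e * uemb a) * uemb a * (1 - e * e * uemb a)) \<le> (\<epsilon> / C)\<^sup>2"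
    using approximate_inverse[OF psd_ip[of "x n"]] unfolding a_def by metis
  have sa: "star (uemb a) = uemb a" by (simp add: a_def ip_star flip: uemb_star)
  \<comment> \<open>Subtracting this approximate projection onto \<open>x n\<close> lowers the Gram
    matrix by exactly \<open>star (d i) * d j\<close>, thanks to the equation for
    \<open>e * e\<close>. Errors arise only in the row and column split off and do not add up over
    the induction.\<close>
  define x' where "x' i = x i - x n \<cdot> uact g (ip (x n) (x i))" for i
  define d where "d i = uact e (ip (x n) (x i))" for i
  obtain m :: nat and c where c: "\<And>i j. i < n \<Longrightarrow> j < n \<Longrightarrow>
      norm (ip (x' i) (x' j) - (\<Sum>k<m. star (c k i) * c k j)) \<le> \<epsilon>"
    using Suc.IH[of x'] by blast
  \<comment> \<open>Row \<open>m\<close> is new; the vector split off gets zeros in the earlier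
    rows, which describe the vectors \<open>x'\<close> only.\<close>
  define c' where "c' k i = (if k = m then d i else if i = n then 0 else c k i)" for k i
  have x': "ip (x' i) (x' j) = ip (x i) (x j) - star (d i) * d j" for i j
  proof -
    let ?p = "uemb (ip (x n) (x i))" and ?q = "uemb (ip (x n) (x j))"
    have "uemb (ip (x' i) (x' j)) = uemb (ip (x i) (x j)) - star ?p * (g * ?q)
        - star (g * ?p) * ?q + star (g * ?p) * uemb a * (g * ?q)"
      unfolding x'_def ip_diff_ract ip_star[of "x n" "x i", symmetric]
      by (simp only: uemb_diff uemb_add uemb_mult uemb_star a_def flip: mult_uemb)
    also have "\<dots> = uemb (ip (x i) (x j)) - star ?p * (g + g - g * uemb a * g) * ?q"
      by (simp only: star_mult ge(1) distrib_left distrib_right left_diff_distrib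
          right_diff_distrib mult.assoc) (simp only: diff_diff_eq diff_add_eq add_diff_eq diff_diff_eq2)
    also have "\<dots> = uemb (ip (x i) (x j)) - star ?p * (e * e) * ?q" by (simp only: ge(4))
    also have "\<dots> = uemb (ip (x i) (x j) - star (d i) * d j)"
      by (simp add: d_def star_mult ge(2) uemb_diff uemb_mult uemb_star mult.assoc
          flip: mult_uemb)
    finally show ?thesis by simp
  qed
  define z where "z = x n - x n \<cdot> uact (e * e) a"
  have "uemb (ip z z) = (1 - e * e * uemb a) * uemb a * (1 - e * e * uemb a)"
  proof -
    have "uemb (ip z z) = uemb a - uemb a * (e * e * uemb a) - star (e * e * uemb a) * uemb a
        + star (e * e * uemb a) * uemb a * (e * e * uemb a)"
      unfolding z_def ip_diff_ract a_def
      by (simp only: uemb_diff uemb_add uemb_mult uemb_star flip: mult_uemb)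
    also have "star (e * e * uemb a) = e * e * uemb a"
      using ge(3) by (simp add: star_mult ge(2) sa) (metis mult.assoc)
    finally show ?thesis by (simp add: algebra_simps mult.assoc)
  qed
  with ge(5) have "norm (ip z z) \<le> (\<epsilon> / C)\<^sup>2" by (metis norm_uemb)
  then have z: "mnorm z \<le> \<epsilon> / C"
    unfolding mnorm_square[symmetric] by (rule power2_le_imp_le) (use \<open>C > 0\<close> assms in simp)
  have last: "norm (ip (x n) (x j) - star (d n) * d j) \<le> \<epsilon>" if "j \<le> n" for j
  proof -
    have "uemb (ip (x n) (x j) - star (d n) * d j)
        = uemb (ip (x n) (x j)) - uemb a * e * e * uemb (ip (x n) (x j))"
      by (simp add: d_def star_mult ge(2) uemb_diff uemb_mult uemb_star mult.assoc sa
          flip: mult_uemb a_def)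
    also have "\<dots> = uemb (ip z (x j))"
      unfolding z_def by (simp add: ip_diff_left ip_ract_left uemb_diff uemb_mult
          uemb_star star_mult ge(2) sa mult.assoc flip: mult_uemb)
    finally have "norm (ip (x n) (x j) - star (d n) * d j) = norm (ip z (x j))" by simp
    also have "\<dots> \<le> mnorm z * mnorm (x j)" by (rule norm_ip_le)
    also have "\<dots> \<le> (\<epsilon> / C) * C" using z C[OF that] assms \<open>C > 0\<close> by (intro mult_mono) auto
    finally show ?thesis using \<open>C > 0\<close> by simp
  qed
  have "norm (ip (x i) (x j) - (\<Sum>k<Suc m. star (c' k i) * c' k j)) \<le> \<epsilon>" if "i < Suc n" "j < Suc n" for i j
  proof (cases "i = n \<or> j = n")
    case True
    then have "(\<Sum>k<m. star (c' k i) * c' k j) = 0" by (intro sum.neutral) (auto simp: c'_def)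
    then have eq: "ip (x i) (x j) - (\<Sum>k<Suc m. star (c' k i) * c' k j) = ip (x i) (x j) - star (d i) * d j"
      by (simp add: c'_def)
    show ?thesis
    proof (cases "i = n")
      case True
      then show ?thesis unfolding eq using last[of j] that by simp
    next
      case False
      then have "j = n" using \<open>i = n \<or> j = n\<close> by simp
      have "norm (ip (x i) (x j) - star (d i) * d j) = norm (star (ip (x i) (x j) - star (d i) * d j))"
        by simp
      also have "\<dots> \<le> \<epsilon>" using last[of i] that \<open>j = n\<close>
        by (simp add: star_diff ip_star star_mult star_star del: norm_star)
      finally show ?thesis unfolding eq .
    qed
  next
    case False
    then have lt: "i < n" "j < n" using that by auto
    have "(\<Sum>k<m. star (c' k i) * c' k j) = (\<Sum>k<m. star (c k i) * c k j)"
      using lt by (intro sum.cong) (auto simp: c'_def)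
    then have "ip (x i) (x j) - (\<Sum>k<Suc m. star (c' k i) * c' k j)
        = ip (x' i) (x' j) - (\<Sum>k<m. star (c k i) * c k j)"
      by (simp add: c'_def x')
    then show ?thesis using c[OF lt] by simp
  qed
  then show ?case by blast
qed simp

end

section \<open>Inner products of words and their positivity\<close>

context correspondence
begin

text \<open>For \<open>a = ip y y'\<close> this is the algebra-valued inner product of
  \<open>y \<otimes> v 0 \<otimes> ...\<close> and \<open>y' \<otimes> w 0 \<otimes> ...\<close>,
  cut off after \<open>N\<close> further letters. A general \<open>a\<close> makes it possible to
  unroll the recursion from the front as well.\<close>

primrec chain :: "'b \<Rightarrow> (nat \<Rightarrow> 'e) \<Rightarrow> (nat \<Rightarrow> 'e) \<Rightarrow> nat \<Rightarrow> 'b"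
  where "chain a v w 0 = a"
  | "chain a v w (Suc N) = ip (v N) (lact (chain a v w N) (w N))"

lemma chain_Suc_front:
  "chain a v w (Suc N) = chain (ip (v 0) (lact a (w 0))) (\<lambda>n. v (Suc n)) (\<lambda>n. w (Suc n)) N"
  by (induction N) auto

lemma chain_add: "chain (a + b) v w N = chain a v w N + chain b v w N"
  by (induction N) (auto simp: lact_add ip_add_right)

lemma chain_scaleC: "chain (z *\<^sub>C a) v w N = z *\<^sub>C chain a v w N"
  by (induction N) (auto simp: lact_scaleC ip_scaleC_right)

lemma chain_diff: "chain (a - b) v w N = chain a v w N - chain b v w N"
  by (induction N) (auto simp: lact_diff_left ip_diff_right)

lemma chain_zero [simp]: "chain 0 v w N = 0"
  by (induction N) auto

lemma chain_sum: "chain (\<Sum>i\<in>A. f i) v w N = (\<Sum>i\<in>A. chain (f i) v w N)"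
  by (induction A rule: infinite_finite_induct) (auto simp: chain_add)

lemma star_chain: "star (chain a v w N) = chain (star a) w v N"
  by (induction N) (auto simp: ip_star ip_lact_right[symmetric] lact_star)

lemma norm_chain: "norm (chain a v w N) \<le> norm a * (\<Prod>i<N. mnorm (v i) * mnorm (w i))"
proof (induction N)
  case (Suc N)
  have "norm (chain a v w (Suc N)) \<le> mnorm (v N) * norm (chain a v w N) * mnorm (w N)"
    by (simp add: norm_ip_lact_le)
  also have "\<dots> \<le> mnorm (v N) * (norm a * (\<Prod>i<N. mnorm (v i) * mnorm (w i))) * mnorm (w N)"
    by (intro mult_right_mono mult_left_mono Suc) auto
  finally show ?case by (simp add: ac_simps)
qed simp

lemma psd_chain: "psd (uemb a) \<Longrightarrow> psd (uemb (chain a v v N))"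
  by (induction N) (auto intro: psd_ip_lact)

text \<open>If the matrix of the \<open>ip (y i) (y j)\<close> were a finite sum of terms
  \<open>star (c k i) * c k j\<close>, passing the first letter would turn each summand into the
  same statement for the vectors \<open>lact (c k i) (v i 0)\<close> and shorter words. The
  factorization is only approximate, which suffices since positive elements form a closed
  set.\<close>

lemma psd_sum_chain:
  fixes y :: "nat \<Rightarrow> 'e"
  shows "psd (uemb (\<Sum>i<n. \<Sum>j<n. chain (ip (y i) (y j)) (v i) (v j) N))"
proof (induction N arbitrary: y v)
  case 0
  have "(\<Sum>i<n. \<Sum>j<n. ip (y i) (y j)) = ip (\<Sum>i<n. y i) (\<Sum>j<n. y j)"
    by (simp add: ip_sum_left ip_sum_right) (rule sum.swap)
  then show ?case by (simp add: psd_ip)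
next
  case (Suc N)
  define v' where "v' i = (\<lambda>n. v i (Suc n))" for i
  define L where "L i j d = chain (ip (v i 0) (lact d (v j 0))) (v' i) (v' j) N" for i j d
  define b where "b i j = mnorm (v i 0) * mnorm (v j 0) * (\<Prod>k<N. mnorm (v' i k) * mnorm (v' j k))" for i j
  have b0: "0 \<le> b i j" for i j by (simp add: b_def prod_nonneg)
  have L: "norm (L i j d) \<le> norm d * b i j" for i j d
  proof -
    have "norm (L i j d) \<le> norm (ip (v i 0) (lact d (v j 0))) * (\<Prod>k<N. mnorm (v' i k) * mnorm (v' j k))"
      unfolding L_def by (rule norm_chain)
    also have "\<dots> \<le> mnorm (v i 0) * norm d * mnorm (v j 0) * (\<Prod>k<N. mnorm (v' i k) * mnorm (v' j k))"
      by (intro mult_right_mono norm_ip_lact_le prod_nonneg) auto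
    finally show ?thesis by (simp add: b_def ac_simps)
  qed
  have Ldiff: "L i j (d - d') = L i j d - L i j d'" for i j d d'
    by (simp add: L_def lact_diff_left ip_diff_right chain_diff)
  have Lsum: "L i j (\<Sum>k\<in>K. f k) = (\<Sum>k\<in>K. L i j (f k))" for i j f and K :: "nat set"
    by (simp add: L_def lact_sum_left ip_sum_right chain_sum)
  have "psd (uemb (\<Sum>i<n. \<Sum>j<n. L i j (ip (y i) (y j))))"
  proof (rule psd_approx)
    fix e :: real assume "e > 0"
    \<comment> \<open>The total of the bounds \<open>b i j\<close> converts an entrywise error into
      an error of the double sum; adding \<open>1\<close> avoids division by
      \<open>0\<close>.\<close>
    define C where "C = (\<Sum>i<n. \<Sum>j<n. b i j) + 1"
    have C: "C > 0" unfolding C_def by (intro add_nonneg_pos sum_nonneg b0) auto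
    have "e / C > 0" using C \<open>e > 0\<close> by simp
    from gram_matrix_approx[OF this, of n y]
    obtain m :: nat and c where c: "\<forall>i<n. \<forall>j<n.
        norm (ip (y i) (y j) - (\<Sum>k<m. star (c k i) * c k j)) \<le> e / C" by (elim exE) (rule that)
    define G where "G = (\<Sum>k<m. \<Sum>i<n. \<Sum>j<n. L i j (star (c k i) * c k j))"
    have "L i j (star (c k i) * c k j)
        = chain (ip (lact (c k i) (v i 0)) (lact (c k j) (v j 0))) (v' i) (v' j) N" for i j k
      by (simp add: L_def lact_mult lact_star)
    then have "psd (uemb G)"
      unfolding G_def uemb_sum[where A = "{..<m}"] by (intro psd_sum) (simp add: Suc.IH)
    moreover have "norm (uemb (\<Sum>i<n. \<Sum>j<n. L i j (ip (y i) (y j))) - uemb G) \<le> e"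
    proof -
      have "G = (\<Sum>i<n. \<Sum>k<m. \<Sum>j<n. L i j (star (c k i) * c k j))"
        unfolding G_def by (rule sum.swap)
      also have "\<dots> = (\<Sum>i<n. \<Sum>j<n. \<Sum>k<m. L i j (star (c k i) * c k j))"
        by (intro sum.cong refl sum.swap)
      finally have "G = (\<Sum>i<n. \<Sum>j<n. L i j (\<Sum>k<m. star (c k i) * c k j))"
        by (simp only: Lsum)
      then have "(\<Sum>i<n. \<Sum>j<n. L i j (ip (y i) (y j))) - G
          = (\<Sum>i<n. \<Sum>j<n. L i j (ip (y i) (y j) - (\<Sum>k<m. star (c k i) * c k j)))"
        by (simp add: Ldiff sum_subtractf)
      also have "norm \<dots> \<le> (\<Sum>i<n. \<Sum>j<n. e / C * b i j)"
        by (intro sum_norm_le order_trans[OF L] mult_right_mono c[rule_format] b0) auto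
      also have "\<dots> = e / C * (\<Sum>i<n. \<Sum>j<n. b i j)" by (simp add: sum_distrib_left)
      also have "\<dots> \<le> e / C * C" using \<open>e > 0\<close> C by (intro mult_left_mono) (auto simp: C_def)
      finally show ?thesis using C by (simp flip: uemb_diff)
    qed
    ultimately show "\<exists>g. psd g \<and> norm (uemb (\<Sum>i<n. \<Sum>j<n. L i j (ip (y i) (y j))) - g) \<le> e" by blast
  qed
  then show ?case unfolding chain_Suc_front L_def v'_def .
qed

end

context faithful_correspondence
begin

text \<open>Letters are chosen one at a time. The strict lower bound is passed on with the same
  \<open>\<delta>\<close> by \<open>ip_lact_almost_attains_norm\<close>, so nothing is lost over
  infinitely many steps.\<close>

lemma exists_word_chain_bounded_below:
  assumes h: "psd (uemb h)" and \<delta>: "0 \<le> \<delta>" "\<delta> < norm h"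
  obtains w where "\<And>n. mnorm (w n) \<le> 1" "\<And>n. \<delta> < norm (chain h w w n)"
proof -
  define P where "P a \<longleftrightarrow> psd (uemb a) \<and> \<delta> < norm a" for a :: 'b
  define s where "s a = (SOME x. mnorm x \<le> 1 \<and> \<delta> < norm (ip x (lact a x)))" for a
  have s: "mnorm (s a) \<le> 1 \<and> \<delta> < norm (ip (s a) (lact a (s a)))" if "P a" for a
    unfolding s_def
    by (rule someI_ex) (use ip_lact_almost_attains_norm[of a \<delta>] that \<delta> in \<open>unfold P_def, metis\<close>)
  define a where "a = rec_nat h (\<lambda>_ a. ip (s a) (lact a (s a)))"
  have P: "P (a n)" for n
    by (induction n) (use h \<delta> s in \<open>auto simp: a_def P_def intro: psd_ip_lact\<close>)
  have "chain h (\<lambda>n. s (a n)) (\<lambda>n. s (a n)) n = a n" for n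
    by (induction n) (auto simp: a_def)
  with P s show thesis by (intro that[of "\<lambda>n. s (a n)"]) (auto simp: P_def)
qed

end

section \<open>Positive functionals on bounded sequences\<close>

definition sublinear :: "('v::real_vector \<Rightarrow> real) \<Rightarrow> bool"
  where "sublinear p \<longleftrightarrow> (\<forall>x y. p (x + y) \<le> p x + p y) \<and> (\<forall>t\<ge>0. \<forall>x. p (t *\<^sub>R x) \<le> t * p x)"

lemma sublinear_add: "sublinear p \<Longrightarrow> p (x + y) \<le> p x + p y"
  and sublinear_scaleR: "sublinear p \<Longrightarrow> 0 \<le> t \<Longrightarrow> p (t *\<^sub>R x) \<le> t * p x"
  by (auto simp: sublinear_def)

lemma sublinear_zero: "sublinear p \<Longrightarrow> p 0 = 0"
  using sublinear_add[of p 0 0] sublinear_scaleR[of p 0 0] by simp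

lemma sublinear_minus: "sublinear p \<Longrightarrow> - p (- x) \<le> p x"
  using sublinear_add[of p x "- x"] sublinear_zero[of p] by simp

lemma sublinear_scaleR_eq:
  assumes p: "sublinear p" and "0 \<le> t" shows "p (t *\<^sub>R x) = t * p x"
proof (cases "t = 0")
  case False
  then have t: "t > 0" using assms by simp
  have "t * p x = t * p ((1/t) *\<^sub>R (t *\<^sub>R x))" using t by simp
  also have "\<dots> \<le> t * ((1/t) * p (t *\<^sub>R x))"
    using t by (intro mult_left_mono sublinear_scaleR[OF p]) auto
  finally show ?thesis using sublinear_scaleR[OF p assms(2), of x] t by simp
qed (simp add: sublinear_zero[OF p])

text \<open>A minimal sublinear functional is fixed by tilting in every direction, hence linear.\<close>

definition tilt :: "'v::real_vector \<Rightarrow> ('v \<Rightarrow> real) \<Rightarrow> 'v \<Rightarrow> real"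
  where "tilt y p x = (INF t\<in>{0..}. p (x + t *\<^sub>R y) - t * p y)"

lemma
  assumes p: "sublinear p"
  shows tilt_le: "0 \<le> t \<Longrightarrow> tilt y p x \<le> p (x + t *\<^sub>R y) - t * p y"
    and sublinear_tilt: "sublinear (tilt y p)"
proof -
  have bdd: "bdd_below ((\<lambda>t. p (x + t *\<^sub>R y) - t * p y) ` {0..})" for x
  proof (rule bdd_belowI2)
    fix t :: real assume "t \<in> {0..}"
    then show "- p (- x) \<le> p (x + t *\<^sub>R y) - t * p y"
      using sublinear_add[OF p, of "x + t *\<^sub>R y" "- x"] sublinear_scaleR_eq[OF p, of t y] by simp
  qed
  show le: "tilt y p x \<le> p (x + t *\<^sub>R y) - t * p y" if "0 \<le> t" for x t
    unfolding tilt_def by (rule cINF_lower[OF bdd]) (use that in simp)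
  have ge: "c \<le> tilt y p x" if "\<And>t. 0 \<le> t \<Longrightarrow> c \<le> p (x + t *\<^sub>R y) - t * p y" for c x
    unfolding tilt_def by (rule cINF_greatest) (use that in auto)
  show "sublinear (tilt y p)"
    unfolding sublinear_def
  proof (intro conjI allI impI)
    fix x z
    have "tilt y p (x + z) - (p (x + t *\<^sub>R y) - t * p y) \<le> tilt y p z" if t: "0 \<le> t" for t
    proof (rule ge)
      fix s :: real assume s: "0 \<le> s"
      have "tilt y p (x + z) \<le> p ((x + z) + (t + s) *\<^sub>R y) - (t + s) * p y"
        by (rule le) (use s t in simp)
      also have "(x + z) + (t + s) *\<^sub>R y = (x + t *\<^sub>R y) + (z + s *\<^sub>R y)" by (simp add: scaleR_add_left)
      finally show "tilt y p (x + z) - (p (x + t *\<^sub>R y) - t * p y) \<le> p (z + s *\<^sub>R y) - s * p y"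
        using sublinear_add[OF p, of "x + t *\<^sub>R y" "z + s *\<^sub>R y"] by (simp add: algebra_simps)
    qed
    then have "tilt y p (x + z) - tilt y p z \<le> p (x + t *\<^sub>R y) - t * p y" if "0 \<le> t" for t
      using that by (simp add: algebra_simps)
    then have "tilt y p (x + z) - tilt y p z \<le> tilt y p x" by (rule ge)
    then show "tilt y p (x + z) \<le> tilt y p x + tilt y p z" by simp
  next
    fix t :: real and x assume t: "0 \<le> t"
    show "tilt y p (t *\<^sub>R x) \<le> t * tilt y p x"
    proof (cases "t = 0")
      case True
      then show ?thesis using le[of 0 0] by (simp add: sublinear_zero[OF p])
    next
      case False
      with t have t: "t > 0" by simp
      have "tilt y p (t *\<^sub>R x) / t \<le> tilt y p x"
      proof (rule ge)
        fix s :: real assume s: "0 \<le> s"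
        have "tilt y p (t *\<^sub>R x) \<le> p (t *\<^sub>R x + (t * s) *\<^sub>R y) - (t * s) * p y"
          by (rule le) (use s t in simp)
        also have "t *\<^sub>R x + (t * s) *\<^sub>R y = t *\<^sub>R (x + s *\<^sub>R y)" by (simp add: scaleR_add_right)
        also have "p (t *\<^sub>R (x + s *\<^sub>R y)) = t * p (x + s *\<^sub>R y)"
          by (rule sublinear_scaleR_eq[OF p]) (use t in simp)
        finally show "tilt y p (t *\<^sub>R x) / t \<le> p (x + s *\<^sub>R y) - s * p y"
          using t by (simp add: field_simps)
      qed
      then show ?thesis using t by (simp add: field_simps)
    qed
  qed
qed

text \<open>Zorn's lemma for the reversed pointwise order. The infimum of a chain is finite since
  all members lie above \<open>- p (- x)\<close>, and subadditive since any two members are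
  comparable.\<close>

lemma exists_minimal_sublinear:
  fixes p :: "'v::real_vector \<Rightarrow> real"
  assumes p: "sublinear p"
  obtains q where "sublinear q" "\<And>x. q x \<le> p x"
    "\<And>r. sublinear r \<Longrightarrow> (\<And>x. r x \<le> q x) \<Longrightarrow> r = q"
proof -
  define A where "A = {q. sublinear q \<and> (\<forall>x. q x \<le> p x)}"
  define P where "P q r \<longleftrightarrow> (\<forall>x. r x \<le> q x)" for q r :: "'v \<Rightarrow> real"
  have po: "partial_order_on A (relation_of P A)"
    by (rule partial_order_on_relation_ofI)
      (auto simp: P_def fun_eq_iff intro: order_trans antisym)
  have ch: "\<exists>u\<in>A. \<forall>q\<in>C. P q u" if C: "C \<in> Chains (relation_of P A)" for C
  proof (cases "C = {}")
    case True
    then show ?thesis using p by (auto simp: A_def)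
  next
    case False
    have CA: "q \<in> A" if "q \<in> C" for q using C that by (auto simp: Chains_def relation_of_def)
    have lin: "P q r \<or> P r q" if "q \<in> C" "r \<in> C" for q r
      using C that by (auto simp: Chains_def relation_of_def)
    define u where "u x = (INF q\<in>C. q x)" for x
    have bdd: "bdd_below ((\<lambda>q. q x) ` C)" for x
    proof (rule bdd_belowI2)
      fix q assume "q \<in> C"
      then have q: "sublinear q" "q (- x) \<le> p (- x)" using CA by (auto simp: A_def)
      show "- p (- x) \<le> q x" using sublinear_minus[OF q(1), of x] q(2) by simp
    qed
    have le: "u x \<le> q x" if "q \<in> C" for q x
      unfolding u_def by (rule cINF_lower[OF bdd that])
    have ge: "c \<le> u x" if "\<And>q. q \<in> C \<Longrightarrow> c \<le> q x" for c x
      unfolding u_def by (rule cINF_greatest[OF False that])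
    have "sublinear u" unfolding sublinear_def
    proof (intro conjI allI impI)
      fix x y
      have "u (x + y) - r y \<le> u x" if r: "r \<in> C" for r
      proof (rule ge)
        fix q assume q: "q \<in> C"
        from lin[OF q r] obtain s where s: "s \<in> C" "s x \<le> q x" "s y \<le> r y"
          using q r by (auto simp: P_def)
        have "u (x + y) \<le> s x + s y"
          using le[OF s(1), of "x + y"] sublinear_add[of s x y] CA[OF s(1)] by (simp add: A_def)
        then show "u (x + y) - r y \<le> q x" using s by simp
      qed
      then have "u (x + y) - u x \<le> u y" by (intro ge) (simp add: algebra_simps)
      then show "u (x + y) \<le> u x + u y" by simp
    next
      fix t :: real and x assume t: "0 \<le> t"
      obtain q0 where q0: "q0 \<in> C" using False by blast
      have hom: "q (t *\<^sub>R x) = t * q x" if "q \<in> C" for q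
        using sublinear_scaleR_eq[of q t x] CA[OF that] t by (simp add: A_def)
      show "u (t *\<^sub>R x) \<le> t * u x"
      proof (cases "t = 0")
        case True
        then show ?thesis using le[OF q0, of "t *\<^sub>R x"] hom[OF q0] by simp
      next
        case False
        with t have t: "t > 0" by simp
        have "u (t *\<^sub>R x) / t \<le> u x"
        proof (rule ge)
          fix q assume q: "q \<in> C"
          show "u (t *\<^sub>R x) / t \<le> q x" using le[OF q, of "t *\<^sub>R x"] hom[OF q] t
            by (simp add: field_simps)
        qed
        then show ?thesis using t by (simp add: field_simps)
      qed
    qed
    moreover have "u x \<le> p x" for x
      using le False CA order_trans by (fastforce simp: A_def)
    ultimately have "u \<in> A" by (simp add: A_def)
    then show ?thesis using le by (auto simp: P_def)
  qed
  from predicate_Zorn[OF po ch] obtain q where q: "q \<in> A" "\<And>r. r \<in> A \<Longrightarrow> P q r \<Longrightarrow> r = q" by blast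
  show thesis
  proof (rule that[of q])
    show "sublinear q" "q x \<le> p x" for x using q(1) by (auto simp: A_def)
    fix r assume "sublinear r" "\<And>x. r x \<le> q x"
    moreover from this have "r x \<le> p x" for x
      using q(1) order_trans[of "r x" "q x" "p x"] by (auto simp: A_def)
    ultimately show "r = q" by (intro q(2)) (auto simp: A_def P_def)
  qed
qed

text \<open>Minimality gives \<open>tilt y q = q\<close>; at \<open>t = 1\<close> this is
  superadditivity, the missing half of additivity.\<close>

lemma linear_below_sublinear:
  fixes p :: "'v::real_vector \<Rightarrow> real"
  assumes p: "sublinear p"
  obtains f where "linear f" "\<And>x. f x \<le> p x"
proof -
  obtain q where q: "sublinear q" "\<And>x. q x \<le> p x"
    and min: "\<And>r. sublinear r \<Longrightarrow> (\<And>x. r x \<le> q x) \<Longrightarrow> r = q"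
    using exists_minimal_sublinear[OF p] by metis
  have "tilt y q = q" for y
    by (rule min[OF sublinear_tilt[OF q(1)]]) (use tilt_le[OF q(1), of 0] in simp)
  then have "q x + q y \<le> q (x + y)" for x y
    using tilt_le[OF q(1), of 1 y x] by simp
  then have add: "q (x + y) = q x + q y" for x y
    using sublinear_add[OF q(1)] by (simp add: antisym)
  have minus: "q (- x) = - q x" for x
    using add[of x "- x"] sublinear_zero[OF q(1)] by simp
  have "q (t *\<^sub>R x) = t * q x" for t x
  proof (cases "0 \<le> t")
    case False
    then have "q (t *\<^sub>R x) = q (- ((- t) *\<^sub>R x))" by simp
    also have "\<dots> = t * q x" unfolding minus using False sublinear_scaleR_eq[OF q(1), of "- t" x] by simp
    finally show ?thesis .
  qed (rule sublinear_scaleR_eq[OF q(1)])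
  then have "linear q" by (intro linearI) (simp_all add: add)
  then show thesis using q(2) that by blast
qed

text \<open>The infimum \<open>p\<close> is at most \<open>0\<close> at \<open>- d\<close> for
  \<open>d\<close> in the cone, which makes linear functionals below \<open>p\<close> nonnegative on
  the cone, and at most the norm, which bounds them.\<close>

lemma cone_functional:
  fixes P :: "'v::real_normed_vector set"
  assumes P0: "0 \<in> P" and Padd: "\<And>x y. x \<in> P \<Longrightarrow> y \<in> P \<Longrightarrow> x + y \<in> P"
    and Pscale: "\<And>x t. x \<in> P \<Longrightarrow> 0 \<le> t \<Longrightarrow> t *\<^sub>R x \<in> P"
    and \<delta>: "\<And>d. d \<in> P \<Longrightarrow> \<delta> \<le> norm (a + d)"
  obtains f where "linear f" "\<And>x. \<bar>f x\<bar> \<le> norm x" "\<And>d. d \<in> P \<Longrightarrow> 0 \<le> f d" "\<delta> \<le> f a"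
proof -
  define p where "p x = (INF d\<in>P. norm (x + d))" for x
  have bdd: "bdd_below ((\<lambda>d. norm (x + d)) ` P)" for x
    by (rule bdd_belowI2[of _ 0]) simp
  have le: "p x \<le> norm (x + d)" if "d \<in> P" for x d
    unfolding p_def by (rule cINF_lower[OF bdd that])
  have ge: "c \<le> p x" if "\<And>d. d \<in> P \<Longrightarrow> c \<le> norm (x + d)" for c x
    unfolding p_def using P0 that by (intro cINF_greatest) auto
  have p: "sublinear p" unfolding sublinear_def
  proof (intro conjI allI impI)
    fix x y
    have "p (x + y) - norm (x + d) \<le> p y" if d: "d \<in> P" for d
    proof (rule ge)
      fix e assume e: "e \<in> P"
      have "p (x + y) \<le> norm ((x + y) + (d + e))" by (rule le) (intro Padd d e)
      also have "\<dots> \<le> norm (x + d) + norm (y + e)"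
        using norm_triangle_ineq[of "x + d" "y + e"] by (simp add: algebra_simps)
      finally show "p (x + y) - norm (x + d) \<le> norm (y + e)" by simp
    qed
    then have "p (x + y) - p y \<le> p x" by (intro ge) (simp add: algebra_simps)
    then show "p (x + y) \<le> p x + p y" by simp
  next
    fix t :: real and x assume t: "0 \<le> t"
    show "p (t *\<^sub>R x) \<le> t * p x"
    proof (cases "t = 0")
      case True
      then show ?thesis using le[OF P0, of 0] by simp
    next
      case False
      with t have t: "t > 0" by simp
      have "p (t *\<^sub>R x) / t \<le> p x"
      proof (rule ge)
        fix d assume "d \<in> P"
        then have "p (t *\<^sub>R x) \<le> norm (t *\<^sub>R x + t *\<^sub>R d)" using t by (intro le Pscale) auto
        also have "\<dots> = t * norm (x + d)" using t by (simp flip: scaleR_add_right)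
        finally show "p (t *\<^sub>R x) / t \<le> norm (x + d)" using t by (simp add: field_simps)
      qed
      then show ?thesis using t by (simp add: field_simps)
    qed
  qed
  \<comment> \<open>Hahn-Banach below \<open>p\<close> alone would give only an upper bound at
    \<open>a\<close>. Tilting in direction \<open>a\<close> first forces
    \<open>f (- a) \<le> - p a\<close>, hence \<open>p a \<le> f a\<close>.\<close>
  obtain f where f: "linear f" "\<And>x. f x \<le> tilt a p x"
    using linear_below_sublinear[OF sublinear_tilt[OF p]] by metis
  have fp: "f x \<le> p x" for x using f(2)[of x] tilt_le[OF p, of 0 a x] by simp
  have fminus: "f (- x) = - f x" for x by (rule linear_neg[OF f(1)])
  show thesis
  proof (rule that[OF f(1)])
    show "\<bar>f x\<bar> \<le> norm x" for x
      using fp[of x] fp[of "- x"] le[OF P0, of x] le[OF P0, of "- x"] fminus[of x] by simp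
    show "0 \<le> f d" if "d \<in> P" for d
      using fp[of "- d"] le[OF that, of "- d"] fminus[of d] by simp
    have "f (- a) \<le> - p a"
      using f(2)[of "- a"] tilt_le[OF p, of 1 a "- a"] sublinear_zero[OF p] by simp
    then have "p a \<le> f a" using fminus[of a] by simp
    then show "\<delta> \<le> f a" using ge[of \<delta> a] \<delta> by force
  qed
qed

text \<open>All conditions concern bounded sequences, the values elsewhere being arbitrary. The
  factor \<open>2\<close> comes from estimating real and imaginary parts separately.\<close>

definition limit_functional :: "((nat \<Rightarrow> 'b::cstar_algebra) \<Rightarrow> complex) \<Rightarrow> bool"
  where "limit_functional \<phi> \<longleftrightarrow>
    (\<forall>c d. bounded (range c) \<longrightarrow> bounded (range d) \<longrightarrow> \<phi> (\<lambda>n. c n + d n) = \<phi> c + \<phi> d) \<and>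
    (\<forall>z c. bounded (range c) \<longrightarrow> \<phi> (\<lambda>n. z *\<^sub>C c n) = z * \<phi> c) \<and>
    (\<forall>c. bounded (range c) \<longrightarrow> \<phi> (\<lambda>n. star (c n)) = cnj (\<phi> c)) \<and>
    (\<forall>c. bounded (range c) \<longrightarrow> (\<forall>n. psd (uemb (c n))) \<longrightarrow> 0 \<le> Re (\<phi> c)) \<and>
    (\<forall>c M. (\<forall>n. norm (c n) \<le> M) \<longrightarrow> cmod (\<phi> c) \<le> 2 * M) \<and>
    (\<forall>c d. bounded (range c) \<longrightarrow> (\<forall>\<^sub>F n in sequentially. c n = d n) \<longrightarrow> bounded (range d) \<longrightarrow> \<phi> c = \<phi> d)"

lemma real_part_norm_le:
  fixes x :: "'a::cstar_algebra"
  shows "norm ((1/2) *\<^sub>R (x + star x)) \<le> norm x"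
  using norm_triangle_ineq[of x "star x"] by simp

lemma exists_limit_functional:
  fixes a :: "nat \<Rightarrow> 'b::cstar_algebra"
  assumes a: "bounded (range a)" "\<And>n. psd (uemb (a n))" "\<And>n. \<delta> \<le> norm (a n)"
  obtains \<phi> where "limit_functional \<phi>" "\<delta> \<le> Re (\<phi> a)"
proof -
  have mem: "c \<in> bcontfun" if "bounded (range c)" for c :: "nat \<Rightarrow> 'b"
    using that by (auto simp: bcontfun_def continuous_on_open_vimage open_discrete)
  have app: "apply_bcontfun (Bcontfun c) = c" if "bounded (range c)" for c :: "nat \<Rightarrow> 'b"
    by (rule Bcontfun_inverse[OF mem[OF that]])
  \<comment> \<open>\<open>P\<close> contains \<open>d\<close> and \<open>- d\<close> if \<open>d\<close> is antihermitian or eventually zero, so a functional that is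
    positive on \<open>P\<close> is hermitian and ignores finitely many entries.\<close>
  define P where "P = {d :: nat \<Rightarrow>\<^sub>C 'b. \<forall>\<^sub>F n in sequentially.
    psd (uemb (apply_bcontfun d n + star (apply_bcontfun d n)))}"
  \<comment> \<open>One index at which \<open>d\<close> has positive real part is enough: adding
    that part cannot decrease the norm of the positive \<open>a n\<close>, and a real part is no
    larger than its element.\<close>
  have Pa: "\<delta> \<le> norm (Bcontfun a + d)" if "d \<in> P" for d
  proof -
    have "\<forall>\<^sub>F n in sequentially. psd (uemb (apply_bcontfun d n + star (apply_bcontfun d n)))"
      using that by (simp add: P_def)
    then obtain n where n: "psd (uemb (apply_bcontfun d n + star (apply_bcontfun d n)))"
      using eventually_happens'[OF sequentially_bot] by blast
    let ?d = "apply_bcontfun d n"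
    have sa: "star (a n) = a n" using psd_star[OF a(2)] by (simp flip: uemb_star)
    have "\<delta> \<le> norm (uemb (a n))" using a(3) by simp
    also have "\<dots> \<le> norm (uemb (a n) + (1/2) *\<^sub>R uemb (?d + star ?d))"
      by (intro norm_mono_psd a psd_scaleR n) simp
    also have "uemb (a n) + (1/2) *\<^sub>R uemb (?d + star ?d)
        = uemb ((1/2) *\<^sub>R (a n + a n) + (1/2) *\<^sub>R (?d + star ?d))"
      by (simp add: uemb_add uemb_scaleR flip: scaleR_2)
    also have "(1/2) *\<^sub>R (a n + a n) + (1/2) *\<^sub>R (?d + star ?d)
        = (1/2) *\<^sub>R ((a n + ?d) + star (a n + ?d))"
      by (simp only: star_add sa scaleR_add_right ac_simps)
    also have "norm (uemb ((1/2) *\<^sub>R ((a n + ?d) + star (a n + ?d)))) \<le> norm (a n + ?d)" unfolding norm_uemb by (rule real_part_norm_le)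
    also have "\<dots> = norm (apply_bcontfun (Bcontfun a + d) n)" by (simp add: app[OF a(1)])
    also have "\<dots> \<le> norm (Bcontfun a + d)" by (rule norm_bounded)
    finally show ?thesis .
  qed
  have Padd: "x + y \<in> P" if "x \<in> P" "y \<in> P" for x y
    using that unfolding P_def mem_Collect_eq
  proof eventually_elim
    case (elim n)
    from psd_add[OF this] show ?case by (simp add: star_add uemb_add add.commute add.left_commute)
  qed
  have Pscale: "t *\<^sub>R x \<in> P" if "x \<in> P" "0 \<le> t" for x t
    using that(1) unfolding P_def mem_Collect_eq
  proof eventually_elim
    case (elim n)
    from psd_scaleR[OF this that(2)] show ?case by (simp add: star_scaleR uemb_add uemb_scaleR scaleR_add_right)
  qed
  have P0: "0 \<in> P" by (simp add: P_def)
  obtain f where f: "linear f" "\<And>x. \<bar>f x\<bar> \<le> norm x" "\<And>d. d \<in> P \<Longrightarrow> 0 \<le> f d" "\<delta> \<le> f (Bcontfun a)"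
    using cone_functional[OF P0 Padd Pscale Pa] by blast
  define g where "g c = f (Bcontfun c)" for c
  have g_add: "g (\<lambda>n. c n + d n) = g c + g d" if "bounded (range c)" "bounded (range d)" for c d
  proof -
    have "Bcontfun (\<lambda>n. c n + d n) = Bcontfun c + Bcontfun d"
      using that by (intro bcontfun_eqI) (simp add: app bounded_plus_comp)
    then show ?thesis by (simp add: g_def linear_add[OF f(1)])
  qed
  have bs: "bounded (range (\<lambda>n. z *\<^sub>C c n))" if "bounded (range c)" for z and c :: "nat \<Rightarrow> 'b"
  proof -
    from that obtain B where "\<And>n. norm (c n) \<le> B" by (auto simp: bounded_iff)
    then show ?thesis by (intro boundedI[of _ "cmod z * B"]) (auto simp: norm_scaleC mult_left_mono)
  qed
  have bst: "bounded (range (\<lambda>n. star (c n)))" if "bounded (range c)" for c :: "nat \<Rightarrow> 'b"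
    using that by (auto simp: bounded_iff)
  have g_scale: "g (\<lambda>n. complex_of_real r *\<^sub>C c n) = r * g c" if "bounded (range c)" for r c
  proof -
    have "Bcontfun (\<lambda>n. complex_of_real r *\<^sub>C c n) = r *\<^sub>R Bcontfun c"
      using that bs[OF that] by (intro bcontfun_eqI) (simp add: app scaleR_scaleC)
    then show ?thesis by (simp add: g_def linear_cmul[OF f(1)])
  qed
  have g_bound: "\<bar>g c\<bar> \<le> M" if "\<And>n. norm (c n) \<le> M" for c M
  proof -
    have "bounded (range c)" using that by (auto simp: bounded_iff)
    then have "norm (Bcontfun c) \<le> M" by (intro norm_bound) (simp add: app that)
    then show ?thesis using f(2)[of "Bcontfun c"] by (simp add: g_def)
  qed
  have g_pos: "0 \<le> g c" if "bounded (range c)" "\<forall>\<^sub>F n in sequentially. psd (uemb (c n + star (c n)))" for c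
    unfolding g_def by (rule f(3)) (use that in \<open>simp add: P_def app\<close>)
  have g_eq: "g c = g d" if c: "bounded (range c)" and d: "bounded (range d)"
    and ev: "\<forall>\<^sub>F n in sequentially. c n + star (c n) = d n + star (d n)" for c d
  proof -
    have le: "g d \<le> g c" if c: "bounded (range c)" and d: "bounded (range d)"
      and ev: "\<forall>\<^sub>F n in sequentially. c n + star (c n) = d n + star (d n)" for c d
    proof -
      have b: "bounded (range (\<lambda>n. complex_of_real (- 1) *\<^sub>C d n))" by (rule bs[OF d])
      have "0 \<le> g (\<lambda>n. c n + complex_of_real (- 1) *\<^sub>C d n)"
      proof (rule g_pos)
        show "bounded (range (\<lambda>n. c n + complex_of_real (- 1) *\<^sub>C d n))"
          by (rule bounded_plus_comp[OF c b])
        show "\<forall>\<^sub>F n in sequentially. psd (uemb ((c n + complex_of_real (- 1) *\<^sub>C d n) +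
            star (c n + complex_of_real (- 1) *\<^sub>C d n)))"
          using ev
        proof eventually_elim
          case (elim n)
          have "(c n + complex_of_real (- 1) *\<^sub>C d n) + star (c n + complex_of_real (- 1) *\<^sub>C d n)
              = (c n + star (c n)) - (d n + star (d n))"
            unfolding scaleC_of_real by (simp add: star_minus star_add star_diff)
          then show ?case using elim by simp
        qed
      qed
      also have "\<dots> = g c - g d" using g_add[OF c b] g_scale[OF d, of "- 1"] by simp
      finally show ?thesis by simp
    qed
    have "\<forall>\<^sub>F n in sequentially. d n + star (d n) = c n + star (c n)"
      using ev by eventually_elim simp
    then show ?thesis using le[OF c d ev] le[OF d c] by simp
  qed
  \<comment> \<open>The complex linear functional with real part \<open>g\<close>.\<close>
  define \<phi> where "\<phi> c = Complex (g c) (- g (\<lambda>n. \<i> *\<^sub>C c n))" for c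
  have \<phi>_add: "\<phi> (\<lambda>n. c n + d n) = \<phi> c + \<phi> d" if "bounded (range c)" "bounded (range d)" for c d
    using that by (simp add: \<phi>_def g_add bs scaleC_add_right complex_eq_iff)
  have \<phi>_scale: "\<phi> (\<lambda>n. z *\<^sub>C c n) = z * \<phi> c" if c: "bounded (range c)" for z c
  proof -
    have re: "\<phi> (\<lambda>n. complex_of_real r *\<^sub>C c n) = r * \<phi> c" if "bounded (range c)" for r c
    proof -
      have "(\<lambda>n. \<i> *\<^sub>C complex_of_real r *\<^sub>C c n) = (\<lambda>n. complex_of_real r *\<^sub>C \<i> *\<^sub>C c n)"
        by (simp add: scaleC_scaleC mult.commute)
      then show ?thesis using g_scale[OF that, of r] g_scale[OF bs[OF that], of r \<i>]
        by (simp add: \<phi>_def complex_eq_iff)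
    qed
    have im: "\<phi> (\<lambda>n. \<i> *\<^sub>C c n) = \<i> * \<phi> c" if "bounded (range c)" for c
    proof -
      have "(\<lambda>n. \<i> *\<^sub>C \<i> *\<^sub>C c n) = (\<lambda>n. complex_of_real (- 1) *\<^sub>C c n)"
        by (simp add: scaleC_scaleC)
      then show ?thesis using g_scale[OF that, of "- 1"] by (simp add: \<phi>_def complex_eq_iff)
    qed
    have "(\<lambda>n. z *\<^sub>C c n) = (\<lambda>n. complex_of_real (Re z) *\<^sub>C c n + \<i> *\<^sub>C complex_of_real (Im z) *\<^sub>C c n)"
      unfolding scaleC_scaleC scaleC_add_left[symmetric] by (simp flip: complex_eq)
    then have "\<phi> (\<lambda>n. z *\<^sub>C c n) = \<phi> (\<lambda>n. complex_of_real (Re z) *\<^sub>C c n) + \<phi> (\<lambda>n. \<i> *\<^sub>C complex_of_real (Im z) *\<^sub>C c n)"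
      by (simp add: \<phi>_add bs c)
    also have "\<dots> = (complex_of_real (Re z) + \<i> * complex_of_real (Im z)) * \<phi> c"
      unfolding im[OF bs[OF c]] re[OF c] by (simp add: algebra_simps)
    also have "complex_of_real (Re z) + \<i> * complex_of_real (Im z) = z" by (simp flip: complex_eq)
    finally show ?thesis .
  qed
  have "limit_functional \<phi>" unfolding limit_functional_def
  proof (intro conjI allI impI)
    fix c d :: "nat \<Rightarrow> 'b" and z :: complex assume c: "bounded (range c)"
    show "\<phi> (\<lambda>n. z *\<^sub>C c n) = z * \<phi> c" by (rule \<phi>_scale[OF c])
    have 1: "g (\<lambda>n. star (c n)) = g c"
      by (rule g_eq[OF bst[OF c] c]) (simp add: star_star add.commute)
    have "g (\<lambda>n. \<i> *\<^sub>C star (c n)) = g (\<lambda>n. complex_of_real (- 1) *\<^sub>C \<i> *\<^sub>C c n)"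
      by (rule g_eq[OF bs[OF bst[OF c]] bs[OF bs[OF c]]])
        (simp add: star_scaleC star_star star_minus scaleC_scaleC add.commute)
    then have "g (\<lambda>n. \<i> *\<^sub>C star (c n)) = - g (\<lambda>n. \<i> *\<^sub>C c n)"
      using g_scale[OF bs[OF c], of "- 1" \<i>] by simp
    with 1 show "\<phi> (\<lambda>n. star (c n)) = cnj (\<phi> c)" by (simp add: \<phi>_def complex_eq_iff)
    show "0 \<le> Re (\<phi> c)" if "\<forall>n. psd (uemb (c n))"
      unfolding \<phi>_def complex.sel
    proof (rule g_pos[OF c], rule always_eventually, rule allI)
      fix n
      have "star (c n) = c n" using psd_star[of "uemb (c n)"] that by (simp flip: uemb_star)
      then show "psd (uemb (c n + star (c n)))" using that by (simp add: uemb_add psd_add)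
    qed
    show "\<phi> (\<lambda>n. c n + d n) = \<phi> c + \<phi> d" if "bounded (range d)" by (rule \<phi>_add[OF c that])
    show "\<phi> c = \<phi> d" if ev: "\<forall>\<^sub>F n in sequentially. c n = d n" and d: "bounded (range d)"
    proof -
      have "g c = g d" by (rule g_eq[OF c d]) (use ev in eventually_elim, simp)
      moreover have "g (\<lambda>n. \<i> *\<^sub>C c n) = g (\<lambda>n. \<i> *\<^sub>C d n)"
        by (rule g_eq[OF bs[OF c] bs[OF d]]) (use ev in eventually_elim, simp)
      ultimately show ?thesis by (simp add: \<phi>_def)
    qed
  next
    fix c :: "nat \<Rightarrow> 'b" and M assume "\<forall>n. norm (c n) \<le> M"
    then have "\<bar>g c\<bar> \<le> M" "\<bar>g (\<lambda>n. \<i> *\<^sub>C c n)\<bar> \<le> M"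
      by (auto intro!: g_bound simp: norm_scaleC)
    then show "cmod (\<phi> c) \<le> 2 * M"
      using cmod_le[of "\<phi> c"] by (simp add: \<phi>_def)
  qed
  moreover have "\<delta> \<le> Re (\<phi> a)" using f(4) by (simp add: \<phi>_def g_def)
  ultimately show thesis using that by blast
qed

section \<open>The Hilbert space of a positive kernel\<close>

lemma (in hilbert_space) adj_eqI:
  assumes S: "S \<in> bounded_ops G ipG" and eq: "\<And>u v. u \<in> G \<Longrightarrow> v \<in> G \<Longrightarrow> ipG (T u) v = ipG u (S v)"
  shows "adj G ipG T = S"
  unfolding adj_def
proof (rule the_equality)
  show "S \<in> bounded_ops G ipG \<and> (\<forall>u\<in>G. \<forall>v\<in>G. ipG (T u) v = ipG u (S v))"
    using S eq by blast
  fix S' assume S': "S' \<in> bounded_ops G ipG \<and> (\<forall>u\<in>G. \<forall>v\<in>G. ipG (T u) v = ipG u (S' v))"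
  have SE: "S \<in> G \<rightarrow>\<^sub>E G" "S' \<in> G \<rightarrow>\<^sub>E G" using S S' by (auto simp: bounded_ops_def)
  show "S' = S"
  proof (rule PiE_ext[OF SE(2,1)])
    fix v assume v: "v \<in> G"
    have in_G: "S v \<in> G" "S' v \<in> G" using SE v by auto
    have neg: "(-1) *\<^sub>C S v \<in> G" by (rule complex_vector.subspace_scale[OF subspace in_G(1)])
    have d: "S' v + (-1) *\<^sub>C S v \<in> G" (is "?d \<in> G")
      by (rule complex_vector.subspace_add[OF subspace in_G(2) neg])
    have "ipG ?d ?d = ipG ?d (S' v) + (-1) * ipG ?d (S v)"
      by (simp add: ipG_add_right[OF d in_G(2) neg] ipG_scaleC_right[OF d in_G(1)] del: complex_vector.scale_minus_left)
    also have "\<dots> = 0" using eq[OF d v] S' d v by simp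
    finally have "?d = 0" using ipG_definite[OF d] by blast
    then show "S' v = S v" by simp
  qed
qed

type_synonym 'i combination = "(complex \<times> 'i) list"

text \<open>The value \<open>F i\<close> will be the inner product of the \<open>i\<close>-th kernel
  function with \<open>F\<close>. The conjugation then makes this the inner product of the
  combination \<open>L\<close>, in the conjugate linear first argument, with
  \<open>F\<close>.\<close>

definition eval_comb :: "'i combination \<Rightarrow> ('i \<Rightarrow> complex) \<Rightarrow> complex"
  where "eval_comb L F = (\<Sum>(c, i)\<leftarrow>L. cnj c * F i)"

definition scale_comb :: "complex \<Rightarrow> 'i combination \<Rightarrow> 'i combination"
  where "scale_comb z L = map (\<lambda>(c, i). (z * c, i)) L"

definition map_comb :: "('i \<Rightarrow> 'j) \<Rightarrow> 'i combination \<Rightarrow> 'j combination"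
  where "map_comb a L = map (\<lambda>(c, i). (c, a i)) L"

abbreviation diff_comb :: "'i combination \<Rightarrow> 'i combination \<Rightarrow> 'i combination"
  where "diff_comb L M \<equiv> L @ scale_comb (-1) M"

lemma eval_comb_simps [simp]:
  "eval_comb [] F = 0" "eval_comb (L @ M) F = eval_comb L F + eval_comb M F"
  "eval_comb (scale_comb z L) F = cnj z * eval_comb L F"
  "eval_comb (map_comb a L) F = eval_comb L (F \<circ> a)"
proof -
  show "eval_comb (scale_comb z L) F = cnj z * eval_comb L F"
    by (induction L) (auto simp: eval_comb_def scale_comb_def algebra_simps)
  show "eval_comb (map_comb a L) F = eval_comb L (F \<circ> a)"
    by (induction L) (auto simp: eval_comb_def map_comb_def)
qed (simp_all add: eval_comb_def)

lemma eval_comb_singleton: "eval_comb [(c, i)] F = cnj c * F i"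
  by (simp add: eval_comb_def)

lemma eval_comb_add: "eval_comb L (F + G) = eval_comb L F + eval_comb L G"
  by (induction L) (auto simp: eval_comb_def algebra_simps)

lemma eval_comb_scaleC: "eval_comb L (z *\<^sub>C F) = z * eval_comb L F"
  by (induction L) (auto simp: eval_comb_def algebra_simps scaleC_fun_def scaleC_complex_def)

lemma tendsto_eval_comb:
  assumes "\<And>i. (\<lambda>n. F n i) \<longlonglongrightarrow> G i"
  shows "(\<lambda>n. eval_comb L (F n)) \<longlonglongrightarrow> eval_comb L G"
proof (induction L)
  case (Cons x L)
  have "(\<lambda>n. cnj (fst x) * F n (snd x) + eval_comb L (F n)) \<longlonglongrightarrow> cnj (fst x) * G (snd x) + eval_comb L G"
    by (intro tendsto_intros assms Cons)
  then show ?case by (simp add: eval_comb_def case_prod_unfold)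
qed simp

lemma map_comb_simps [simp]:
  "map_comb a (L @ M) = map_comb a L @ map_comb a M"
  "map_comb a (scale_comb z L) = scale_comb z (map_comb a L)"
  by (auto simp: map_comb_def scale_comb_def)

locale positive_kernel =
  fixes K :: "'i \<Rightarrow> 'i \<Rightarrow> complex"
  assumes K_cnj: "cnj (K i j) = K j i"
    and K_positive: "0 \<le> Re (\<Sum>(c, i)\<leftarrow>L. cnj c * (\<Sum>(d, j)\<leftarrow>L. d * K i j))"
begin

definition kvec :: "'i combination \<Rightarrow> 'i \<Rightarrow> complex"
  where "kvec L i = (\<Sum>(d, j)\<leftarrow>L. d * K i j)"

definition ks :: "'i combination \<Rightarrow> 'i combination \<Rightarrow> complex"
  where "ks L M = eval_comb L (kvec M)"

definition kn :: "'i combination \<Rightarrow> real"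
  where "kn L = sqrt (Re (ks L L))"

lemma kvec_simps [simp]:
  "kvec [] = 0" "kvec (L @ M) = kvec L + kvec M" "kvec (scale_comb z L) = z *\<^sub>C kvec L"
  "kvec [(d, j)] i = d * K i j"
proof -
  show "kvec (scale_comb z L) = z *\<^sub>C kvec L"
    by (induction L) (auto simp: fun_eq_iff kvec_def scale_comb_def scaleC_fun_def scaleC_complex_def algebra_simps)
qed (auto simp: fun_eq_iff kvec_def)

lemma ks_simps [simp]:
  "ks [] M = 0" "ks L [] = 0"
  "ks (L @ L') M = ks L M + ks L' M" "ks L (M @ M') = ks L M + ks L M'"
  "ks (scale_comb z L) M = cnj z * ks L M" "ks L (scale_comb z M) = z * ks L M"
  using eval_comb_scaleC[of L 0 0]
  by (auto simp: ks_def eval_comb_add eval_comb_scaleC)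

lemma eval_kvec_singleton: "eval_comb [(1, i)] (kvec M) = kvec M i"
  by (simp add: eval_comb_singleton)

lemma ks_cnj: "cnj (ks L M) = ks M L"
proof (induction L)
  case (Cons x L)
  have 1: "cnj (ks [x] M) = ks M [x]" for M
  proof (induction M)
    case (Cons y M)
    have "cnj (ks [x] [y]) = ks [y] [x]"
      by (cases x; cases y) (simp add: ks_def eval_comb_singleton K_cnj)
    then have "cnj (ks [x] ([y] @ M)) = ks ([y] @ M) [x]"
      using Cons unfolding ks_simps by simp
    then show ?case by simp
  qed simp
  have "cnj (ks ([x] @ L) M) = ks M ([x] @ L)" using Cons 1 unfolding ks_simps by simp
  then show ?case by simp
qed simp

lemma ks_self_nonneg: "0 \<le> Re (ks L L)"
  using K_positive[of L] by (simp add: ks_def eval_comb_def kvec_def)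

lemma kn_nonneg [simp]: "0 \<le> kn L"
  by (simp add: kn_def ks_self_nonneg)

lemma kn_square: "(kn L)\<^sup>2 = Re (ks L L)"
  by (simp add: kn_def ks_self_nonneg)

lemma ks_self: "ks L L = (kn L)\<^sup>2"
  using ks_cnj[of L L] by (simp add: complex_eq_iff kn_square)

lemma kn_scale: "kn (scale_comb z L) = cmod z * kn L"
proof (rule power2_eq_imp_eq)
  have "ks (scale_comb z L) (scale_comb z L) = (z * cnj z) * ks L L"
    unfolding ks_simps by (simp only: ac_simps)
  also have "z * cnj z = complex_of_real ((cmod z)\<^sup>2)" by (rule complex_norm_square[symmetric])
  finally have "Re (ks (scale_comb z L) (scale_comb z L)) = (cmod z)\<^sup>2 * Re (ks L L)"
    by (simp only: Re_complex_of_real times_complex.sel Im_complex_of_real mult_zero_left diff_zero)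
  then show "(kn (scale_comb z L))\<^sup>2 = (cmod z * kn L)\<^sup>2"
    unfolding power_mult_distrib kn_square .
qed auto

lemma norm_ks_le: "cmod (ks L M) \<le> kn L * kn M"
proof (rule ccontr)
  assume "\<not> ?thesis"
  then have less: "kn L * kn M < cmod (ks L M)" by simp
  define c where "c = cmod (ks L M)"
  have c: "c > 0" unfolding c_def
    by (rule le_less_trans[OF mult_nonneg_nonneg[OF kn_nonneg kn_nonneg] less])
  \<comment> \<open>A phase that makes the mixed terms real, so that a nonnegative real quadratic
    polynomial in \<open>t\<close> remains.\<close>
  define z where "z = cnj (ks L M) / c"
  have zc: "z * ks L M = c" using c
    by (simp add: z_def c_def field_simps complex_norm_square[symmetric] power2_eq_square)
  have czc: "cnj z * ks M L = c" using arg_cong[OF zc, of cnj] by (simp add: ks_cnj)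
  have nz: "cmod z = 1" using c by (simp add: z_def c_def norm_divide)
  have key: "0 \<le> (kn L)\<^sup>2 + 2 * t * c + t\<^sup>2 * (kn M)\<^sup>2" for t :: real
  proof -
    let ?N = "scale_comb (complex_of_real t * z) M"
    have "ks (L @ ?N) (L @ ?N) = ks L L + t * (z * ks L M) + t * (cnj z * ks M L) + ks ?N ?N"
      by (simp add: algebra_simps del: ks_simps(5,6)) simp
    also have "\<dots> = complex_of_real ((kn L)\<^sup>2 + 2 * t * c + t\<^sup>2 * (kn M)\<^sup>2)"
      unfolding zc czc ks_self kn_scale by (simp add: norm_mult nz power_mult_distrib)
    finally show ?thesis using ks_self_nonneg[of "L @ ?N"] by simp
  qed
  show False
  proof (cases "kn M = 0")
    case True
    have "0 \<le> (kn L)\<^sup>2 + 2 * (- ((kn L)\<^sup>2 + 1) / c) * c + 0" using key[of "- ((kn L)\<^sup>2 + 1) / c"] True by simp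
    also have "\<dots> = - (kn L)\<^sup>2 - 2" using c by simp
    finally show False using zero_le_power2[of "kn L"] by linarith
  next
    case False
    then have M: "(kn M)\<^sup>2 > 0" by simp
    have "0 \<le> (kn L)\<^sup>2 + 2 * (- c / (kn M)\<^sup>2) * c + (- c / (kn M)\<^sup>2)\<^sup>2 * (kn M)\<^sup>2" by (rule key)
    also have "\<dots> = (kn L)\<^sup>2 - c\<^sup>2 / (kn M)\<^sup>2" using M by (simp add: power2_eq_square field_simps)
    finally have "c\<^sup>2 \<le> (kn L * kn M)\<^sup>2" using M by (simp add: field_simps power_mult_distrib)
    then have "c \<le> kn L * kn M" by (rule power2_le_imp_le) simp
    then show False using less by (simp add: c_def)
  qed
qed

lemma kn_triangle: "kn (L @ M) \<le> kn L + kn M"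
proof (rule power2_le_imp_le)
  have "(kn (L @ M))\<^sup>2 = (kn L)\<^sup>2 + 2 * Re (ks L M) + (kn M)\<^sup>2"
    using ks_cnj[of L M] unfolding kn_square by (simp add: complex_eq_iff)
  also have "\<dots> \<le> (kn L)\<^sup>2 + 2 * (kn L * kn M) + (kn M)\<^sup>2"
    using order_trans[OF complex_Re_le_cmod norm_ks_le] by simp
  finally show "(kn (L @ M))\<^sup>2 \<le> (kn L + kn M)\<^sup>2" by (simp add: power2_sum)
qed simp

text \<open>By hermitian symmetry \<open>ks\<close> depends on either list only through its kernel
  function; identities of combinations can thus be checked on functions.\<close>

lemma kn_eqI: "kvec L = kvec M \<Longrightarrow> kn L = kn M"
  by (metis kn_def ks_cnj ks_def)

lemma norm_kvec_le: "cmod (kvec L i) \<le> kn [(1, i)] * kn L"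
  using norm_ks_le[of "[(1, i)]" L] by (simp add: ks_def eval_kvec_singleton)

section \<open>The completion as a space of functions\<close>

definition comb_Cauchy :: "(nat \<Rightarrow> 'i combination) \<Rightarrow> bool"
  where "comb_Cauchy X \<longleftrightarrow> (\<forall>e>0. \<exists>N. \<forall>m\<ge>N. \<forall>n\<ge>N. kn (diff_comb (X m) (X n)) < e)"

definition approximates :: "(nat \<Rightarrow> 'i combination) \<Rightarrow> ('i \<Rightarrow> complex) \<Rightarrow> bool"
  where "approximates X F \<longleftrightarrow> comb_Cauchy X \<and> (\<forall>i. (\<lambda>n. kvec (X n) i) \<longlonglongrightarrow> F i)"

text \<open>Combinations of norm \<open>0\<close> already vanish as functions, so the completion
  needs no quotient and can be realized by pointwise limits.\<close>

definition H :: "('i \<Rightarrow> complex) set"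
  where "H = {F. \<exists>X. approximates X F}"

text \<open>The choice is arbitrary; by \<open>ipH_tendsto\<close> every approximating sequence of
  \<open>F\<close> has this limit.\<close>

definition ipH :: "('i \<Rightarrow> complex) \<Rightarrow> ('i \<Rightarrow> complex) \<Rightarrow> complex"
  where "ipH F G = lim (\<lambda>n. eval_comb ((SOME X. approximates X F) n) G)"

lemma comb_Cauchy_bounded:
  assumes "comb_Cauchy X" obtains C where "0 \<le> C" "\<And>n. kn (X n) \<le> C"
proof -
  obtain N where N: "\<And>m n. m \<ge> N \<Longrightarrow> n \<ge> N \<Longrightarrow> kn (diff_comb (X m) (X n)) < 1"
    using assms unfolding comb_Cauchy_def by (meson zero_less_one)
  define C where "C = Max ((\<lambda>n. kn (X n)) ` {..N}) + 1"
  have le: "kn (X n) \<le> C - 1" if "n \<le> N" for n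
    unfolding C_def using that by (auto intro!: Max_ge)
  have "kn (X n) \<le> C" for n
  proof (cases "n \<le> N")
    case False
    have "kn (X n) = kn (diff_comb (X n) (X N) @ X N)"
      by (rule kn_eqI) (simp add: fun_eq_iff scaleC_fun_def scaleC_complex_def)
    also have "\<dots> \<le> kn (diff_comb (X n) (X N)) + kn (X N)" by (rule kn_triangle)
    also have "\<dots> \<le> C" using N[of n N] le[of N] False by simp
    finally show ?thesis .
  qed (use le[of n] in simp)
  moreover have "0 \<le> C" using le[of 0] kn_nonneg[of "X 0"] by linarith
  ultimately show thesis using that by blast
qed

lemma approximates_eval:
  "approximates X F \<Longrightarrow> (\<lambda>n. eval_comb L (kvec (X n))) \<longlonglongrightarrow> eval_comb L F"
  by (intro tendsto_eval_comb) (simp add: approximates_def)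

lemma H_bounded:
  assumes "F \<in> H" obtains C where "0 \<le> C" "\<And>L. cmod (eval_comb L F) \<le> C * kn L"
proof -
  from assms obtain X where X: "approximates X F" by (auto simp: H_def)
  obtain C where C: "0 \<le> C" "\<And>n. kn (X n) \<le> C" using X comb_Cauchy_bounded approximates_def by metis
  show thesis
  proof (rule that[OF C(1)])
    fix L
    have "cmod (eval_comb L (kvec (X n))) \<le> C * kn L" for n
      using norm_ks_le[of L "X n"] mult_left_mono[OF C(2)[of n] kn_nonneg[of L]]
      by (simp add: ks_def mult.commute)
    then show "cmod (eval_comb L F) \<le> C * kn L"
      by (intro tendsto_upperbound[OF tendsto_norm[OF approximates_eval[OF X]]]) auto
  qed
qed

text \<open>This is why functions represent the completion faithfully. The squared norm splits into
  a product with \<open>diff_comb (X n) (X N)\<close>, small for large \<open>N\<close>, and one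
  with the fixed \<open>X N\<close>, which involves finitely many point values of
  \<open>kvec (X n)\<close> and so tends to \<open>0\<close>.\<close>

lemma comb_Cauchy_null:
  assumes X: "comb_Cauchy X" and lim: "\<And>i. (\<lambda>n. kvec (X n) i) \<longlonglongrightarrow> 0"
  shows "(\<lambda>n. kn (X n)) \<longlonglongrightarrow> 0"
proof -
  obtain C where C: "0 \<le> C" "\<And>n. kn (X n) \<le> C" using comb_Cauchy_bounded[OF X] by metis
  have "(\<lambda>n. (kn (X n))\<^sup>2) \<longlonglongrightarrow> 0"
  proof (rule LIMSEQ_I)
    fix e :: real assume e: "0 < e"
    define e' where "e' = e / (2 * (C + 1))"
    have e': "0 < e'" using e C by (simp add: e'_def)
    obtain N where N: "\<And>m n. m \<ge> N \<Longrightarrow> n \<ge> N \<Longrightarrow> kn (diff_comb (X m) (X n)) < e'"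
      using X e' unfolding comb_Cauchy_def by meson
    have "approximates X 0" using X lim by (simp add: approximates_def)
    from approximates_eval[OF this, of "X N"]
    have "(\<lambda>n. ks (X N) (X n)) \<longlonglongrightarrow> 0"
      by (simp add: ks_def eval_comb_def zero_fun_def case_prod_unfold)
    then obtain M where M: "\<And>n. n \<ge> M \<Longrightarrow> cmod (ks (X N) (X n)) < e / 2"
      using LIMSEQ_D[of _ 0 "e/2"] e by (metis diff_zero half_gt_zero)
    show "\<exists>no. \<forall>n\<ge>no. norm ((kn (X n))\<^sup>2 - 0) < e"
    proof (intro exI[of _ "max M N"] allI impI)
      fix n assume n: "max M N \<le> n"
      have "complex_of_real ((kn (X n))\<^sup>2) = ks (diff_comb (X n) (X N)) (X n) + ks (X N) (X n)"
        by (simp add: ks_self)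
      then have "(kn (X n))\<^sup>2 = cmod (ks (diff_comb (X n) (X N)) (X n) + ks (X N) (X n))"
        by (metis abs_power2 norm_of_real)
      also have "\<dots> \<le> kn (diff_comb (X n) (X N)) * kn (X n) + cmod (ks (X N) (X n))"
        using norm_triangle_ineq order_trans norm_ks_le add_right_mono by meson
      also have "\<dots> \<le> e' * C + cmod (ks (X N) (X n))"
        using N[of n N] n C(2)[of n] e' by (intro add_right_mono mult_mono) auto
      also have "e' * C \<le> e / 2" using e C(1) by (simp add: e'_def field_simps)
      also have "cmod (ks (X N) (X n)) < e / 2" using M n by simp
      finally show "norm ((kn (X n))\<^sup>2 - 0) < e" by simp
    qed
  qed
  then have "(\<lambda>n. sqrt ((kn (X n))\<^sup>2)) \<longlonglongrightarrow> sqrt 0" by (intro tendsto_intros)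
  then show ?thesis by simp
qed

lemma comb_Cauchy_append:
  assumes "comb_Cauchy X" "comb_Cauchy Y" shows "comb_Cauchy (\<lambda>n. X n @ Y n)"
  unfolding comb_Cauchy_def
proof (intro allI impI)
  fix e :: real assume e: "0 < e"
  obtain N where N: "\<And>m n. m \<ge> N \<Longrightarrow> n \<ge> N \<Longrightarrow> kn (diff_comb (X m) (X n)) < e / 2"
    using assms(1) e unfolding comb_Cauchy_def by (meson half_gt_zero)
  obtain M where M: "\<And>m n. m \<ge> M \<Longrightarrow> n \<ge> M \<Longrightarrow> kn (diff_comb (Y m) (Y n)) < e / 2"
    using assms(2) e unfolding comb_Cauchy_def by (meson half_gt_zero)
  show "\<exists>N. \<forall>m\<ge>N. \<forall>n\<ge>N. kn (diff_comb (X m @ Y m) (X n @ Y n)) < e"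
  proof (intro exI[of _ "max M N"] allI impI)
    fix m n assume mn: "max M N \<le> m" "max M N \<le> n"
    have "kn (diff_comb (X m @ Y m) (X n @ Y n)) = kn (diff_comb (X m) (X n) @ diff_comb (Y m) (Y n))"
      by (rule kn_eqI) (simp add: fun_eq_iff scaleC_fun_def scaleC_complex_def)
    also have "\<dots> \<le> kn (diff_comb (X m) (X n)) + kn (diff_comb (Y m) (Y n))" by (rule kn_triangle)
    also have "\<dots> < e" using N[of m n] M[of m n] mn by simp
    finally show "kn (diff_comb (X m @ Y m) (X n @ Y n)) < e" .
  qed
qed

lemma comb_Cauchy_contraction:
  assumes X: "comb_Cauchy X" and C: "\<And>m n. kn (diff_comb (Y m) (Y n)) \<le> C * kn (diff_comb (X m) (X n))"
  shows "comb_Cauchy Y"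
  unfolding comb_Cauchy_def
proof (intro allI impI)
  fix e :: real assume e: "0 < e"
  define D where "D = \<bar>C\<bar> + 1"
  have D: "D > 0" "C \<le> D" by (auto simp: D_def)
  obtain N where N: "\<And>m n. m \<ge> N \<Longrightarrow> n \<ge> N \<Longrightarrow> kn (diff_comb (X m) (X n)) < e / D"
    using X e D unfolding comb_Cauchy_def by (meson divide_pos_pos)
  show "\<exists>N. \<forall>m\<ge>N. \<forall>n\<ge>N. kn (diff_comb (Y m) (Y n)) < e"
  proof (intro exI[of _ N] allI impI)
    fix m n assume mn: "N \<le> m" "N \<le> n"
    have "kn (diff_comb (Y m) (Y n)) \<le> D * kn (diff_comb (X m) (X n))"
      using C[of m n] mult_right_mono[OF D(2) kn_nonneg] by (rule order_trans)
    also have "\<dots> < e" using N[OF mn] D by (simp add: field_simps)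
    finally show "kn (diff_comb (Y m) (Y n)) < e" .
  qed
qed

lemma comb_Cauchy_scale:
  assumes "comb_Cauchy X" shows "comb_Cauchy (\<lambda>n. scale_comb z (X n))"
proof (rule comb_Cauchy_contraction[OF assms])
  show "kn (diff_comb (scale_comb z (X m)) (scale_comb z (X n))) \<le> cmod z * kn (diff_comb (X m) (X n))" for m n
    unfolding kn_scale[symmetric]
    by (rule eq_refl, rule kn_eqI) (simp add: fun_eq_iff scaleC_fun_def scaleC_complex_def algebra_simps)
qed

lemma comb_Cauchy_const: "comb_Cauchy (\<lambda>n. L)"
proof -
  have "kn (diff_comb L L) = kn []"
    by (rule kn_eqI) (simp add: fun_eq_iff scaleC_fun_def scaleC_complex_def)
  then show ?thesis by (simp add: comb_Cauchy_def kn_def)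
qed

lemma approximates_append:
  "approximates X F \<Longrightarrow> approximates Y G \<Longrightarrow> approximates (\<lambda>n. X n @ Y n) (F + G)"
  by (auto simp: approximates_def intro!: comb_Cauchy_append tendsto_intros)

lemma approximates_scale: "approximates X F \<Longrightarrow> approximates (\<lambda>n. scale_comb z (X n)) (z *\<^sub>C F)"
  by (auto simp: approximates_def scaleC_fun_def scaleC_complex_def intro!: comb_Cauchy_scale tendsto_intros)

lemma approximates_kvec: "approximates (\<lambda>n. L) (kvec L)"
  by (simp add: approximates_def comb_Cauchy_const)

lemma approximates_diff:
  assumes "approximates X F" "approximates Y G" shows "approximates (\<lambda>n. diff_comb (X n) (Y n)) (F - G)"
proof -
  have "F - G = F + (-1) *\<^sub>C G" by (simp add: fun_eq_iff scaleC_fun_def scaleC_complex_def)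
  then show ?thesis using approximates_append[OF assms(1) approximates_scale[OF assms(2)]] by metis
qed

lemma kvec_in_H: "kvec L \<in> H"
  using approximates_kvec by (auto simp: H_def)

lemma H_add: "F \<in> H \<Longrightarrow> G \<in> H \<Longrightarrow> F + G \<in> H"
  using approximates_append by (fastforce simp: H_def)

lemma H_scaleC: "F \<in> H \<Longrightarrow> z *\<^sub>C F \<in> H"
  using approximates_scale by (fastforce simp: H_def)

lemma H_diff: "F \<in> H \<Longrightarrow> G \<in> H \<Longrightarrow> F - G \<in> H"
  using approximates_diff by (fastforce simp: H_def)

lemma ipH_tendsto:
  assumes X: "approximates X F" and G: "G \<in> H"
  shows "(\<lambda>n. eval_comb (X n) G) \<longlonglongrightarrow> ipH F G"
proof -
  obtain C where C: "0 \<le> C" "\<And>L. cmod (eval_comb L G) \<le> C * kn L" using H_bounded[OF G] by metis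
  define Y where "Y = (SOME X. approximates X F)"
  have Y: "approximates Y F" unfolding Y_def by (rule someI[of _ X]) (rule X)
  have "Cauchy (\<lambda>n. eval_comb (Y n) G)"
  proof (rule CauchyI)
    fix e :: real assume "0 < e"
    then have "0 < e / (C + 1)" using C by simp
    then obtain N where N: "\<And>m n. m \<ge> N \<Longrightarrow> n \<ge> N \<Longrightarrow> kn (diff_comb (Y m) (Y n)) < e / (C + 1)"
      using Y unfolding approximates_def comb_Cauchy_def by meson
    show "\<exists>M. \<forall>m\<ge>M. \<forall>n\<ge>M. norm (eval_comb (Y m) G - eval_comb (Y n) G) < e"
    proof (intro exI[of _ N] allI impI)
      fix m n assume mn: "N \<le> m" "N \<le> n"
      have "norm (eval_comb (Y m) G - eval_comb (Y n) G) = norm (eval_comb (diff_comb (Y m) (Y n)) G)"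
        by simp
      also have "\<dots> \<le> (C + 1) * kn (diff_comb (Y m) (Y n))"
        using C(2)[of "diff_comb (Y m) (Y n)"] mult_right_mono[of C "C + 1" "kn (diff_comb (Y m) (Y n))"]
        by simp
      also have "\<dots> < e" using N[OF mn] C(1) by (simp add: field_simps)
      finally show "norm (eval_comb (Y m) G - eval_comb (Y n) G) < e" .
    qed
  qed
  then have limY: "(\<lambda>n. eval_comb (Y n) G) \<longlonglongrightarrow> ipH F G"
    unfolding ipH_def Y_def[symmetric] by (simp add: Cauchy_convergent convergent_LIMSEQ_iff[symmetric])
  have "approximates (\<lambda>n. diff_comb (X n) (Y n)) (F - F)" by (rule approximates_diff[OF X Y])
  then have "(\<lambda>n. kn (diff_comb (X n) (Y n))) \<longlonglongrightarrow> 0"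
    by (intro comb_Cauchy_null) (simp_all add: approximates_def)
  then have "(\<lambda>n. C * kn (diff_comb (X n) (Y n))) \<longlonglongrightarrow> 0" using tendsto_mult_left_zero tendsto_mult_right_zero by blast
  then have "(\<lambda>n. eval_comb (diff_comb (X n) (Y n)) G) \<longlonglongrightarrow> 0"
    by (rule Lim_null_comparison[rotated]) (use C(2) in \<open>auto intro!: always_eventually simp del: eval_comb_simps\<close>)
  then have "(\<lambda>n. eval_comb (X n) G - eval_comb (Y n) G) \<longlonglongrightarrow> 0" by simp
  from tendsto_add[OF this limY] show ?thesis by simp
qed

lemma ipH_kvec: "G \<in> H \<Longrightarrow> ipH (kvec L) G = eval_comb L G"
  using ipH_tendsto[OF approximates_kvec, of G L] LIMSEQ_unique tendsto_const by blast

lemma ks_tendsto_ipH: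
  assumes X: "approximates X F" and Y: "approximates Y G"
  shows "(\<lambda>n. ks (X n) (Y n)) \<longlonglongrightarrow> ipH F G"
proof -
  have G: "G \<in> H" using Y by (auto simp: H_def)
  obtain C where C: "0 \<le> C" "\<And>n. kn (X n) \<le> C" using X comb_Cauchy_bounded approximates_def by metis
  have "(\<lambda>n. eval_comb (X n) G - ks (X n) (Y n)) \<longlonglongrightarrow> 0"
  proof (rule LIMSEQ_I)
    fix e :: real assume e: "0 < e"
    define e' where "e' = e / (C + 1)"
    have e': "0 < e'" using e C by (simp add: e'_def)
    then obtain N where N: "\<And>m n. m \<ge> N \<Longrightarrow> n \<ge> N \<Longrightarrow> kn (diff_comb (Y m) (Y n)) < e'"
      using Y unfolding approximates_def comb_Cauchy_def by meson
    show "\<exists>no. \<forall>n\<ge>no. norm (eval_comb (X n) G - ks (X n) (Y n) - 0) < e"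
    proof (intro exI[of _ N] allI impI)
      fix n assume n: "N \<le> n"
      have "(\<lambda>m. ks (X n) (Y m) - ks (X n) (Y n)) \<longlonglongrightarrow> eval_comb (X n) G - ks (X n) (Y n)"
        unfolding ks_def by (intro tendsto_intros approximates_eval Y)
      moreover have "\<forall>\<^sub>F m in sequentially. cmod (ks (X n) (Y m) - ks (X n) (Y n)) \<le> C * e'"
      proof (rule eventually_sequentiallyI[of N])
        fix m assume m: "N \<le> m"
        have "cmod (ks (X n) (Y m) - ks (X n) (Y n)) = cmod (ks (X n) (diff_comb (Y m) (Y n)))" by simp
        also have "\<dots> \<le> kn (X n) * kn (diff_comb (Y m) (Y n))" by (rule norm_ks_le)
        also have "\<dots> \<le> C * e'" using C N[OF m n] by (intro mult_mono) auto
        finally show "cmod (ks (X n) (Y m) - ks (X n) (Y n)) \<le> C * e'" .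
      qed
      ultimately have "cmod (eval_comb (X n) G - ks (X n) (Y n)) \<le> C * e'"
        using tendsto_upperbound[OF tendsto_norm] by fastforce
      also have "\<dots> < e" using e C by (simp add: e'_def field_simps)
      finally show "norm (eval_comb (X n) G - ks (X n) (Y n) - 0) < e" by simp
    qed
  qed
  from tendsto_diff[OF ipH_tendsto[OF X G] this] show ?thesis by simp
qed

lemma hnorm_tendsto:
  assumes "approximates X F" shows "(\<lambda>n. kn (X n)) \<longlonglongrightarrow> hnorm ipH F"
  unfolding hnorm_def kn_def by (intro tendsto_intros ks_tendsto_ipH assms)

lemma hnorm_nonneg: "F \<in> H \<Longrightarrow> 0 \<le> hnorm ipH F"
  using tendsto_lowerbound[OF hnorm_tendsto] by (fastforce simp: H_def)

lemma hnorm_kvec: "hnorm ipH (kvec L) = kn L"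
  using hnorm_tendsto[OF approximates_kvec, of L] LIMSEQ_unique tendsto_const by blast

lemma hnorm_triangle:
  assumes "F \<in> H" "G \<in> H" shows "hnorm ipH (F + G) \<le> hnorm ipH F + hnorm ipH G"
proof -
  from assms obtain X Y where X: "approximates X F" and Y: "approximates Y G" by (auto simp: H_def)
  show ?thesis
    by (rule LIMSEQ_le[OF hnorm_tendsto[OF approximates_append[OF X Y]]
          tendsto_add[OF hnorm_tendsto[OF X] hnorm_tendsto[OF Y]]]) (auto intro: kn_triangle)
qed

lemma hnorm_triangle_diff:
  assumes "F \<in> H" "G \<in> H" "L \<in> H" shows "hnorm ipH (F - L) \<le> hnorm ipH (F - G) + hnorm ipH (G - L)"
  using hnorm_triangle[OF H_diff[OF assms(1,2)] H_diff[OF assms(2,3)]] by simp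

lemma H_dense:
  assumes X: "approximates X F" shows "(\<lambda>n. hnorm ipH (F - kvec (X n))) \<longlonglongrightarrow> 0"
proof (rule LIMSEQ_I)
  fix e :: real assume "0 < e"
  then obtain N where N: "\<And>m n. m \<ge> N \<Longrightarrow> n \<ge> N \<Longrightarrow> kn (diff_comb (X m) (X n)) < e / 2"
    using X unfolding approximates_def comb_Cauchy_def by (meson half_gt_zero)
  show "\<exists>no. \<forall>n\<ge>no. norm (hnorm ipH (F - kvec (X n)) - 0) < e"
  proof (intro exI[of _ N] allI impI)
    fix n assume n: "N \<le> n"
    have lim: "(\<lambda>m. kn (diff_comb (X m) (X n))) \<longlonglongrightarrow> hnorm ipH (F - kvec (X n))"
      by (rule hnorm_tendsto[OF approximates_diff[OF X approximates_kvec]])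
    have "hnorm ipH (F - kvec (X n)) \<le> e / 2"
      by (rule tendsto_upperbound[OF lim])
        (use N n less_imp_le in \<open>auto intro!: eventually_sequentiallyI[of N]\<close>)
    moreover have "0 \<le> hnorm ipH (F - kvec (X n))"
      by (rule tendsto_lowerbound[OF lim]) auto
    ultimately show "norm (hnorm ipH (F - kvec (X n)) - 0) < e" using \<open>0 < e\<close> by simp
  qed
qed

lemma hnorm_minus_commute:
  assumes "F \<in> H" "G \<in> H" shows "hnorm ipH (F - G) = hnorm ipH (G - F)"
proof -
  from assms obtain X Y where X: "approximates X F" and Y: "approximates Y G" by (auto simp: H_def)
  have "kn (diff_comb (X n) (Y n)) = kn (diff_comb (Y n) (X n))" for n
    using kn_scale[of "-1" "diff_comb (Y n) (X n)"]
      kn_eqI[of "scale_comb (-1) (diff_comb (Y n) (X n))" "diff_comb (X n) (Y n)"]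
    by (simp add: fun_eq_iff scaleC_fun_def scaleC_complex_def)
  then show ?thesis
    using hnorm_tendsto[OF approximates_diff[OF X Y]] hnorm_tendsto[OF approximates_diff[OF Y X]]
    by (simp add: LIMSEQ_unique)
qed

text \<open>Each \<open>F n\<close> is replaced by a combination within
  \<open>1 / real (Suc n)\<close>; these combinations form an approximating sequence, and its
  pointwise limit is the limit sought.\<close>

lemma H_complete: "complete_in H (hnorm ipH)"
  unfolding complete_in_def
proof (intro allI impI)
  fix F :: "nat \<Rightarrow> 'i \<Rightarrow> complex"
  assume "(\<forall>n. F n \<in> H) \<and> (\<forall>e>0. \<exists>N. \<forall>m\<ge>N. \<forall>n\<ge>N. hnorm ipH (F m - F n) < e)"
  then have FH: "\<And>n. F n \<in> H" and FC: "\<forall>e>0. \<exists>N. \<forall>m\<ge>N. \<forall>n\<ge>N. hnorm ipH (F m - F n) < e"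
    by auto
  have "\<exists>L. hnorm ipH (F n - kvec L) < 1 / real (Suc n)" for n
  proof -
    obtain X where "approximates X (F n)" using FH[of n] by (auto simp: H_def)
    from order_tendstoD(2)[OF H_dense[OF this], of "1 / real (Suc n)"]
    have "\<forall>\<^sub>F k in sequentially. hnorm ipH (F n - kvec (X k)) < 1 / real (Suc n)" by simp
    then show ?thesis using eventually_happens'[OF sequentially_bot] by blast
  qed
  then obtain L where L: "\<And>n. hnorm ipH (F n - kvec (L n)) < 1 / real (Suc n)" by metis
  have small: "\<exists>N. \<forall>n\<ge>N. 1 / real (Suc n) < e" if "0 < e" for e
    using order_tendstoD(2)[OF LIMSEQ_inverse_real_of_nat that]
    by (simp add: eventually_sequentially inverse_eq_divide)
  have LC: "comb_Cauchy L" unfolding comb_Cauchy_def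
  proof (intro allI impI)
    fix e :: real assume e: "0 < e"
    obtain N where N: "\<And>m n. m \<ge> N \<Longrightarrow> n \<ge> N \<Longrightarrow> hnorm ipH (F m - F n) < e / 3" using FC e
      by (meson divide_pos_pos zero_less_numeral)
    obtain M where M: "\<And>n. n \<ge> M \<Longrightarrow> 1 / real (Suc n) < e / 3" using small[of "e / 3"] e by auto
    show "\<exists>N. \<forall>m\<ge>N. \<forall>n\<ge>N. kn (diff_comb (L m) (L n)) < e"
    proof (intro exI[of _ "max M N"] allI impI)
      fix m n assume mn: "max M N \<le> m" "max M N \<le> n"
      have "kvec (diff_comb (L m) (L n)) = kvec (L m) - kvec (L n)"
        by (simp add: fun_eq_iff scaleC_fun_def scaleC_complex_def)
      then have "kn (diff_comb (L m) (L n)) = hnorm ipH (kvec (L m) - kvec (L n))"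
        by (metis hnorm_kvec)
      also have "\<dots> \<le> hnorm ipH (kvec (L m) - F m) + (hnorm ipH (F m - F n) + hnorm ipH (F n - kvec (L n)))"
        using hnorm_triangle_diff[of "kvec (L m)" "F m" "kvec (L n)"]
          hnorm_triangle_diff[of "F m" "F n" "kvec (L n)"] by (simp add: kvec_in_H FH)
      also have "\<dots> < e"
        using L[of m] L[of n] M[of m] M[of n] N[of m n] mn hnorm_minus_commute[of "kvec (L m)" "F m"]
        by (simp add: kvec_in_H FH)
      finally show "kn (diff_comb (L m) (L n)) < e" .
    qed
  qed
  have "convergent (\<lambda>n. kvec (L n) i)" for i
  proof (rule Cauchy_convergent, rule CauchyI)
    fix e :: real assume e: "0 < e"
    let ?k = "kn [(1, i)]"
    have k: "0 < ?k + 1" by (rule add_nonneg_pos[OF kn_nonneg zero_less_one])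
    then obtain N where N: "\<And>m n. m \<ge> N \<Longrightarrow> n \<ge> N \<Longrightarrow> kn (diff_comb (L m) (L n)) < e / (?k + 1)"
      using LC e unfolding comb_Cauchy_def by (meson divide_pos_pos)
    show "\<exists>M. \<forall>m\<ge>M. \<forall>n\<ge>M. norm (kvec (L m) i - kvec (L n) i) < e"
    proof (intro exI[of _ N] allI impI)
      fix m n assume mn: "N \<le> m" "N \<le> n"
      have "norm (kvec (L m) i - kvec (L n) i) = norm (kvec (diff_comb (L m) (L n)) i)"
        by (simp add: scaleC_fun_def scaleC_complex_def)
      also have "\<dots> \<le> ?k * kn (diff_comb (L m) (L n))" by (rule norm_kvec_le)
      also have "\<dots> \<le> (?k + 1) * kn (diff_comb (L m) (L n))" by (intro mult_right_mono) auto
      also have "\<dots> < e" using N[OF mn] k by (simp add: field_simps)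
      finally show "norm (kvec (L m) i - kvec (L n) i) < e" .
    qed
  qed
  then have "\<exists>g. (\<lambda>n. kvec (L n) i) \<longlonglongrightarrow> g" for i by (simp add: convergent_def)
  then obtain G where G: "\<And>i. (\<lambda>n. kvec (L n) i) \<longlonglongrightarrow> G i" by metis
  have app: "approximates L G" using LC G by (simp add: approximates_def)
  then have GH: "G \<in> H" by (auto simp: H_def)
  have lim: "(\<lambda>n. 1 / real (Suc n) + hnorm ipH (G - kvec (L n))) \<longlonglongrightarrow> 0 + 0"
    using LIMSEQ_inverse_real_of_nat by (intro tendsto_add H_dense[OF app]) (simp add: inverse_eq_divide)
  have le: "norm (hnorm ipH (F n - G)) \<le> 1 / real (Suc n) + hnorm ipH (G - kvec (L n))" for n
  proof -
    have "0 \<le> hnorm ipH (F n - G)" by (rule hnorm_nonneg[OF H_diff[OF FH GH]])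
    moreover have "hnorm ipH (F n - G) \<le> hnorm ipH (F n - kvec (L n)) + hnorm ipH (G - kvec (L n))"
      using hnorm_triangle_diff[of "F n" "kvec (L n)" G] hnorm_minus_commute[of G "kvec (L n)"]
      by (simp add: kvec_in_H FH GH)
    ultimately show ?thesis using L[of n] by simp
  qed
  have "(\<lambda>n. hnorm ipH (F n - G)) \<longlonglongrightarrow> 0"
    by (rule Lim_null_comparison[OF always_eventually[OF allI[OF le]]]) (use lim in simp)
  then show "\<exists>l\<in>H. (\<lambda>n. hnorm ipH (F n - l)) \<longlonglongrightarrow> 0" using GH by blast
qed

sublocale hilbert_space H ipH
proof
  have "0 \<in> H" using kvec_in_H[of "[]"] by simp
  then show "complex_vector.subspace H" by (auto simp: complex_vector.subspace_def H_add H_scaleC)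
  show "complete_in H (hnorm ipH)" by (rule H_complete)
  fix F G G' :: "'i \<Rightarrow> complex" and z
  assume F: "F \<in> H"
  then obtain X where X: "approximates X F" by (auto simp: H_def)
  show "ipH F (G + G') = ipH F G + ipH F G'" if "G \<in> H" "G' \<in> H"
    using ipH_tendsto[OF X H_add[OF that]] tendsto_add[OF ipH_tendsto[OF X that(1)] ipH_tendsto[OF X that(2)]]
    by (simp add: eval_comb_add LIMSEQ_unique)
  show "ipH F (z *\<^sub>C G) = z * ipH F G" if "G \<in> H"
    using ipH_tendsto[OF X H_scaleC[OF that, of z]] tendsto_mult_left[OF ipH_tendsto[OF X that], of z]
    by (simp add: eval_comb_scaleC LIMSEQ_unique)
  show "cnj (ipH F G) = ipH G F" if "G \<in> H"
  proof -
    from that obtain Y where Y: "approximates Y G" by (auto simp: H_def)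
    have "(\<lambda>n. cnj (ks (X n) (Y n))) \<longlonglongrightarrow> cnj (ipH F G)"
      by (intro tendsto_cnj ks_tendsto_ipH X Y)
    then show ?thesis using ks_tendsto_ipH[OF Y X] by (simp add: ks_cnj LIMSEQ_unique)
  qed
  show "0 \<le> Re (ipH F F)"
    by (rule tendsto_lowerbound[OF tendsto_Re[OF ks_tendsto_ipH[OF X X]]]) (auto simp: ks_self_nonneg)
  show "F = 0" if "ipH F F = 0"
  proof
    fix i
    have "(\<lambda>n. kn (X n)) \<longlonglongrightarrow> 0" using hnorm_tendsto[OF X] that by (simp add: hnorm_def)
    then have "(\<lambda>n. kn [(1, i)] * kn (X n)) \<longlonglongrightarrow> 0" by (rule tendsto_mult_right_zero)
    then have "(\<lambda>n. kvec (X n) i) \<longlonglongrightarrow> 0"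
      by (rule Lim_null_comparison[rotated]) (intro always_eventually allI norm_kvec_le)
    then show "F i = 0 i" using X LIMSEQ_unique by (auto simp: approximates_def)
  qed
qed

text \<open>Operators are given by precomposition with maps of the index set.\<close>

definition adjoint_maps :: "('i \<Rightarrow> 'i) \<Rightarrow> ('i \<Rightarrow> 'i) \<Rightarrow> bool"
  where "adjoint_maps a a' \<longleftrightarrow> (\<forall>i j. K (a i) j = K i (a' j)) \<and>
    (\<exists>C. \<forall>L. kn (map_comb a L) \<le> C * kn L) \<and> (\<exists>C. \<forall>L. kn (map_comb a' L) \<le> C * kn L)"

text \<open>As \<open>F i\<close> is the inner product of the \<open>i\<close>-th kernel function
  with \<open>F\<close>, this is the adjoint of the operator that moves the \<open>i\<close>-th
  kernel function to the one at \<open>a i\<close>.\<close>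

definition precomp :: "('i \<Rightarrow> 'i) \<Rightarrow> ('i \<Rightarrow> complex) \<Rightarrow> ('i \<Rightarrow> complex)"
  where "precomp a = (\<lambda>F\<in>H. F \<circ> a)"

lemma adjoint_maps_sym: "adjoint_maps a a' \<Longrightarrow> adjoint_maps a' a"
  unfolding adjoint_maps_def by (metis K_cnj)

lemma kvec_map_comb:
  assumes "\<And>i j. K (a i) j = K i (a' j)" shows "kvec (map_comb a' L) = kvec L \<circ> a"
  by (induction L) (auto simp: fun_eq_iff kvec_def map_comb_def assms)

text \<open>One bound suffices: the squared norm of the image of \<open>L\<close> under
  \<open>a'\<close> is the inner product of \<open>L\<close> with \<open>a\<close> applied to that
  image, and Cauchy-Schwarz allows one factor to be cancelled.\<close>

lemma adjoint_mapsI: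
  assumes adj: "\<And>i j. K (a i) j = K i (a' j)" and C: "\<And>L. kn (map_comb a L) \<le> C * kn L"
  shows "adjoint_maps a a'"
proof -
  have "kn (map_comb a' L) \<le> C * kn L" for L
  proof (cases "kn (map_comb a' L) = 0")
    case True
    have "0 \<le> C * kn L" using order_trans[OF kn_nonneg C] by blast
    then show ?thesis using True by simp
  next
    case False
    have "ks (map_comb a' L) (map_comb a' L) = ks (map_comb a (map_comb a' L)) L"
      by (simp add: ks_def kvec_map_comb[of a a' L, OF adj])
    then have "(kn (map_comb a' L))\<^sup>2 = Re (ks (map_comb a (map_comb a' L)) L)"
      by (simp add: kn_square)
    also have "\<dots> \<le> kn (map_comb a (map_comb a' L)) * kn L"
      using complex_Re_le_cmod norm_ks_le by (rule order_trans)
    also have "\<dots> \<le> (C * kn (map_comb a' L)) * kn L" by (intro mult_right_mono C) simp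
    finally show ?thesis using False kn_nonneg[of "map_comb a' L"]
      by (simp add: power2_eq_square)
  qed
  then show ?thesis using assms unfolding adjoint_maps_def by blast
qed

lemma approximates_precomp:
  assumes a: "adjoint_maps a a'" and X: "approximates X F"
  shows "approximates (\<lambda>n. map_comb a' (X n)) (F \<circ> a)"
proof -
  obtain C where C: "\<And>L. kn (map_comb a' L) \<le> C * kn L" using a by (auto simp: adjoint_maps_def)
  have "comb_Cauchy (\<lambda>n. map_comb a' (X n))"
    by (rule comb_Cauchy_contraction[of X _ C])
      (use X C in \<open>auto simp: approximates_def simp flip: map_comb_simps\<close>)
  then show ?thesis using X a kvec_map_comb[of a a'] by (auto simp: approximates_def adjoint_maps_def)
qed

lemma comp_in_H: "adjoint_maps a a' \<Longrightarrow> F \<in> H \<Longrightarrow> F \<circ> a \<in> H"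
  using approximates_precomp by (fastforce simp: H_def)

lemma precomp_apply: "F \<in> H \<Longrightarrow> precomp a F = F \<circ> a"
  by (simp add: precomp_def)

lemma precomp_bounded:
  assumes a: "adjoint_maps a a'" shows "precomp a \<in> bounded_ops H ipH"
proof -
  obtain C where C: "\<And>L. kn (map_comb a' L) \<le> C * kn L" using a by (auto simp: adjoint_maps_def)
  have "hnorm ipH (F \<circ> a) \<le> C * hnorm ipH F" if "F \<in> H" for F
  proof -
    from that obtain X where X: "approximates X F" by (auto simp: H_def)
    show ?thesis
      by (rule LIMSEQ_le[OF hnorm_tendsto[OF approximates_precomp[OF a X]]
            tendsto_mult_left[OF hnorm_tendsto[OF X]]]) (auto intro: C)
  qed
  moreover have "(F + G) \<circ> a = (F \<circ> a) + (G \<circ> a)" "(z *\<^sub>C F) \<circ> a = z *\<^sub>C (F \<circ> a)"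
    for F G :: "'i \<Rightarrow> complex" and z
    by (simp_all add: fun_eq_iff scaleC_fun_def)
  ultimately show ?thesis using comp_in_H[OF a]
    by (auto simp: bounded_ops_def precomp_def H_add H_scaleC intro!: exI[of _ C])
qed

lemma adj_precomp:
  assumes a: "adjoint_maps a a'" shows "adj H ipH (precomp a) = precomp a'"
proof (rule adj_eqI[OF precomp_bounded[OF adjoint_maps_sym[OF a]]])
  fix F G assume F: "F \<in> H" and G: "G \<in> H"
  from F obtain X where X: "approximates X F" by (auto simp: H_def)
  have "(\<lambda>n. eval_comb (X n) (G \<circ> a')) \<longlonglongrightarrow> ipH (F \<circ> a) G"
    using ipH_tendsto[OF approximates_precomp[OF a X] G] by simp
  moreover have "(\<lambda>n. eval_comb (X n) (G \<circ> a')) \<longlonglongrightarrow> ipH F (G \<circ> a')"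
    by (rule ipH_tendsto[OF X comp_in_H[OF adjoint_maps_sym[OF a] G]])
  ultimately show "ipH (precomp a F) G = ipH F (precomp a' G)"
    using F G by (simp add: precomp_apply LIMSEQ_unique)
qed

lemma precomp_kvec:
  "adjoint_maps a a' \<Longrightarrow> precomp a (kvec L) = kvec (map_comb a' L)"
  using kvec_map_comb[of a a' L] by (simp add: precomp_apply kvec_in_H adjoint_maps_def)

lemma closed_span_eq_H:
  assumes S: "\<And>s. s \<in> S \<Longrightarrow> s \<in> H"
    and dense: "\<And>i e. 0 < e \<Longrightarrow> \<exists>u\<in>complex_vector.span S. hnorm ipH (kvec [(1, i)] - u) < e"
  shows "closed_span H (hnorm ipH) S = H"
proof
  show "closed_span H (hnorm ipH) S \<subseteq> H" by (auto simp: closed_span_def)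
  have span_H: "u \<in> H" if "u \<in> complex_vector.span S" for u
    using complex_vector.span_minimal[of S H] S subspace that by blast
  have comb: "\<exists>u\<in>complex_vector.span S. hnorm ipH (kvec L - u) < e" if "0 < e" for L e
    using that
  proof (induction L arbitrary: e)
    case Nil
    have "hnorm ipH (kvec [] - 0) = 0" using hnorm_kvec[of "[]"] by (simp add: kn_def)
    then show ?case using Nil complex_vector.span_zero by (metis)
  next
    case (Cons x L)
    obtain c i where x: "x = (c, i)" by (cases x)
    define D where "D = cmod c + 1"
    have D0: "D > 0" "cmod c \<le> D" by (simp_all add: D_def add_nonneg_pos)
    define e' where "e' = e / 2 / D"
    have e': "0 < e'" using Cons.prems D0 by (simp add: e'_def)
    obtain u where u: "u \<in> complex_vector.span S" "hnorm ipH (kvec [(1, i)] - u) < e'" using dense[OF e'] by blast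
    obtain w where w: "w \<in> complex_vector.span S" "hnorm ipH (kvec L - w) < e / 2"
      using Cons.IH[of "e / 2"] Cons.prems half_gt_zero by blast
    have D: "kvec [(1, i)] - u \<in> H" by (intro H_diff kvec_in_H span_H u)
    have "kvec (x # L) - (c *\<^sub>C u + w) = c *\<^sub>C (kvec [(1, i)] - u) + (kvec L - w)"
      by (simp add: fun_eq_iff kvec_def x scaleC_fun_def scaleC_complex_def algebra_simps)
    then have "hnorm ipH (kvec (x # L) - (c *\<^sub>C u + w))
        \<le> hnorm ipH (c *\<^sub>C (kvec [(1, i)] - u)) + hnorm ipH (kvec L - w)"
      using hnorm_triangle[OF H_scaleC[OF D] H_diff[OF kvec_in_H span_H[OF w(1)]]] by metis
    moreover have "hnorm ipH (c *\<^sub>C (kvec [(1, i)] - u)) = cmod c * hnorm ipH (kvec [(1, i)] - u)"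
    proof -
      obtain X where X: "approximates X (kvec [(1, i)] - u)" using D by (auto simp: H_def)
      show ?thesis
        using hnorm_tendsto[OF approximates_scale[OF X, of c]] tendsto_mult_left[OF hnorm_tendsto[OF X], of "cmod c"]
        by (simp add: kn_scale LIMSEQ_unique)
    qed
    moreover have "cmod c * hnorm ipH (kvec [(1, i)] - u) \<le> D * e'"
      using u D0 hnorm_nonneg[OF D] by (intro mult_mono) auto
    moreover have "D * e' = e / 2" using D0 by (simp add: e'_def)
    ultimately have "hnorm ipH (kvec (x # L) - (c *\<^sub>C u + w)) < e" using w(2) by linarith
    moreover have "c *\<^sub>C u + w \<in> complex_vector.span S"
      by (intro complex_vector.span_add complex_vector.span_scale u w)
    ultimately show ?case by blast
  qed
  show "H \<subseteq> closed_span H (hnorm ipH) S"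
  proof
    fix F assume F: "F \<in> H"
    then obtain X where X: "approximates X F" by (auto simp: H_def)
    have "\<exists>u\<in>complex_vector.span S. hnorm ipH (F - u) < e" if e: "0 < e" for e
    proof -
      have "\<forall>\<^sub>F n in sequentially. hnorm ipH (F - kvec (X n)) < e / 2"
        by (rule order_tendstoD(2)[OF H_dense[OF X]]) (use e in simp)
      then obtain n where n: "hnorm ipH (F - kvec (X n)) < e / 2"
        using eventually_happens'[OF sequentially_bot] by blast
      obtain u where u: "u \<in> complex_vector.span S" "hnorm ipH (kvec (X n) - u) < e / 2"
        using comb[of "e / 2" "X n"] e half_gt_zero by blast
      have "hnorm ipH (F - u) < e"
        using hnorm_triangle_diff[of F "kvec (X n)" u] F kvec_in_H span_H[OF u(1)] n u(2) by simp
      then show ?thesis using u(1) by blast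
    qed
    then show "F \<in> closed_span H (hnorm ipH) S" using F by (auto simp: closed_span_def)
  qed
qed

end

section \<open>The representation on infinite words\<close>

lemma
  assumes "limit_functional \<phi>"
  shows limit_functional_add: "bounded (range c) \<Longrightarrow> bounded (range d) \<Longrightarrow> \<phi> (\<lambda>n. c n + d n) = \<phi> c + \<phi> d"
    and limit_functional_scaleC: "bounded (range c) \<Longrightarrow> \<phi> (\<lambda>n. z *\<^sub>C c n) = z * \<phi> c"
    and limit_functional_star: "bounded (range c) \<Longrightarrow> \<phi> (\<lambda>n. star (c n)) = cnj (\<phi> c)"
    and limit_functional_positive: "bounded (range c) \<Longrightarrow> (\<And>n. psd (uemb (c n))) \<Longrightarrow> 0 \<le> Re (\<phi> c)"
    and limit_functional_norm: "(\<And>n. norm (c n) \<le> M) \<Longrightarrow> cmod (\<phi> c) \<le> 2 * M"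
    and limit_functional_cong: "bounded (range c) \<Longrightarrow> bounded (range d) \<Longrightarrow>
      (\<forall>\<^sub>F n in sequentially. c n = d n) \<Longrightarrow> \<phi> c = \<phi> d"
  using assms unfolding limit_functional_def by blast+

lemma limit_functional_zero: "limit_functional \<phi> \<Longrightarrow> \<phi> (\<lambda>n. 0) = 0"
  using limit_functional_scaleC[of \<phi> "\<lambda>n. 0" 0] by simp

lemma limit_functional_sum:
  assumes \<phi>: "limit_functional \<phi>" and "\<And>p. p \<in> A \<Longrightarrow> bounded (range (f p))"
  shows "\<phi> (\<lambda>n. \<Sum>p\<in>A. f p n) = (\<Sum>p\<in>A. \<phi> (f p)) \<and> bounded (range (\<lambda>n. \<Sum>p\<in>A. f p n))"
  using assms(2)
proof (induction A rule: infinite_finite_induct)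
  case (insert p A)
  then show ?case
    by (simp add: limit_functional_add[OF \<phi>] bounded_plus_comp)
qed (simp_all add: limit_functional_zero[OF \<phi>])

text \<open>Supplies the functionals of the shifted components; since \<open>g\<close> tends to
  infinity, the indifference to finitely many entries survives.\<close>

lemma limit_functional_reindex:
  assumes \<phi>: "limit_functional \<phi>" and g: "filterlim g sequentially sequentially"
  shows "limit_functional (\<lambda>c. \<phi> (\<lambda>m. c (g m)))"
proof -
  have b: "bounded (range (\<lambda>m. c (g m)))" if "bounded (range c)" for c :: "nat \<Rightarrow> 'a"
    by (rule bounded_subset[OF that]) auto
  have ev: "\<forall>\<^sub>F m in sequentially. c (g m) = d (g m)" if "\<forall>\<^sub>F n in sequentially. c n = d n"
    for c d :: "nat \<Rightarrow> 'a"
    using that g by (rule eventually_compose_filterlim)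
  show ?thesis
    unfolding limit_functional_def
    by (intro conjI allI impI)
      (auto intro!: limit_functional_add[OF \<phi>] limit_functional_scaleC[OF \<phi>] limit_functional_star[OF \<phi>]
        limit_functional_positive[OF \<phi>] limit_functional_norm[OF \<phi>] limit_functional_cong[OF \<phi>] b ev)
qed

lemma limit_functional_trivial: "limit_functional (\<lambda>c. 0)"
  by (auto simp: limit_functional_def intro: order_trans[OF norm_ge_zero])

context positive_kernel
begin

lemma ks_double_sum: "ks L M = (\<Sum>(c, i)\<leftarrow>L. \<Sum>(d, j)\<leftarrow>M. cnj c * d * K i j)"
  by (simp add: ks_def eval_comb_def kvec_def sum_list_const_mult[symmetric] case_prod_unfold mult.assoc)

lemma ks_map_comb: "ks (map_comb a L) (map_comb b M) = (\<Sum>(c, i)\<leftarrow>L. \<Sum>(d, j)\<leftarrow>M. cnj c * d * K (a i) (b j))"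
  by (simp add: ks_double_sum map_comb_def case_prod_unfold comp_def)

text \<open>The kernel \<open>C\<^sup>2\<close> times \<open>K\<close> minus the transformed kernel
  is positive because it is the pullback of \<open>K\<close> under \<open>r\<close>.\<close>

lemma kn_map_comb_le:
  assumes r: "\<And>i j. K (r i) (r j) = complex_of_real (C\<^sup>2) * K i j - K (a i) (a j)" and "0 \<le> C"
  shows "kn (map_comb a L) \<le> C * kn L"
proof (rule power2_le_imp_le)
  have "ks (map_comb r L) (map_comb r L) = complex_of_real (C\<^sup>2) * ks L L - ks (map_comb a L) (map_comb a L)"
    unfolding ks_map_comb r
    by (simp add: ks_double_sum case_prod_unfold right_diff_distrib sum_list_subtractf
        sum_list_const_mult[symmetric] mult.left_commute)
  then have "(kn (map_comb r L))\<^sup>2 = C\<^sup>2 * (kn L)\<^sup>2 - (kn (map_comb a L))\<^sup>2"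
    unfolding kn_square by (simp del: of_real_power)
  then show "(kn (map_comb a L))\<^sup>2 \<le> (C * kn L)\<^sup>2"
    using zero_le_power2[of "kn (map_comb r L)"] by (simp add: power_mult_distrib)
qed (use assms in simp)

text \<open>Linear relations among kernel functions persist for all elements of \<open>H\<close>.
  Linearity of the operators in their parameter thus comes from linearity in the first
  letter.\<close>

lemma H_respects: "F \<in> H \<Longrightarrow> kvec L = kvec M \<Longrightarrow> eval_comb L F = eval_comb M F"
  by (metis ipH_kvec)

end

lemma case_nat_0_Suc: "case_nat (v 0) (\<lambda>n. v (Suc n)) = v"
  by (auto simp: fun_eq_iff split: nat.split)

text \<open>A word consists of a component index, a first letter and the remaining letters; it stands for
  the infinite elementary tensor of its letters. The map \<open>up\<close> moves to the component in which
  words start one letter later. Words with eventually contractive letters have finite norm.\<close>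

locale word_kernel = correspondence ract ip lact
  for ract :: "'e::complex_vector \<Rightarrow> 'b::cstar_algebra \<Rightarrow> 'e"  (infixl "\<cdot>" 70)
    and ip :: "'e \<Rightarrow> 'e \<Rightarrow> 'b"
    and lact :: "'b \<Rightarrow> 'e \<Rightarrow> 'e" +
  fixes \<phi> :: "'j \<Rightarrow> (nat \<Rightarrow> 'b) \<Rightarrow> complex"
    and up down :: "'j \<Rightarrow> 'j"
    and enc :: "'j \<times> 'e \<times> (nat \<Rightarrow> 'e) \<Rightarrow> 'i"
    and dec :: "'i \<Rightarrow> 'j \<times> 'e \<times> (nat \<Rightarrow> 'e)"
  assumes \<phi>: "limit_functional (\<phi> j)"
    and up_down [simp]: "up (down j) = j" "down (up j) = j"
    and \<phi>_up: "bounded (range c) \<Longrightarrow> \<phi> (up j) (\<lambda>n. c (Suc n)) = \<phi> j c"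
    and dec_enc [simp]: "dec (enc s) = s"
begin

definition valid :: "(nat \<Rightarrow> 'e) \<Rightarrow> bool"
  where "valid v \<longleftrightarrow> (\<forall>\<^sub>F n in sequentially. mnorm (v n) \<le> 1)"

text \<open>Different components are orthogonal. Words that are not valid, whose truncations may be
  unbounded, count as zero vectors, which keeps the kernel total.\<close>

fun KK :: "'j \<times> 'e \<times> (nat \<Rightarrow> 'e) \<Rightarrow> 'j \<times> 'e \<times> (nat \<Rightarrow> 'e) \<Rightarrow> complex"
  where "KK (j, y, v) (j', y', v') =
    (if j = j' \<and> valid v \<and> valid v' then \<phi> j (chain (ip y y') v v') else 0)"

text \<open>An index outside the range of \<open>enc\<close> is harmless: it duplicates the kernel
  function of the word to which it decodes, see \<open>kvec_dec\<close>.\<close>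

definition K :: "'i \<Rightarrow> 'i \<Rightarrow> complex"
  where "K i i' = KK (dec i) (dec i')"

lemma valid_Suc [simp]: "valid (\<lambda>n. v (Suc n)) \<longleftrightarrow> valid v"
  unfolding valid_def by (rule eventually_sequentially_Suc[of "\<lambda>n. mnorm (v n) \<le> 1"])

lemma valid_case_nat [simp]: "valid (case_nat y v) \<longleftrightarrow> valid v"
  using valid_Suc[of "case_nat y v"] by simp

lemma chain_bound:
  assumes "valid v" "valid w"
  obtains C where "0 \<le> C" "\<And>a N. norm (chain a v w N) \<le> norm a * C"
proof -
  define P where "P N = (\<Prod>i<N. mnorm (v i) * mnorm (w i))" for N
  have P0: "0 \<le> P N" for N by (simp add: P_def prod_nonneg)
  obtain N0 where N0: "\<And>n. n \<ge> N0 \<Longrightarrow> mnorm (v n) \<le> 1 \<and> mnorm (w n) \<le> 1"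
    using eventually_conj[OF assms[unfolded valid_def]] by (auto simp: eventually_sequentially)
  \<comment> \<open>Beyond \<open>N0\<close> the products no longer grow, so the sum of the first,
    nonnegative values bounds them all.\<close>
  define C where "C = (\<Sum>n\<le>N0. P n)"
  have "P N \<le> C" for N
  proof (induction N)
    case 0
    show ?case unfolding C_def by (rule member_le_sum) (auto simp: P0)
  next
    case (Suc N)
    show ?case
    proof (cases "Suc N \<le> N0")
      case True
      then show ?thesis unfolding C_def by (intro member_le_sum) (auto simp: P0)
    next
      case False
      then have "mnorm (v N) * mnorm (w N) \<le> 1 * 1" using N0[of N] by (intro mult_mono) auto
      then have "P (Suc N) \<le> P N" using mult_left_mono[OF _ P0[of N]] by (fastforce simp: P_def)
      then show ?thesis using Suc by simp
    qed
  qed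
  then have "norm (chain a v w N) \<le> norm a * C" for a N
    using norm_chain[of a v w N] by (simp add: P_def) (meson mult_left_mono norm_ge_zero order_trans)
  moreover have "0 \<le> C" by (simp add: C_def P0 sum_nonneg)
  ultimately show thesis using that by blast
qed

lemma bounded_chain: "valid v \<Longrightarrow> valid w \<Longrightarrow> bounded (range (chain a v w))"
  using chain_bound[of v w] by (metis boundedI rangeE)

lemma KK_cnj: "cnj (KK s t) = KK t s"
proof -
  obtain j y v j' y' v' where st: "s = (j, y, v)" "t = (j', y', v')" by (cases s; cases t)
  have "(\<lambda>n. star (chain (ip y y') v v' n)) = chain (ip y' y) v' v"
    by (simp add: fun_eq_iff star_chain ip_star)
  then show ?thesis using limit_functional_star[OF \<phi> bounded_chain, of v v' j "ip y y'"]
    by (auto simp: st)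
qed

lemma KK_add: "KK s (j, y + y', v) = KK s (j, y, v) + KK s (j, y', v)"
  and KK_scaleC: "KK s (j, z *\<^sub>C y, v) = z * KK s (j, y, v)"
proof -
  obtain j' x w where s: "s = (j', x, w)" by (cases s)
  show "KK s (j, y + y', v) = KK s (j, y, v) + KK s (j, y', v)"
    using limit_functional_add[OF \<phi> bounded_chain bounded_chain, of w v w v j "ip x y" "ip x y'"]
    by (simp add: s ip_add_right chain_add[abs_def])
  show "KK s (j, z *\<^sub>C y, v) = z * KK s (j, y, v)"
    using limit_functional_scaleC[OF \<phi> bounded_chain, of w v j z "ip x y"]
    by (simp add: s ip_scaleC_right chain_scaleC[abs_def])
qed

lemma KK_zero [simp]: "KK s (j, 0, v) = 0"
  using KK_scaleC[of s j 0 0 v] by simp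

lemma KK_diff: "KK s (j, y - y', v) = KK s (j, y, v) - KK s (j, y', v)"
  using KK_add[of s j "y - y'" y' v] by simp

lemma KK_invalid: "\<not> valid v \<Longrightarrow> KK s (j, y, v) = 0"
  by (cases s) auto

lemma KK_scaleC_left: "KK (j, z *\<^sub>C y, v) t = cnj z * KK (j, y, v) t"
  by (metis KK_cnj KK_scaleC complex_cnj_mult)

lemma KK_component_positive:
  fixes y :: "nat \<Rightarrow> 'e"
  assumes "\<And>p. p < n \<Longrightarrow> valid (v p)"
  shows "0 \<le> Re (\<Sum>p<n. \<Sum>q<n. KK (j, y p, v p) (j, y q, v q))"
proof -
  define f where "f p q = chain (ip (y p) (y q)) (v p) (v q)" for p q
  have b: "bounded (range (f p q))" if "p < n" "q < n" for p q
    unfolding f_def by (intro bounded_chain assms that)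
  have 1: "\<phi> j (\<lambda>N. \<Sum>q<n. f p q N) = (\<Sum>q<n. \<phi> j (f p q)) \<and> bounded (range (\<lambda>N. \<Sum>q<n. f p q N))"
    if "p < n" for p
    by (rule limit_functional_sum[OF \<phi>]) (use b that in auto)
  have 2: "\<phi> j (\<lambda>N. \<Sum>p<n. \<Sum>q<n. f p q N) = (\<Sum>p<n. \<phi> j (\<lambda>N. \<Sum>q<n. f p q N)) \<and>
      bounded (range (\<lambda>N. \<Sum>p<n. \<Sum>q<n. f p q N))"
    by (rule limit_functional_sum[OF \<phi>]) (use 1 in auto)
  have "(\<Sum>p<n. \<Sum>q<n. KK (j, y p, v p) (j, y q, v q)) = (\<Sum>p<n. \<Sum>q<n. \<phi> j (f p q))"
    by (intro sum.cong refl) (auto simp: assms f_def)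
  also have "\<dots> = \<phi> j (\<lambda>N. \<Sum>p<n. \<Sum>q<n. f p q N)" using 1 2 by simp
  finally show ?thesis
    using limit_functional_positive[OF \<phi> conjunct2[OF 2]] psd_sum_chain[of y v] by (simp add: f_def)
qed

lemma KK_positive:
  fixes y :: "nat \<Rightarrow> 'e"
  shows "0 \<le> Re (\<Sum>p<n. \<Sum>q<n. KK (j p, y p, v p) (j q, y q, v q))"
proof -
  define J where "J = j ` {..<n}"
  \<comment> \<open>The vectors are split over the finitely many components involved. A vector is
    \<open>0\<close> outside its own component; invalid words get first letter \<open>0\<close> and
    the valid zero tail, so that the result for one component applies.\<close>
  define y' where "y' k p = (if j p = k \<and> valid (v p) then y p else 0)" for k p
  define v' where "v' p = (if valid (v p) then v p else (\<lambda>n. 0))" for p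
  have v': "valid (v' p)" for p by (simp add: v'_def) (simp add: valid_def mnorm_def)
  have zl: "KK (k, 0, u) t = 0" for k u t using KK_scaleC_left[of k 0 0 u t] by simp
  have "KK (j p, y p, v p) (j q, y q, v q) = (\<Sum>k\<in>J. KK (k, y' k p, v' p) (k, y' k q, v' q))" if p: "p < n" for p q
  proof -
    have "(\<Sum>k\<in>J. KK (k, y' k p, v' p) (k, y' k q, v' q))
        = (\<Sum>k\<in>J. if k = j p then KK (j p, y' (j p) p, v' p) (j p, y' (j p) q, v' q) else 0)"
      by (intro sum.cong refl) (auto simp: y'_def zl simp del: KK.simps)
    also have "\<dots> = KK (j p, y' (j p) p, v' p) (j p, y' (j p) q, v' q)"
      using p by (simp add: J_def del: KK.simps)
    also have "\<dots> = KK (j p, y p, v p) (j q, y q, v q)"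
      using KK_zero[of "(j p, y' (j p) p, v' p)" "j p" "v' q"] zl[of "j p" "v' p" "(j p, y' (j p) q, v' q)"]
      by (auto simp: y'_def v'_def simp del: KK_zero)
    finally show ?thesis by simp
  qed
  then have "(\<Sum>p<n. \<Sum>q<n. KK (j p, y p, v p) (j q, y q, v q))
      = (\<Sum>p<n. \<Sum>q<n. \<Sum>k\<in>J. KK (k, y' k p, v' p) (k, y' k q, v' q))"
    by (intro sum.cong refl) simp
  also have "\<dots> = (\<Sum>p<n. \<Sum>k\<in>J. \<Sum>q<n. KK (k, y' k p, v' p) (k, y' k q, v' q))"
    by (intro sum.cong refl sum.swap)
  also have "\<dots> = (\<Sum>k\<in>J. \<Sum>p<n. \<Sum>q<n. KK (k, y' k p, v' p) (k, y' k q, v' q))"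
    by (rule sum.swap)
  finally show ?thesis using KK_component_positive[OF v'] by (simp add: sum_nonneg del: KK.simps)
qed

sublocale positive_kernel K
proof
  show "cnj (K i j) = K j i" for i j by (simp add: K_def KK_cnj)
  fix L :: "(complex \<times> 'i) list"
  define n where "n = length L"
  define c where "c p = fst (L ! p)" for p
  define i where "i p = snd (L ! p)" for p
  define j where "j p = fst (dec (i p))" for p
  define y where "y p = fst (snd (dec (i p)))" for p
  define v where "v p = snd (snd (dec (i p)))" for p
  have dec: "dec (i p) = (j p, y p, v p)" for p by (simp add: j_def y_def v_def)
  have "(\<Sum>(c, i)\<leftarrow>L. cnj c * (\<Sum>(d, j)\<leftarrow>L. d * K i j))
      = (\<Sum>p<n. cnj (c p) * (\<Sum>q<n. c q * K (i p) (i q)))"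
    by (simp add: sum_list_sum_nth case_prod_unfold n_def c_def i_def atLeast0LessThan)
  \<comment> \<open>Coefficients are absorbed into the first letters, so positivity is needed only
    for plain sums of words.\<close>
  also have "\<dots> = (\<Sum>p<n. \<Sum>q<n. KK (j p, c p *\<^sub>C y p, v p) (j q, c q *\<^sub>C y q, v q))"
    unfolding K_def dec KK_scaleC KK_scaleC_left by (simp add: sum_distrib_left mult_ac del: KK.simps)
  finally show "0 \<le> Re (\<Sum>(c, i)\<leftarrow>L. cnj c * (\<Sum>(d, j)\<leftarrow>L. d * K i j))"
    using KK_positive by (simp del: KK.simps)
qed

section \<open>The operators on words\<close>

definition lift :: "('j \<times> 'e \<times> (nat \<Rightarrow> 'e) \<Rightarrow> 'j \<times> 'e \<times> (nat \<Rightarrow> 'e)) \<Rightarrow> 'i \<Rightarrow> 'i"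
  where "lift f i = enc (f (dec i))"

fun lmap :: "'b \<Rightarrow> 'j \<times> 'e \<times> (nat \<Rightarrow> 'e) \<Rightarrow> 'j \<times> 'e \<times> (nat \<Rightarrow> 'e)"
  where "lmap b (j, y, v) = (j, lact b y, v)"

text \<open>The creation operator: the former first letter opens the tail, and \<open>down\<close>
  records that the word now starts one letter earlier.\<close>

fun cmap :: "'e \<Rightarrow> 'j \<times> 'e \<times> (nat \<Rightarrow> 'e) \<Rightarrow> 'j \<times> 'e \<times> (nat \<Rightarrow> 'e)"
  where "cmap x (j, y, v) = (down j, x, case_nat y v)"

text \<open>The annihilation operator, adjoint to \<open>cmap x\<close>: pairing \<open>x\<close>
  with the first letter yields an algebra element, which then acts on the second letter.\<close>

fun amap :: "'e \<Rightarrow> 'j \<times> 'e \<times> (nat \<Rightarrow> 'e) \<Rightarrow> 'j \<times> 'e \<times> (nat \<Rightarrow> 'e)"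
  where "amap x (j, y, v) = (up j, lact (ip x y) (v 0), \<lambda>n. v (Suc n))"

lemma lift_lift [simp]: "lift f (lift g i) = enc (f (g (dec i)))"
  by (simp add: lift_def)

lemma K_lift_left: "K (lift f i) j = KK (f (dec i)) (dec j)"
  and K_lift_right: "K i (lift f j) = KK (dec i) (f (dec j))"
  by (simp_all add: K_def lift_def)

lemma KK_lmap: "KK (lmap b s) t = KK s (lmap (star b) t)"
  by (cases s; cases t) (simp add: lact_star)

text \<open>Pairing off the new letter shifts the sequence of truncations by one, by
  \<open>chain_Suc_front\<close>; \<open>\<phi>_up\<close> absorbs the shift in the change of
  component.\<close>

lemma KK_cmap: "KK (cmap x s) t = KK s (amap x t)"
proof -
  obtain j y v j' y' v' where st: "s = (j, y, v)" "t = (j', y', v')" by (cases s; cases t)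
  show ?thesis
  proof (cases "j = up j' \<and> valid v \<and> valid v'")
    case True
    have "KK (cmap x s) t = \<phi> (down j) (chain (ip x y') (case_nat y v) v')"
      using True by (auto simp: st)
    also have "\<dots> = \<phi> (up (down j)) (\<lambda>N. chain (ip x y') (case_nat y v) v' (Suc N))"
      using True by (intro \<phi>_up[symmetric] bounded_chain) auto
    also have "\<dots> = \<phi> j (chain (ip y (lact (ip x y') (v' 0))) v (\<lambda>n. v' (Suc n)))"
      by (simp add: chain_Suc_front del: chain.simps)
    also have "\<dots> = KK s (amap x t)" using True by (auto simp: st)
    finally show ?thesis .
  next
    case False
    then have "down j \<noteq> j' \<or> \<not> valid v \<or> \<not> valid v'" by auto
    then show ?thesis using False by (auto simp: st)
  qed
qed

text \<open>Applying the map of \<open>lact_defect\<close> to the first letter gives the pullback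
  that \<open>kn_map_comb_le\<close> asks for.\<close>

lemma kn_lmap: "kn (map_comb (lift (lmap b)) L) \<le> norm b * kn L"
proof -
  obtain r where r: "\<And>x y. ip (r x) (r y) = (norm b)\<^sup>2 *\<^sub>R ip x y - ip (lact b x) (lact b y)"
    using lact_defect by metis
  define R where "R = (\<lambda>(j :: 'j, y, v :: nat \<Rightarrow> 'e). (j, r y, v))"
  have "KK (R s) (R t) = complex_of_real ((norm b)\<^sup>2) * KK s t - KK (lmap b s) (lmap b t)" for s t
  proof -
    obtain j y v j' y' v' where st: "s = (j, y, v)" "t = (j', y', v')" by (cases s; cases t)
    show ?thesis
    proof (cases "j = j' \<and> valid v \<and> valid v'")
      case True
      let ?c = "chain (ip y y') v v'" and ?d = "chain (ip (lact b y) (lact b y')) v v'"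
      have b: "bounded (range ?c)" "bounded (range ?d)" using True by (simp_all add: bounded_chain)
      have bs: "bounded (range (\<lambda>n. z *\<^sub>C chain a v v' n))" for z a
        using bounded_chain[of v v' "z *\<^sub>C a"] True by (simp add: chain_scaleC[abs_def])
      have "chain (ip (r y) (r y')) v v'
          = (\<lambda>n. complex_of_real ((norm b)\<^sup>2) *\<^sub>C ?c n + complex_of_real (- 1) *\<^sub>C ?d n)"
        by (simp add: fun_eq_iff r chain_diff scaleR_scaleC chain_scaleC)
      then have "\<phi> j (chain (ip (r y) (r y')) v v')
          = complex_of_real ((norm b)\<^sup>2) * \<phi> j ?c + complex_of_real (- 1) * \<phi> j ?d"
        by (simp only: limit_functional_add[OF \<phi> bs bs] limit_functional_scaleC[OF \<phi> b(1)]
            limit_functional_scaleC[OF \<phi> b(2)])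
      then show ?thesis using True by (auto simp: st R_def)
    qed (auto simp: st R_def)
  qed
  then show ?thesis by (intro kn_map_comb_le[of "lift R"]) (simp_all add: K_def lift_def)
qed

lemma adjoint_lmap: "adjoint_maps (lift (lmap b)) (lift (lmap (star b)))"
  by (rule adjoint_mapsI[OF _ kn_lmap]) (simp add: K_lift_left K_lift_right KK_lmap)

lemma amap_cmap: "amap x (cmap y s) = lmap (ip x y) s"
  by (cases s) simp

text \<open>Annihilation after creation by \<open>x\<close> is the action of
  \<open>ip x x = star c * c\<close>, so creation has the same effect on norms as the action of
  \<open>c\<close>.\<close>

lemma adjoint_cmap: "adjoint_maps (lift (cmap x)) (lift (amap x))"
proof -
  obtain c where c: "ip x x = star c * c" using ip_positive[of x] by (auto simp: cstar_positive_def)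
  have lmap_mult: "lmap (star c * c) s = lmap (star c) (lmap c s)" for s
    by (cases s) (simp add: lact_mult)
  have "kn (map_comb (lift (cmap x)) L) \<le> norm c * kn L" for L
  proof -
    have "K (lift (cmap x) i) (lift (cmap x) j) = K (lift (lmap c) i) (lift (lmap c) j)" for i j
      unfolding K_def lift_def dec_enc KK_cmap amap_cmap c lmap_mult KK_lmap ..
    then have "ks (map_comb (lift (cmap x)) L) (map_comb (lift (cmap x)) L)
        = ks (map_comb (lift (lmap c)) L) (map_comb (lift (lmap c)) L)"
      by (simp add: ks_map_comb)
    then show ?thesis using kn_lmap[of c L] by (simp add: kn_def)
  qed
  then show ?thesis
    by (rule adjoint_mapsI[rotated]) (simp add: K_lift_left K_lift_right KK_cmap)
qed

text \<open>The star compensates for the adjoint hidden in \<open>precomp\<close>: on kernel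
  functions \<open>pi_op b\<close> acts as \<open>lmap b\<close>. Likewise \<open>eta_op x\<close>
  precomposes with annihilation and acts as creation.\<close>

definition pi_op :: "'b \<Rightarrow> ('i \<Rightarrow> complex) \<Rightarrow> 'i \<Rightarrow> complex"
  where "pi_op b = precomp (lift (lmap (star b)))"

definition eta_op :: "'e \<Rightarrow> ('i \<Rightarrow> complex) \<Rightarrow> 'i \<Rightarrow> complex"
  where "eta_op x = precomp (lift (amap x))"

lemma adjoint_pi: "adjoint_maps (lift (lmap (star b))) (lift (lmap b))"
  using adjoint_lmap[of "star b"] by (simp add: star_star)

lemma adjoint_eta: "adjoint_maps (lift (amap x)) (lift (cmap x))"
  by (rule adjoint_maps_sym[OF adjoint_cmap])

lemma pi_op_apply: "F \<in> H \<Longrightarrow> pi_op b F i = F (enc (lmap (star b) (dec i)))"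
  by (simp add: pi_op_def precomp_apply lift_def)

lemma eta_op_apply: "F \<in> H \<Longrightarrow> eta_op x F i = F (enc (amap x (dec i)))"
  by (simp add: eta_op_def precomp_apply lift_def)

lemma pi_op_in_H: "F \<in> H \<Longrightarrow> pi_op b F \<in> H"
  by (simp add: pi_op_def precomp_apply comp_in_H[OF adjoint_pi])

lemma eta_op_in_H: "F \<in> H \<Longrightarrow> eta_op x F \<in> H"
  by (simp add: eta_op_def precomp_apply comp_in_H[OF adjoint_eta])

lemma H_add_letter: "F \<in> H \<Longrightarrow> F (enc (j, y + y', v)) = F (enc (j, y, v)) + F (enc (j, y', v))"
  using H_respects[of F "[(1, enc (j, y + y', v))]" "[(1, enc (j, y, v)), (1, enc (j, y', v))]"]
  by (simp add: fun_eq_iff kvec_def K_def KK_add eval_comb_def del: KK.simps)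

lemma H_scaleC_letter: "F \<in> H \<Longrightarrow> F (enc (j, z *\<^sub>C y, v)) = cnj z * F (enc (j, y, v))"
  using H_respects[of F "[(1, enc (j, z *\<^sub>C y, v))]" "[(z, enc (j, y, v))]"]
  by (simp add: fun_eq_iff kvec_def K_def KK_scaleC eval_comb_def del: KK.simps)

lemma adj_eta: "adj H ipH (eta_op x) = precomp (lift (cmap x))"
  unfolding eta_op_def by (rule adj_precomp[OF adjoint_eta])

lemma kvec_dec: "kvec [(1, i)] = kvec [(1, enc (dec i))]"
  by (simp add: fun_eq_iff kvec_def K_def)

lemma pi_op_kvec: "pi_op b (kvec [(1, enc s)]) = kvec [(1, enc (lmap b s))]"
  unfolding pi_op_def precomp_kvec[OF adjoint_pi] by (simp add: map_comb_def lift_def)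

lemma eta_op_kvec: "eta_op x (kvec [(1, enc s)]) = kvec [(1, enc (cmap x s))]"
  unfolding eta_op_def precomp_kvec[OF adjoint_eta] by (simp add: map_comb_def lift_def)

lemma kvec_letter_diff:
  "kvec [(1, enc (j, y, v))] - kvec [(1, enc (j, y', v))] = kvec [(1, enc (j, y - y', v))]"
  by (simp add: fun_eq_iff kvec_def K_def KK_diff del: KK.simps)

lemma pi_op_nondegenerate: "closed_span H (hnorm ipH) {pi_op b v |b v. v \<in> H} = H"
  (is "closed_span H _ ?S = H")
proof (rule closed_span_eq_H)
  show "s \<in> H" if "s \<in> ?S" for s using that pi_op_in_H by auto
  fix i and e :: real assume e: "0 < e"
  obtain j y v where i: "dec i = (j, y, v)" by (cases "dec i")
  show "\<exists>u\<in>complex_vector.span ?S. hnorm ipH (kvec [(1, i)] - u) < e"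
  proof (cases "valid v")
    case False
    then have "kvec [(1, i)] - 0 = kvec []" by (simp add: fun_eq_iff kvec_def K_def i KK_invalid del: KK.simps)
    then have lt: "hnorm ipH (kvec [(1, i)] - 0) < e" using hnorm_kvec[of "[]"] e by (simp only: kn_def ks_simps) simp
    show ?thesis by (rule bexI, rule lt, rule complex_vector.span_zero)
  next
    case True
    obtain C where C: "0 \<le> C" "\<And>a N. norm (chain a v v N) \<le> norm a * C"
      using chain_bound[OF True True] by metis
    \<comment> \<open>The squared norm of a word with first letter \<open>y - u\<close> and tail
      \<open>v\<close> is at most \<open>2 * C\<close> times that of \<open>y - u\<close>, the
      \<open>2\<close> being the constant of limit functionals; \<open>C + 1\<close> stays
      positive.\<close>
    define \<epsilon> where "\<epsilon> = e / sqrt (2 * (C + 1))"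
    have \<epsilon>: "\<epsilon> > 0" using e C by (simp add: \<epsilon>_def)
    have "y \<in> closed_span UNIV (\<lambda>x. sqrt (norm (ip x x))) {lact b x |b x. True}"
      using lact_nondegenerate by blast
    then obtain u where u: "u \<in> complex_vector.span {lact b x |b x. True}" "mnorm (y - u) < \<epsilon>"
      using \<epsilon> by (auto simp: closed_span_def mnorm_def)
    define W where "W y = kvec [(1, enc (j, y, v))]" for y
    have W_add: "W (x + z) = W x + W z" for x z
      by (simp add: W_def fun_eq_iff kvec_def K_def KK_add del: KK.simps)
    have W_scale: "W (c *\<^sub>C x) = c *\<^sub>C W x" for c x
      by (simp add: W_def fun_eq_iff kvec_def K_def KK_scaleC scaleC_fun_def scaleC_complex_def del: KK.simps)
    have "W u \<in> complex_vector.span ?S"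
      using u(1)
    proof (induction rule: complex_vector.span_induct_alt)
      case base
      have "W 0 = 0" using W_scale[of 0 0] by simp
      then show ?case by (simp only: complex_vector.span_zero)
    next
      case (step c x y)
      then obtain b z where x: "x = lact b z" by blast
      have "W x = pi_op b (W z)" by (simp add: W_def x pi_op_kvec)
      then have "W x \<in> ?S" using kvec_in_H by (auto simp: W_def)
      then show ?case using step unfolding W_add W_scale
        by (intro complex_vector.span_add complex_vector.span_scale) (auto intro: complex_vector.span_base)
    qed
    moreover have "hnorm ipH (kvec [(1, i)] - W u) < e"
    proof -
      let ?d = "y - u"
      have "hnorm ipH (kvec [(1, i)] - W u) = kn [(1, enc (j, ?d, v))]"
        unfolding kvec_dec[of i] i W_def kvec_letter_diff hnorm_kvec ..
      also have "\<dots> < e"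
      proof (rule power2_less_imp_less)
        have "(kn [(1, enc (j, ?d, v))])\<^sup>2 = Re (\<phi> j (chain (ip ?d ?d) v v))"
          using True by (simp add: kn_square ks_double_sum K_def)
        also have "\<dots> \<le> 2 * (norm (ip ?d ?d) * C)"
          using complex_Re_le_cmod limit_functional_norm[OF \<phi> C(2)] by (rule order_trans)
        also have "\<dots> \<le> (mnorm ?d)\<^sup>2 * (2 * (C + 1))" by (simp add: mnorm_square algebra_simps)
        also have "\<dots> < \<epsilon>\<^sup>2 * (2 * (C + 1))"
          using u(2) C(1) by (intro mult_strict_right_mono power_strict_mono) auto
        also have "\<dots> = e\<^sup>2" using C(1) by (simp add: \<epsilon>_def power_divide)
        finally show "(kn [(1, enc (j, ?d, v))])\<^sup>2 < e\<^sup>2" .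
      qed (use e in simp)
      finally show ?thesis .
    qed
    ultimately show ?thesis by blast
  qed
qed

lemma eta_op_nondegenerate: "closed_span H (hnorm ipH) {eta_op x v |x v. v \<in> H} = H"
  (is "closed_span H _ ?S = H")
proof (rule closed_span_eq_H)
  show "s \<in> H" if "s \<in> ?S" for s using that eta_op_in_H by auto
  fix i and e :: real assume e: "0 < e"
  obtain j y v where i: "dec i = (j, y, v)" by (cases "dec i")
  \<comment> \<open>Prefixing lowers the component, so the word without its first letter is placed
    in \<open>up j\<close>.\<close>
  have "kvec [(1, i)] = eta_op y (kvec [(1, enc (up j, v 0, \<lambda>n. v (Suc n)))])"
    unfolding kvec_dec[of i] i eta_op_kvec by (simp add: case_nat_0_Suc)
  then have "kvec [(1, i)] \<in> ?S" using kvec_in_H by blast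
  then have "kvec [(1, i)] \<in> complex_vector.span ?S" by (rule complex_vector.span_base)
  moreover have "hnorm ipH (kvec [(1, i)] - kvec [(1, i)]) < e"
    using e hnorm_kvec[of "[]"] by (simp add: kn_def)
  ultimately show "\<exists>u\<in>complex_vector.span ?S. hnorm ipH (kvec [(1, i)] - u) < e"
    by (rule bexI[of _ "kvec [(1, i)]", rotated])
qed

lemma nondegenerate_representation: "nondegenerate_representation ract ip lact H ipH pi_op eta_op"
proof
  fix b c :: 'b and x y :: 'e and z :: complex
  show "pi_op b \<in> bounded_ops H ipH" unfolding pi_op_def by (rule precomp_bounded[OF adjoint_pi])
  show "eta_op x \<in> bounded_ops H ipH" unfolding eta_op_def by (rule precomp_bounded[OF adjoint_eta])
  show "pi_op (star b) = adj H ipH (pi_op b)"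
    unfolding pi_op_def adj_precomp[OF adjoint_pi] by (simp add: star_star)
  show "closed_span H (hnorm ipH) {pi_op b v |b v. v \<in> H} = H" by (rule pi_op_nondegenerate)
  show "closed_span H (hnorm ipH) {eta_op x v |x v. v \<in> H} = H" by (rule eta_op_nondegenerate)
  show "pi_op (b * c) = compose H (pi_op b) (pi_op c)"
  proof
    fix F
    show "pi_op (b * c) F = compose H (pi_op b) (pi_op c) F"
    proof (cases "F \<in> H")
      case True
      \<comment> \<open>Precomposition reverses the order of products and the star reverses it back,
        so the relations reduce to identities of maps on words.\<close>
      have "lmap (star (b * c)) s = lmap (star c) (lmap (star b) s)" for s
        by (cases s) (simp add: star_mult lact_mult)
      then show ?thesis using True
        by (simp add: compose_def fun_eq_iff pi_op_apply pi_op_in_H)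
    qed (simp add: compose_def pi_op_def precomp_def)
  qed
  show "compose H (adj H ipH (eta_op x)) (eta_op y) = pi_op (ip x y)"
  proof
    fix F
    show "compose H (adj H ipH (eta_op x)) (eta_op y) F = pi_op (ip x y) F"
      by (cases "F \<in> H")
        (simp_all add: compose_def fun_eq_iff pi_op_apply eta_op_apply eta_op_in_H adj_eta
          precomp_apply lift_def amap_cmap ip_star, simp add: pi_op_def precomp_def)
  qed
  show "eta_op (lact b (x \<cdot> c)) = compose H (pi_op b) (compose H (eta_op x) (pi_op c))"
  proof
    fix F
    show "eta_op (lact b (x \<cdot> c)) F = compose H (pi_op b) (compose H (eta_op x) (pi_op c)) F"
    proof (cases "F \<in> H")
      case True
      have "amap (lact b (x \<cdot> c)) s = lmap (star c) (amap x (lmap (star b) s))" for s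
        by (cases s) (simp add: lact_star ip_ract_left lact_mult)
      then show ?thesis using True
        by (simp add: compose_def fun_eq_iff pi_op_apply eta_op_apply pi_op_in_H eta_op_in_H)
    qed (simp add: compose_def eta_op_def precomp_def)
  qed
  fix F assume F: "F \<in> H"
  have lmap_add: "F (enc (lmap (b + c) s)) = F (enc (lmap b s)) + F (enc (lmap c s))" for b c s
    by (cases s) (simp add: lact_add H_add_letter F)
  have lmap_scale: "F (enc (lmap (z *\<^sub>C b) s)) = cnj z * F (enc (lmap b s))" for z b s
    by (cases s) (simp add: lact_scaleC H_scaleC_letter F)
  have amap_add: "F (enc (amap (x + y) s)) = F (enc (amap x s)) + F (enc (amap y s))" for x y s
    by (cases s) (simp add: ip_add_left lact_add H_add_letter F)
  have amap_scale: "F (enc (amap (z *\<^sub>C x) s)) = z * F (enc (amap x s))" for z x s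
    by (cases s) (simp add: ip_scaleC_left lact_scaleC H_scaleC_letter F)
  show "pi_op (b + c) F = pi_op b F + pi_op c F" "pi_op (z *\<^sub>C b) F = z *\<^sub>C pi_op b F"
    "eta_op (x + y) F = eta_op x F + eta_op y F" "eta_op (z *\<^sub>C x) F = z *\<^sub>C eta_op x F"
    by (simp_all add: fun_eq_iff pi_op_apply eta_op_apply F star_add star_scaleC lmap_add lmap_scale
        amap_add amap_scale scaleC_fun_def scaleC_complex_def)
qed

text \<open>If \<open>b\<close> and \<open>c\<close> act alike, the kernel function of the word with
  first letter \<open>lact (b - c) y\<close> vanishes, while its value at its own index is the
  squared norm of that word.\<close>

lemma pi_op_inj:
  assumes "\<And>d. d \<noteq> 0 \<Longrightarrow> \<exists>j y v. KK (j, lact d y, v) (j, lact d y, v) \<noteq> 0"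
  shows "inj pi_op"
proof (rule injI, rule ccontr)
  fix b c assume eq: "pi_op b = pi_op c" and "b \<noteq> c"
  then obtain j y v where KK: "KK (j, lact (b - c) y, v) (j, lact (b - c) y, v) \<noteq> 0"
    using assms[of "b - c"] by auto
  have "kvec [(1, enc (j, lact b y, v))] = kvec [(1, enc (j, lact c y, v))]"
    using pi_op_kvec[of b "(j, y, v)"] pi_op_kvec[of c "(j, y, v)"] by (simp add: eq)
  then have "kvec [(1, enc (j, lact (b - c) y, v))] = 0"
    using kvec_letter_diff[of j "lact b y" v "lact c y"] by (simp add: lact_diff_left)
  then have "kvec [(1, enc (j, lact (b - c) y, v))] (enc (j, lact (b - c) y, v)) = 0" by simp
  then show False using KK by (simp add: kvec_def K_def del: KK.simps)
qed

end

section \<open>Separating functionals and the encoding of words\<close>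

lemma (in faithful_correspondence) exists_faithful_functional:
  assumes "b \<noteq> 0"
  shows "\<exists>\<phi> y v. limit_functional \<phi> \<and> (\<forall>n. mnorm (v n) \<le> 1) \<and>
    \<phi> (chain (ip (lact b y) (lact b y)) v v) \<noteq> 0"
proof -
  obtain y where "lact b y \<noteq> 0"
    using assms lact_faithful by (metis ext inj_eq lact_zero_left)
  define h where "h = ip (lact b y) (lact b y)"
  have h: "psd (uemb h)" "norm h > 0"
    using psd_ip ip_definite \<open>lact b y \<noteq> 0\<close> by (auto simp: h_def)
  \<comment> \<open>Half the norm is strictly below \<open>norm h\<close>, as the choice of letters
    demands, and positive, so that the functional does not vanish.\<close>
  obtain v where v: "\<And>n. mnorm (v n) \<le> 1" "\<And>n. norm h / 2 < norm (chain h v v n)"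
    using exists_word_chain_bounded_below[OF h(1), of "norm h / 2"] h(2) by auto
  have "norm (chain h v v n) \<le> norm h" for n
  proof -
    have "(\<Prod>i<n. mnorm (v i) * mnorm (v i)) \<le> 1"
      using v(1) by (intro prod_le_1) (auto intro: mult_le_one)
    then show ?thesis using norm_chain[of h v v n] by (meson mult_left_le norm_ge_zero order_trans)
  qed
  then have "bounded (range (chain h v v))" by (auto intro!: boundedI)
  then obtain \<phi> where "limit_functional \<phi>" "norm h / 2 \<le> Re (\<phi> (chain h v v))"
    using exists_limit_functional[of "chain h v v" "norm h / 2"] psd_chain[OF h(1)] v(2) less_imp_le
    by metis
  then show ?thesis using v(1) h(2) unfolding h_def by (auto intro!: exI[of _ \<phi>] exI[of _ y] exI[of _ v])
qed

text \<open>The index type is dictated by the ambient space: complex functions on lists. A word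
  becomes the indicator function of a set of lists, of which the one of length three records
  component and first letter, and those of length two record position and letter in the
  tail.\<close>

definition word_code ::
    "('b \<times> int) \<times> 'e \<times> (nat \<Rightarrow> 'e) \<Rightarrow> (nat + 'b + 'e) list \<Rightarrow> complex"
  where "word_code = (\<lambda>((b, k), y, v) l.
    if l = [Inl (to_nat k), Inr (Inl b), Inr (Inr y)] \<or> (\<exists>n. l = [Inl n, Inr (Inr (v n))]) then 1 else 0)"

lemma inj_word_code: "inj (word_code :: ('b \<times> int) \<times> 'e \<times> (nat \<Rightarrow> 'e) \<Rightarrow> _)"
proof (rule injI)
  fix s t :: "('b \<times> int) \<times> 'e \<times> (nat \<Rightarrow> 'e)" assume eq: "word_code s = word_code t"
  obtain b k y v where s: "s = ((b, k), y, v)" by (metis surj_pair)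
  obtain b' k' y' v' where t: "t = ((b', k'), y', v')" by (metis surj_pair)
  have "word_code t [Inl (to_nat k), Inr (Inl b), Inr (Inr y)] = 1"
    unfolding eq[symmetric] by (simp add: s word_code_def)
  then have "b = b'" "k = k'" "y = y'" by (auto simp: t word_code_def split: if_splits)
  moreover have "v n = v' n" for n
  proof -
    have "word_code t [Inl n, Inr (Inr (v n))] = 1"
      unfolding eq[symmetric] by (simp add: s word_code_def)
    then show ?thesis by (auto simp: t word_code_def split: if_splits)
  qed
  ultimately show "s = t" by (auto simp: s t)
qed

lemma filterlim_nat_int_minus: "filterlim (\<lambda>m. nat (int m - k)) sequentially sequentially"
  unfolding filterlim_at_top
proof
  fix Z
  show "\<forall>\<^sub>F m in sequentially. Z \<le> nat (int m - k)"
    by (rule eventually_sequentiallyI[of "Z + nat \<bar>k\<bar>"]) linarith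
qed

theorem theorem8p3:
  fixes ract :: "'e::complex_vector \<Rightarrow> 'b::cstar_algebra \<Rightarrow> 'e"
    and ip :: "'e \<Rightarrow> 'e \<Rightarrow> 'b"
    and lact :: "'b \<Rightarrow> 'e \<Rightarrow> 'e"
  assumes "faithful_correspondence ract ip lact"
  shows "\<exists>(G :: ('b, 'e) ambient set) ipG \<pi> \<eta>.
    faithful_representation ract ip lact G ipG \<pi> \<eta> \<and>
    nondegenerate_representation ract ip lact G ipG \<pi> \<eta>"
proof -
  interpret faithful_correspondence ract ip lact by (rule assms)
  \<comment> \<open>For \<open>b = 0\<close> any limit functional will do; one is chosen for every
    \<open>b\<close>, so that the whole algebra indexes components.\<close>
  define good where "good b \<phi> \<longleftrightarrow> limit_functional \<phi> \<and> (b \<noteq> 0 \<longrightarrow> (\<exists>y v. (\<forall>n. mnorm (v n) \<le> 1) \<and>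
    \<phi> (chain (ip (lact b y) (lact b y)) v v) \<noteq> 0))" for b \<phi>
  have "\<exists>\<phi>. good b \<phi>" for b
    using exists_faithful_functional[of b] limit_functional_trivial
    by (cases "b = 0") (auto simp: good_def)
  then obtain \<Phi> where \<Phi>: "\<And>b. good b (\<Phi> b)" by metis
  \<comment> \<open>Component \<open>(b, k)\<close> applies the functional of \<open>b\<close> to
    the sequence delayed by \<open>k\<close>. The truncation by \<open>nat\<close> affects finitely
    many \<open>m\<close>, which limit functionals ignore.\<close>
  define \<phi> where "\<phi> j c = \<Phi> (fst j) (\<lambda>m. c (nat (int m - snd j)))" for j :: "'b \<times> int" and c
  define up where "up j = (fst j, snd j + 1)" for j :: "'b \<times> int"
  define down where "down j = (fst j, snd j - 1)" for j :: "'b \<times> int"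
  interpret word_kernel ract ip lact \<phi> up down word_code "inv word_code"
  proof
    fix j :: "'b \<times> int" and c :: "nat \<Rightarrow> 'b"
    have lim: "limit_functional (\<Phi> (fst j))" using \<Phi>[of "fst j"] by (simp add: good_def)
    show "limit_functional (\<phi> j)"
      unfolding \<phi>_def by (rule limit_functional_reindex[OF lim filterlim_nat_int_minus])
    show "up (down j) = j" "down (up j) = j" by (simp_all add: up_def down_def)
    assume c: "bounded (range c)"
    show "\<phi> (up j) (\<lambda>n. c (Suc n)) = \<phi> j c"
      unfolding \<phi>_def up_def fst_conv snd_conv
    proof (rule limit_functional_cong[OF lim])
      show "\<forall>\<^sub>F m in sequentially. c (Suc (nat (int m - (snd j + 1)))) = c (nat (int m - snd j))"
      proof (rule eventually_sequentiallyI[of "nat (snd j + 1)"])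
        fix m assume "nat (snd j + 1) \<le> m"
        then have "Suc (nat (int m - (snd j + 1))) = nat (int m - snd j)" by linarith
        then show "c (Suc (nat (int m - (snd j + 1)))) = c (nat (int m - snd j))" by simp
      qed
    qed (rule bounded_subset[OF c], blast)+
  qed (simp add: inj_word_code)
  have "inj pi_op"
  proof (rule pi_op_inj)
    fix d :: 'b assume "d \<noteq> 0"
    then obtain y v where "\<forall>n. mnorm (v n) \<le> 1" "\<Phi> d (chain (ip (lact d y) (lact d y)) v v) \<noteq> 0"
      using \<Phi>[of d] by (auto simp: good_def)
    \<comment> \<open>In component \<open>(d, 0)\<close> the delay is trivial, so
      \<open>\<phi>\<close> is the functional chosen for \<open>d\<close>.\<close>
    then have "KK ((d, 0), lact d y, v) ((d, 0), lact d y, v) \<noteq> 0"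
      by (simp add: valid_def \<phi>_def)
    then show "\<exists>j y v. KK (j, lact d y, v) (j, lact d y, v) \<noteq> 0" by blast
  qed
  then have "faithful_representation ract ip lact H ipH pi_op eta_op"
    using nondegenerate_representation
    by (simp add: faithful_representation_def faithful_representation_axioms_def
        nondegenerate_representation_def)
  then show ?thesis using nondegenerate_representation by blast
qed

end
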